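(* Let $y\in\mathcal I(S_\infty)$ and $z\in\mathcal I_{\mathrm{FPF}}(S_\infty)$. (a) $\hat F_y$ is a Schur function if and only if $y=1_m\times g_k$ for some $m,k\in\mathbb N=\{0,1,2,\dots\}$. (b) $\hat F^{\mathrm{FPF}}_z$ is a Schur function if and only if $z=v_m\times g_k\times v_n$ for some $m,n\in\mathbb N$ and some positive integer $k$.
   Context: $S_\infty$ is the group of permutations of $\{1,2,\dots\}$ with finite support; $S_n\subset S_\infty$ consists of the permutations fixing all $i>n$; $s_i=(i,i+1)$. $\mathcal I(S_\infty)=\{w\in S_\infty:w=w^{-1}\}$, $\mathcal I_{\mathrm{FPF}}(S_{2n})$ is the set of involutions in $S_{2n}$ with no fixed points in $\{1,\dots,2n\}$, and $\mathcal I_{\mathrm{FPF}}(S_\infty)=\bigcup_{n\ge1}\mathcal I_{\mathrm{FPF}}(S_{2n})$. Let $v_n=(1,2)(3,4)\cdots(2n-1,2n)\in S_{2n}$ and $g_k=(1,k+1)(2,k+2)\cdots(k,2k)\in S_{2k}$ (with $v_0,g_0$ trivial). For $u\in S_m$ and $w\in S_k$, $u\times w=[u(1),\dots,u(m),w(1)+m,\dots,w(k)+m]\in S_{m+k}$ in one-line notation, and $1_m$ is the identity of $S_m$. For an involution $y$, set $y\rtimes s_i = ys_i$ if $ys_i=s_iy$ and $y\rtimes s_i=s_iys_i$ otherwise. An involution word for an involution $z$ is a sequence of positive integers $(a_1,\dots,a_k)$ of shortest possible length such that $z=(\cdots((1\rtimes s_{a_1})\rtimes s_{a_2})\rtimes\cdots)\rtimes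 s_{a_k}$. For involutions $y,z$, $\hat{\mathcal R}(y,z)$ is the set of sequences which, when appended to involution words of $y$, produce involution words of $z$ (this does not depend on the chosen involution word of $y$). For a sequence $a=(a_1,\dots,a_k)$ of positive integers, $C(a)$ is the set of sequences of positive integers $I=(i_1\le\dots\le i_k)$ with $i_j<i_{j+1}$ whenever $a_j<a_{j+1}$; $x_I=x_{i_1}\cdots x_{i_k}$. The involution Stanley symmetric functions are $\hat F_{y,z}=\sum_{a\in\hat{\mathcal R}(y,z)}\sum_{I\in C(a)}x_I$, $\hat F_y=\hat F_{1,y}$, and $\hat F^{\mathrm{FPF}}_z=\hat F_{v_n,z}$ for $z\in\mathcal I_{\mathrm{FPF}}(S_{2n})$. "Schur function" means $s_\lambda$ for a single partition $\lambda$ (possibly empty, with $s_\emptyset=1$). *)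

theory Defs
  imports "HOL-Combinatorics.Permutations" "HOL-Library.Multiset" "HOL-Library.FuncSet"
begin

section \<open>Permutations of the positive integers\<close>

text \<open>
  A permutation of \<open>{1, 2, \<dots>}\<close> is a function on \<^typ>\<open>nat\<close> that fixes \<open>0\<close>.
\<close>

definition Sym_inf :: "(nat \<Rightarrow> nat) set" where
  "Sym_inf = {w. w permutes {1..} \<and> finite {i. w i \<noteq> i}}"

definition invols :: "(nat \<Rightarrow> nat) set" where
  "invols = {w \<in> Sym_inf. w = inv w}"

definition fpf_invols_on :: "nat \<Rightarrow> (nat \<Rightarrow> nat) set" where
  "fpf_invols_on n = {w. w permutes {1..2*n} \<and> w = inv w \<and> (\<forall>i\<in>{1..2*n}. w i \<noteq> i)}"

definition fpf_invols :: "(nat \<Rightarrow> nat) set" where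
  "fpf_invols = (\<Union>n\<in>{1..}. fpf_invols_on n)"

abbreviation s :: "nat \<Rightarrow> nat \<Rightarrow> nat" where
  "s i \<equiv> transpose i (Suc i)"

definition v :: "nat \<Rightarrow> nat \<Rightarrow> nat" where
  "v n i = (if i \<in> {1..2*n} then (if odd i then i + 1 else i - 1) else i)"

definition g :: "nat \<Rightarrow> nat \<Rightarrow> nat" where
  "g k i = (if i \<in> {1..k} then i + k else if i \<in> {k+1..2*k} then i - k else i)"

text \<open>
  \<open>dprod m u w\<close> is \<open>u \<times> w\<close> for \<open>u \<in> S\<^sub>m\<close>. The product depends on \<open>m\<close>, but not on
  the \<open>k\<close> for which \<open>w \<in> S\<^sub>k\<close>, since \<open>w\<close> fixes all integers greater than \<open>k\<close>.
\<close>

definition dprod :: "nat \<Rightarrow> (nat \<Rightarrow> nat) \<Rightarrow> (nat \<Rightarrow> nat) \<Rightarrow> nat \<Rightarrow> nat" where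
  "dprod m u w i = (if i \<le> m then u i else w (i - m) + m)"

section \<open>Involution words\<close>

definition inv_act :: "(nat \<Rightarrow> nat) \<Rightarrow> nat \<Rightarrow> nat \<Rightarrow> nat" where
  "inv_act y i = (if y \<circ> s i = s i \<circ> y then y \<circ> s i else s i \<circ> y \<circ> s i)"

definition inv_expr :: "(nat \<Rightarrow> nat) \<Rightarrow> nat list \<Rightarrow> bool" where
  "inv_expr z a \<longleftrightarrow> set a \<subseteq> {1..} \<and> foldl inv_act id a = z"

definition inv_words :: "(nat \<Rightarrow> nat) \<Rightarrow> nat list set" where
  "inv_words z = {a. inv_expr z a \<and> (\<forall>b. inv_expr z b \<longrightarrow> length a \<le> length b)}"

definition Rhat :: "(nat \<Rightarrow> nat) \<Rightarrow> (nat \<Rightarrow> nat) \<Rightarrow> nat list set" where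
  "Rhat y z = {a. \<exists>b\<in>inv_words y. b @ a \<in> inv_words z}"

lemma Rhat_independent:
  assumes "b \<in> inv_words y"
  shows "Rhat y z = {a. b @ a \<in> inv_words z}"
proof -
  have "c @ a \<in> inv_words z" if "c \<in> inv_words y" "d \<in> inv_words y" "d @ a \<in> inv_words z"
    for a c d
  proof -
    have "length c = length d"
      using that by (auto simp: inv_words_def intro!: antisym)
    moreover have "inv_expr z (c @ a)"
      using that by (auto simp: inv_words_def inv_expr_def)
    ultimately show ?thesis
      using that(3) by (simp add: inv_words_def)
  qed
  then show ?thesis
    using assms unfolding Rhat_def by blast
qed

section \<open>Power series\<close>

text \<open>
  A formal power series in \<open>x\<^sub>1, x\<^sub>2, \<dots>\<close> is given by its coefficients; the multiset \<open>M\<close>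
  stands for the monomial \<open>\<Prod>i\<in>#M. x\<^sub>i\<close>.
\<close>

type_synonym power_series = "nat multiset \<Rightarrow> int"

definition gen_series :: "('a \<Rightarrow> nat multiset) \<Rightarrow> 'a set \<Rightarrow> power_series" where
  "gen_series wt A M = int (card {x \<in> A. wt x = M})"

definition Cseq :: "nat list \<Rightarrow> nat list set" where
  "Cseq a = {I. length I = length a \<and> set I \<subseteq> {1..} \<and> sorted I \<and>
     (\<forall>j. Suc j < length a \<longrightarrow> a ! j < a ! Suc j \<longrightarrow> I ! j < I ! Suc j)}"

text \<open>
  The sum is finite: the letters of an involution word of \<open>z \<in> S\<^sub>n\<close> are less than \<open>n\<close>,
  and all these words have the same length.
\<close>

definition Fhat_rel :: "(nat \<Rightarrow> nat) \<Rightarrow> (nat \<Rightarrow> nat) \<Rightarrow> power_series" where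
  "Fhat_rel y z M = (\<Sum>a\<in>Rhat y z. gen_series mset (Cseq a) M)"

definition Fhat :: "(nat \<Rightarrow> nat) \<Rightarrow> power_series" where
  "Fhat y = Fhat_rel id y"

definition Fhat_FPF :: "(nat \<Rightarrow> nat) \<Rightarrow> power_series" where
  "Fhat_FPF z = Fhat_rel (v (THE n. z \<in> fpf_invols_on n)) z"

lemma fpf_invols_on_unique:
  assumes "z \<in> fpf_invols_on m" "z \<in> fpf_invols_on n"
  shows "m = n"
proof -
  have "{i. z i \<noteq> i} = {1..2*k}" if "z \<in> fpf_invols_on k" for k
    using that by (auto simp: fpf_invols_on_def permutes_def)
  then have "card {1..2*m} = card {1..2*n}"
    using assms by metis
  then show ?thesis by simp
qed

lemma Fhat_FPF_eq: "z \<in> fpf_invols_on n \<Longrightarrow> Fhat_FPF z = Fhat_rel (v n) z"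
  unfolding Fhat_FPF_def using fpf_invols_on_unique
  by (metis (mono_tags, lifting) the_equality)

section \<open>Schur functions\<close>

definition is_partition :: "nat list \<Rightarrow> bool" where
  "is_partition p \<longleftrightarrow> sorted_wrt (\<ge>) p \<and> 0 \<notin> set p"

definition diagram :: "nat list \<Rightarrow> (nat \<times> nat) set" where
  "diagram p = {(i, j). i < length p \<and> j < p ! i}"

definition SSYT :: "nat list \<Rightarrow> (nat \<times> nat \<Rightarrow> nat) set" where
  "SSYT p = {T \<in> diagram p \<rightarrow>\<^sub>E {1..}.
     (\<forall>i j. (i, Suc j) \<in> diagram p \<longrightarrow> T (i, j) \<le> T (i, Suc j)) \<and>
     (\<forall>i j. (Suc i, j) \<in> diagram p \<longrightarrow> T (i, j) < T (Suc i, j))}"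

definition schur :: "nat list \<Rightarrow> power_series" where
  "schur p = gen_series (\<lambda>T. image_mset T (mset_set (diagram p))) (SSYT p)"

definition is_Schur_function :: "power_series \<Rightarrow> bool" where
  "is_Schur_function f \<longleftrightarrow> (\<exists>p. is_partition p \<and> f = schur p)"

end

theory Submission
  imports Defs
begin

text \<open>
  Write \<open>r\<close> for the largest number of arcs of an involution over one point. Moving large values to
  the right in sweeps from left to right lowers this number by one in each sweep, so there is a
  word with \<open>r\<close> decreasing runs (\<open>r - 1\<close> without fixed points). Hence \<open>s\<^sub>\<lambda>\<close> has a monomial in that
  many variables, which bounds the length of \<open>\<lambda>\<close> from above. A sweep from right to left removes an
  increasing run with one letter for each undercut position, which bounds the length of \<open>\<lambda>\<close> from
  below, since the ascent sets of the words are distributed like those of the standard tableaux of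
  shape \<open>\<lambda>\<close>. The left endpoints of the arcs over one point are undercut (all but the first one
  without fixed points), so both bounds agree only if nothing else is undercut, and this forces
  the involution to be a shifted \<open>g\<^sub>k\<close>. Conversely, the words of such an involution are, read
  backwards, the orders in which a staircase can be filled with cells. Reading backwards reverses
  the order of the variables, which does not matter as Schur functions are symmetric.
\<close>

section \<open>Involutions and the length function\<close>

text \<open>No Schur expansion is computed for a general involution; the argument uses only the
  number of rows of the partition. On both sides the coefficient of a monomial of the right degree
  depends only on the places where its sorted list of indices rises, by definition for words and by
  standardization for tableaux. Every set of places occurs, so inversion over subsets provides for
  each word a standard tableau with the same ascents, and a long increasing run turns into many
  rows. The two halves differ in one point: without fixed points an arc joining \<open>i\<close> and
  \<open>Suc i\<close> cannot be deleted. This is the source of each shift by one: the sweeps stop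
  at one arc instead of none, the diagonal is cut off from the diagram whose rows are the undercut
  positions, and the staircase of \<open>g k\<close> loses its last antidiagonal and has
  \<open>k - 1\<close> rows.\<close>

definition involution :: "(nat \<Rightarrow> nat) \<Rightarrow> bool" where
  "involution y \<longleftrightarrow> (\<forall>x. y (y x) = x)"

definition moved :: "(nat \<Rightarrow> nat) \<Rightarrow> nat set" where
  "moved y = {x. y x \<noteq> x}"

definition inversions :: "(nat \<Rightarrow> nat) \<Rightarrow> (nat \<times> nat) set" where
  "inversions w = {(p, q). p < q \<and> w q < w p}"

text \<open>Each step of \<open>\<rtimes>\<close> changes this by four, see \<open>ilen_descent\<close>.\<close>

definition ilen :: "(nat \<Rightarrow> nat) \<Rightarrow> nat" where
  "ilen y = 2 * card (inversions y) + card (moved y)"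

lemma involutionD: "involution y \<Longrightarrow> y (y x) = x"
  by (simp add: involution_def)

lemma involution_inj: "involution y \<Longrightarrow> inj y"
  by (metis injI involutionD)

lemma involution_eq_iff: "involution y \<Longrightarrow> y a = y b \<longleftrightarrow> a = b"
  by (metis involutionD)

lemma involution_swap_iff: "involution y \<Longrightarrow> y a = b \<longleftrightarrow> y b = a"
  by (metis involutionD)

lemma s_simps [simp]:
  "s i i = Suc i" "s i (Suc i) = i" "s i (s i x) = x" "s i x = s i z \<longleftrightarrow> x = z"
  by (auto simp: transpose_def)

lemma s_other: "x \<noteq> i \<Longrightarrow> x \<noteq> Suc i \<Longrightarrow> s i x = x"
  by (simp add: transpose_def)

lemma s_less_iff: "{a, b} \<noteq> {i, Suc i} \<Longrightarrow> s i a < s i b \<longleftrightarrow> a < b"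
  by (auto simp: transpose_def)

text \<open>Multiplication by \<open>s i\<close> thus only creates or deletes an arc between
  neighbours; every other step is a conjugation, which relabels endpoints.\<close>

lemma involution_commutes_iff:
  assumes "involution y"
  shows "y \<circ> s i = s i \<circ> y \<longleftrightarrow> y i = Suc i \<or> (y i = i \<and> y (Suc i) = Suc i)"
proof
  assume "y \<circ> s i = s i \<circ> y"
  then have "y (Suc i) = s i (y i)"
    by (metis comp_apply s_simps(1))
  moreover have "y (Suc i) \<noteq> y i"
    by (simp add: involution_eq_iff[OF assms])
  ultimately show "y i = Suc i \<or> (y i = i \<and> y (Suc i) = Suc i)"
    by (metis s_other s_simps(1))
next
  assume *: "y i = Suc i \<or> (y i = i \<and> y (Suc i) = Suc i)"
  then have "y (Suc i) = i" if "y i = Suc i"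
    using that assms by (metis involutionD)
  with * have "y (s i i) = s i (y i)" "y (s i (Suc i)) = s i (y (Suc i))"
    by (elim disjE; simp)+
  moreover have "y (s i x) = s i (y x)" if "x \<noteq> i" "x \<noteq> Suc i" for x
  proof -
    have "y x \<noteq> i" "y x \<noteq> Suc i"
      using * that assms by (metis involutionD)+
    then show ?thesis using that by (simp add: s_other)
  qed
  ultimately have "y (s i x) = s i (y x)" for x
    by (cases "x = i \<or> x = Suc i") blast+
  then show "y \<circ> s i = s i \<circ> y"
    by (simp add: fun_eq_iff)
qed

lemma inv_act_remove: "involution y \<Longrightarrow> y i = Suc i \<Longrightarrow> inv_act y i = y \<circ> s i"
  by (simp add: inv_act_def involution_commutes_iff)

lemma inv_act_conj:
  "involution y \<Longrightarrow> y (Suc i) < y i \<Longrightarrow> y i \<noteq> Suc i \<Longrightarrow> inv_act y i = s i \<circ> y \<circ> s i"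
  using inv_act_def involution_commutes_iff by auto

lemma involution_inv_act [simp]:
  assumes "involution y"
  shows "involution (inv_act y i)"
proof (cases "y \<circ> s i = s i \<circ> y")
  case True
  then have "y (s i x) = s i (y x)" for x
    by (metis comp_apply)
  with True assms show ?thesis
    by (simp add: inv_act_def involution_def)
next
  case False
  with assms show ?thesis
    by (simp add: inv_act_def involution_def)
qed

lemma inv_act_inv_act [simp]:
  assumes "involution y"
  shows "inv_act (inv_act y i) i = y"
proof (cases "y \<circ> s i = s i \<circ> y")
  case True
  then have "y (s i x) = s i (y x)" for x
    by (metis comp_apply)
  with True show ?thesis
    by (simp add: inv_act_def fun_eq_iff)
next
  case False
  have "(s i \<circ> y \<circ> s i) \<circ> s i \<noteq> s i \<circ> (s i \<circ> y \<circ> s i)"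
  proof
    assume *: "(s i \<circ> y \<circ> s i) \<circ> s i = s i \<circ> (s i \<circ> y \<circ> s i)"
    have "s i (y x) = y (s i x)" for x
      using fun_cong[OF *, of x] by simp
    then have "y \<circ> s i = s i \<circ> y"
      by (simp add: fun_eq_iff)
    with False show False by blast
  qed
  then have "inv_act (s i \<circ> y \<circ> s i) i = s i \<circ> (s i \<circ> y \<circ> s i) \<circ> s i"
    by (simp add: inv_act_def)
  also have "\<dots> = y" by (simp add: fun_eq_iff)
  finally show ?thesis
    using False by (simp add: inv_act_def)
qed

text \<open>If \<open>y\<close> and \<open>s i\<close> do not commute, the values at
  \<open>i\<close> and \<open>Suc i\<close> are not exactly this pair, so the outer
  \<open>s i\<close> keeps their order and only the exchange of positions counts.\<close>

lemma inv_act_descent_flip: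
  assumes "involution y"
  shows "inv_act y i i < inv_act y i (Suc i) \<longleftrightarrow> y (Suc i) < y i"
proof (cases "y \<circ> s i = s i \<circ> y")
  case True
  then have "inv_act y i = y \<circ> s i" by (simp add: inv_act_def)
  then show ?thesis by simp
next
  case False
  have "{y (Suc i), y i} \<noteq> {i, Suc i}"
    using False assms unfolding involution_commutes_iff[OF assms] doubleton_eq_iff
    by (metis involutionD)
  with False show ?thesis
    by (simp add: inv_act_def s_less_iff)
qed

section \<open>Inversions under adjacent transpositions\<close>

lemma inversions_transpose:
  assumes "w i < w (Suc i)"
  shows "inversions (w \<circ> s i) = insert (i, Suc i) ((\<lambda>(p, q). (s i p, s i q)) ` inversions w)" (is "_ = insert _ (?f ` _)")
proof (intro set_eqI iffI)
  fix x
  assume x: "x \<in> inversions (w \<circ> s i)"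
  obtain p q where pq: "x = (p, q)" by force
  show "x \<in> insert (i, Suc i) (?f ` inversions w)"
  proof (cases "p = i \<and> q = Suc i")
    case False
    then have "s i p < s i q"
      using x pq by (auto simp: inversions_def transpose_def)
    then have "(s i p, s i q) \<in> inversions w"
      using x pq by (auto simp: inversions_def)
    then have "?f (s i p, s i q) \<in> ?f ` inversions w" by (rule imageI)
    then show ?thesis by (simp add: pq)
  qed (simp add: pq)
next
  fix x
  assume "x \<in> insert (i, Suc i) (?f ` inversions w)"
  then consider "x = (i, Suc i)" | p q where "x = (s i p, s i q)" "(p, q) \<in> inversions w" by auto
  then show "x \<in> inversions (w \<circ> s i)"
  proof cases
    case 1
    then show ?thesis using assms by (simp add: inversions_def)
  next
    case 2
    then have "\<not> (p = i \<and> q = Suc i)" "p < q"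
      using assms by (auto simp: inversions_def)
    then have "s i p < s i q" by (auto simp: transpose_def)
    with 2 show ?thesis by (simp add: inversions_def)
  qed
qed

lemma finite_inversions:
  assumes "inj w" "finite (moved w)"
  shows "finite (inversions w)"
proof -
  obtain n where n: "\<forall>x\<in>moved w. x \<le> n"
    using assms(2) by (meson finite_nat_set_iff_bounded_le)
  have fix_above: "w x = x" if "n < x" for x
    using n that by (force simp: moved_def)
  have low: "w x \<le> n" if "x \<le> n" for x
  proof (rule ccontr)
    assume "\<not> w x \<le> n"
    then have "w (w x) = w x" by (simp add: fix_above)
    then show False
      using assms(1) that \<open>\<not> w x \<le> n\<close> by (metis injD)
  qed
  have "inversions w \<subseteq> {..n} \<times> {..n}"
  proof
    fix x assume "x \<in> inversions w"
    then obtain p q where pq: "x = (p, q)" "p < q" "w q < w p"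
      by (auto simp: inversions_def)
    have "q \<le> n"
    proof (rule ccontr)
      assume "\<not> q \<le> n"
      then have "w q = q" by (simp add: fix_above)
      then show False
        using pq fix_above[of p] low[of p] \<open>\<not> q \<le> n\<close> by (cases "p \<le> n") auto
    qed
    with pq show "x \<in> {..n} \<times> {..n}" by auto
  qed
  then show ?thesis
    by (rule finite_subset) auto
qed

lemma card_inversions_transpose:
  assumes "w i < w (Suc i)" "inj w" "finite (moved w)"
  shows "card (inversions (w \<circ> s i)) = Suc (card (inversions w))"
proof -
  let ?f = "\<lambda>(p, q). (s i p, s i q)"
  have "inj_on ?f (inversions w)"
    by (auto simp: inj_on_def)
  moreover have "(i, Suc i) \<notin> ?f ` inversions w"
  proof
    assume "(i, Suc i) \<in> ?f ` inversions w"
    then obtain p q where *: "i = s i p" "Suc i = s i q" "(p, q) \<in> inversions w" by auto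
    then have "p = Suc i" "q = i" by (metis s_simps)+
    with * show False by (simp add: inversions_def)
  qed
  ultimately show ?thesis
    using assms by (simp add: inversions_transpose finite_inversions card_image)
qed

text \<open>Reduces left multiplication to right multiplication: the inverse of
  \<open>s i \<circ> y\<close> is \<open>y \<circ> s i\<close>.\<close>

lemma card_inversions_inverse:
  assumes "\<And>x. w (u x) = x" "\<And>x. u (w x) = x"
  shows "card (inversions u) = card (inversions w)"
proof (rule bij_betw_same_card[where f = "\<lambda>(p, q). (u q, u p)"])
  show "bij_betw (\<lambda>(p, q). (u q, u p)) (inversions u) (inversions w)"
    by (rule bij_betw_byWitness[where f' = "\<lambda>(p, q). (w q, w p)"])
      (auto simp: inversions_def assms)
qed

lemma moved_comp_s: "finite (moved w) \<Longrightarrow> finite (moved (w \<circ> s i))"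
  by (rule finite_subset[of _ "insert i (insert (Suc i) (moved w))"])
    (auto simp: moved_def transpose_def)

lemma moved_conj: "moved (s i \<circ> y \<circ> s i) = s i ` moved y"
proof (intro set_eqI iffI)
  fix x assume "x \<in> moved (s i \<circ> y \<circ> s i)"
  then have "s i x \<in> moved y"
    by (auto simp: moved_def)
  then have "s i (s i x) \<in> s i ` moved y" by (rule imageI)
  then show "x \<in> s i ` moved y" by simp
qed (auto simp: moved_def)

lemma finite_moved_inv_act [simp]: "finite (moved y) \<Longrightarrow> finite (moved (inv_act y i))"
proof -
  have "finite (moved (y \<circ> s i))" "finite (moved (s i \<circ> y \<circ> s i))" if "finite (moved y)"
    using that by (simp_all add: moved_comp_s moved_conj)
  then show "finite (moved y) \<Longrightarrow> finite (moved (inv_act y i))"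
    unfolding inv_act_def by presburger
qed

text \<open>The weights in \<open>ilen\<close> balance the two kinds of step: creating an arc adds
  one inversion and two moved points, a conjugation adds two inversions and no moved point. The
  ascent excludes the deletion of an arc.\<close>

lemma ilen_ascent:
  assumes y: "involution y" "finite (moved y)" and asc: "y i < y (Suc i)"
  shows "ilen (inv_act y i) = ilen y + 4"
proof (cases "y \<circ> s i = s i \<circ> y")
  case True
  then have fixed: "y i = i" "y (Suc i) = Suc i"
    using asc involution_commutes_iff[OF y(1), of i] y(1)
    by (metis involutionD lessI less_asym)+
  have "moved (y \<circ> s i) = {i, Suc i} \<union> moved y"
    using fixed by (auto simp: moved_def transpose_def)
  moreover have "{i, Suc i} \<inter> moved y = {}"
    using fixed by (auto simp: moved_def)
  ultimately have "card (moved (y \<circ> s i)) = card (moved y) + 2"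
    using y by (simp add: card_Un_disjoint)
  then show ?thesis
    using True card_inversions_transpose[OF asc involution_inj y(2)] y(1)
    by (simp add: inv_act_def ilen_def)
next
  case False
  have ne: "{y i, y (Suc i)} \<noteq> {i, Suc i}"
    using False asc involution_commutes_iff[OF y(1), of i] y(1)
    unfolding doubleton_eq_iff by (metis involutionD)
  have c1: "card (inversions (y \<circ> s i)) = Suc (card (inversions y))"
    by (intro card_inversions_transpose asc y(2) involution_inj y(1))
  have c2: "card (inversions (s i \<circ> y)) = card (inversions (y \<circ> s i))"
    by (rule card_inversions_inverse) (simp_all add: involutionD[OF y(1)])
  have "moved (s i \<circ> y) \<subseteq> insert i (insert (Suc i) (moved y))"
    by (auto simp: moved_def s_other)
  then have fin: "finite (moved (s i \<circ> y))"
    using y(2) by (auto intro: finite_subset)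
  have "inj (s i \<circ> y)"
    by (intro inj_compose involution_inj[OF y(1)]) simp
  moreover have "(s i \<circ> y) i < (s i \<circ> y) (Suc i)"
    using ne asc by (simp add: s_less_iff)
  ultimately have c3: "card (inversions (s i \<circ> y \<circ> s i)) = Suc (card (inversions (s i \<circ> y)))"
    by (intro card_inversions_transpose fin)
  have "card (moved (s i \<circ> y \<circ> s i)) = card (moved y)"
    unfolding moved_conj by (rule card_image) (simp add: inj_on_def)
  then show ?thesis
    using False c1 c2 c3 by (simp add: inv_act_def ilen_def)
qed

lemma ilen_descent:
  assumes "involution y" "finite (moved y)" "y (Suc i) < y i"
  shows "ilen (inv_act y i) + 4 = ilen y"
  using ilen_ascent[of "inv_act y i" i] assms by (simp add: inv_act_descent_flip)

lemma ilen_id [simp]: "ilen id = 0"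
proof -
  have "inversions id = {}" by (auto simp: inversions_def)
  then show ?thesis by (simp add: ilen_def moved_def)
qed

section \<open>Descending paths\<close>

text \<open>
  The words are read from right to left: \<open>down z (rev a) e\<close> says that \<open>a\<close> leads from \<open>e\<close> to \<open>z\<close>
  and increases the length in each step.
\<close>

fun down :: "(nat \<Rightarrow> nat) \<Rightarrow> nat list \<Rightarrow> (nat \<Rightarrow> nat) \<Rightarrow> bool" where
  "down y [] e \<longleftrightarrow> y = e"
| "down y (i # b) e \<longleftrightarrow> 1 \<le> i \<and> y (Suc i) < y i \<and> down (inv_act y i) b e"

lemma down_append: "down y (b @ c) e \<longleftrightarrow> (\<exists>u. down y b u \<and> down u c e)"
  by (induction b arbitrary: y) auto

text \<open>Every step is undone by the same letter. This identifies the intermediate involution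
  when a word is cut in two.\<close>

lemma down_start_unique:
  "involution y \<Longrightarrow> involution y' \<Longrightarrow> down y b e \<Longrightarrow> down y' b e \<Longrightarrow> y = y'"
  by (induction b arbitrary: y y') (auto, metis inv_act_inv_act involution_inv_act)

lemma down_involution: "involution y \<Longrightarrow> down y b e \<Longrightarrow> involution e"
  by (induction b arbitrary: y) (simp, metis down.simps(2) involution_inv_act)

lemma ilen_down:
  "involution y \<Longrightarrow> finite (moved y) \<Longrightarrow> down y b e \<Longrightarrow> ilen y = ilen e + 4 * length b"
proof (induction b arbitrary: y)
  case (Cons i b)
  then have "ilen (inv_act y i) = ilen e + 4 * length b" by simp
  moreover have "ilen (inv_act y i) + 4 = ilen y"
    using Cons.prems by (intro ilen_descent) auto
  ultimately show ?case by simp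
qed auto

lemma foldl_involution:
  "involution e \<Longrightarrow> finite (moved e) \<Longrightarrow>
    involution (foldl inv_act e a) \<and> finite (moved (foldl inv_act e a))"
  by (induction a rule: rev_induct) auto

lemma involution_id [simp]: "involution id" and finite_moved_id [simp]: "finite (moved id)"
  by (simp_all add: involution_def moved_def)

text \<open>A letter raises or lowers \<open>ilen\<close> by four. A word attains the bound only if
  it never lowers it, so minimality of the length becomes a condition on single letters.\<close>

lemma ilen_word:
  assumes "set a \<subseteq> {1..}"
    and e: "involution e" "finite (moved e)"
  shows "ilen (foldl inv_act e a) \<le> ilen e + 4 * length a \<and>
    (ilen (foldl inv_act e a) = ilen e + 4 * length a \<longrightarrow> down (foldl inv_act e a) (rev a) e)"
  using assms(1)
proof (induction a rule: rev_induct)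
  case (snoc i a)
  define y where "y = foldl inv_act e a"
  have y: "involution y" "finite (moved y)"
    using foldl_involution[OF e, of a] by (simp_all add: y_def)
  have IH: "ilen y \<le> ilen e + 4 * length a" "ilen y = ilen e + 4 * length a \<Longrightarrow> down y (rev a) e"
    using snoc by (auto simp: y_def)
  consider "y i < y (Suc i)" | "y (Suc i) < y i"
    using involution_eq_iff[OF y(1), of i "Suc i"] by linarith
  then show ?case
  proof cases
    case 1
    then show ?thesis
      using IH y snoc.prems ilen_ascent[OF y 1] inv_act_descent_flip[OF involution_inv_act[OF y(1)], of i i]
      by (auto simp: y_def[symmetric] inv_act_inv_act)
  next
    case 2
    then show ?thesis
      using IH y snoc.prems ilen_descent[OF y 2] by (auto simp: y_def[symmetric])
  qed
qed simp

lemma down_foldl: "involution y \<Longrightarrow> down y (rev a) e \<Longrightarrow> foldl inv_act e a = y"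
proof (induction a arbitrary: y rule: rev_induct)
  case (snoc i a)
  then have "foldl inv_act e a = inv_act y i" by auto
  with snoc.prems(1) show ?case by simp
qed auto

lemma down_letters: "down y b e \<Longrightarrow> set b \<subseteq> {1..}"
  by (induction b arbitrary: y) auto

text \<open>One descending path shows that the bound of \<open>ilen_word\<close> is attained, so the
  shortest words are those attaining it.\<close>

lemma inv_words_down:
  assumes z: "involution z" "finite (moved z)" and ex: "down z b id"
  shows "inv_words z = {a. down z (rev a) id}"
proof (intro set_eqI iffI; clarify)
  have b: "inv_expr z (rev b)"
    using down_foldl[of z "rev b" id] z ex down_letters[OF ex] by (auto simp: inv_expr_def)
  have len: "ilen z = 4 * length b"
    using ilen_down[OF z ex] by simp
  show "down z (rev a) id" if "a \<in> inv_words z" for a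
  proof -
    have a: "set a \<subseteq> {1..}" "foldl inv_act id a = z" "length a \<le> length b"
      using that b unfolding inv_words_def inv_expr_def by (force, force, fastforce)
    then show ?thesis
      using ilen_word[OF a(1) involution_id finite_moved_id] len by simp
  qed
  show "a \<in> inv_words z" if "down z (rev a) id" for a
  proof -
    have "inv_expr z a"
      using down_foldl[OF z(1) that] down_letters[OF that] by (auto simp: inv_expr_def)
    moreover have "length a \<le> length c" if "inv_expr z c" for c
      using ilen_word[OF _ involution_id finite_moved_id, of c] that
        ilen_down[OF z \<open>down z (rev a) id\<close>] by (auto simp: inv_expr_def)
    ultimately show ?thesis by (simp add: inv_words_def)
  qed
qed

text \<open>A path from \<open>z\<close> to \<open>id\<close> that ends with a given word of
  \<open>e\<close> must pass through \<open>e\<close>, by \<open>down_start_unique\<close>.\<close>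

lemma Rhat_down:
  assumes z: "involution z" "finite (moved z)"
    and e: "down e b id" and ex: "down z c e"
  shows "Rhat e z = {a. down z (rev a) e}"
proof -
  have ie: "involution e" by (rule down_involution[OF z(1) ex])
  have fe: "finite (moved e)"
    using ex z(2) by (induction c arbitrary: z) auto
  have "rev b \<in> inv_words e"
    using inv_words_down[OF ie fe e] e by simp
  moreover have "inv_words z = {a. down z (rev a) id}"
    by (rule inv_words_down[OF z, of "c @ b"]) (use e ex in \<open>auto simp: down_append\<close>)
  ultimately have "Rhat e z = {a. \<exists>u. down z (rev a) u \<and> down u b id}"
    by (subst Rhat_independent) (auto simp: down_append)
  also have "\<dots> = {a. down z (rev a) e}"
    using e down_start_unique[OF _ ie _ e] down_involution[OF z(1)] by blast
  finally show ?thesis .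
qed

section \<open>Involutions of a finite interval\<close>

text \<open>One flag serves both halves of the theorem. The interval has \<open>n\<close> points
  rather than \<open>2 * n\<close>, so evenness is assumed separately where it matters.\<close>

definition invs :: "bool \<Rightarrow> nat \<Rightarrow> (nat \<Rightarrow> nat) set" where
  "invs fpf n = {y. involution y \<and> (\<forall>x. x = 0 \<or> n < x \<longrightarrow> y x = x) \<and>
     (fpf \<longrightarrow> (\<forall>x\<in>{1..n}. y x \<noteq> x))}"

lemma invs_involution: "y \<in> invs f n \<Longrightarrow> involution y"
  by (simp add: invs_def)

lemma invs_fixed: "y \<in> invs f n \<Longrightarrow> n < x \<Longrightarrow> y x = x"
  by (simp add: invs_def)

lemma invs_zero: "y \<in> invs f n \<Longrightarrow> y 0 = 0"
  by (simp add: invs_def)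

lemma invs_le: "y \<in> invs f n \<Longrightarrow> x \<le> n \<Longrightarrow> y x \<le> n"
  by (metis invs_fixed invs_involution involutionD not_le)

lemma invs_pos: "y \<in> invs f n \<Longrightarrow> 0 < x \<Longrightarrow> 0 < y x"
  by (metis invs_involution involutionD invs_zero gr0I less_irrefl)

lemma invs_finite_moved: "y \<in> invs f n \<Longrightarrow> finite (moved y)"
  by (rule finite_subset[of _ "{..n}"]) (auto simp: invs_def moved_def not_less[symmetric])

lemma invs_weaken: "y \<in> invs f n \<Longrightarrow> y \<in> invs False n"
  by (simp add: invs_def)

lemma invs_descent_less:
  assumes "y \<in> invs f n" "y (Suc i) < y i"
  shows "i < n"
proof (rule ccontr)
  assume "\<not> i < n"
  then have "y (Suc i) = Suc i"
    by (intro invs_fixed[OF assms(1)]) simp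
  moreover have "y i \<le> i"
    using \<open>\<not> i < n\<close> invs_le[OF assms(1), of i] invs_fixed[OF assms(1), of i] by (cases "i = n") auto
  ultimately show False using assms(2) by simp
qed

text \<open>Deleting an arc leaves two fixed points, hence the flag \<open>False\<close>.\<close>

lemma invs_remove:
  assumes "y \<in> invs False n" "1 \<le> i" "y i = Suc i"
  shows "inv_act y i \<in> invs False n"
proof -
  have "i < n"
    using assms invs_descent_less[of y False n i]
    by (metis invs_involution involutionD lessI)
  then show ?thesis
    using assms involution_inv_act[of y i] inv_act_remove[of y i]
    by (auto simp: invs_def s_other)
qed

lemma invs_conj:
  assumes "y \<in> invs f n" "1 \<le> i" "y (Suc i) < y i" "y i \<noteq> Suc i"
  shows "inv_act y i \<in> invs f n"
proof -
  have "i < n" by (rule invs_descent_less[OF assms(1,3)])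
  have "y x \<noteq> i \<and> y x \<noteq> Suc i" if "x = 0 \<or> n < x" for x
    using that assms(1,2) \<open>i < n\<close> by (auto simp: invs_def)
  moreover have "y (s i x) \<noteq> s i x" if "f" "x \<in> {1..n}" for x
    using that assms(1,2) \<open>i < n\<close> by (auto simp: invs_def transpose_def)
  then have "s i (y (s i x)) \<noteq> x" if "f" "x \<in> {1..n}" for x
    using that by (metis s_simps(3))
  ultimately show ?thesis
    using assms involution_inv_act[of y i] inv_act_conj[of y i] \<open>i < n\<close>
    by (auto simp: invs_def s_other)
qed

lemma invs_False_down:
  "y \<in> invs False n \<Longrightarrow> down y b e \<Longrightarrow> set b \<subseteq> {1..<n}"
proof (induction b arbitrary: y)
  case (Cons i b)
  then have "i < n" using invs_descent_less[of y False n i] by auto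
  moreover have "inv_act y i \<in> invs False n"
    using Cons.prems invs_conj[of y False n i] invs_remove[of y n i] by auto
  then have "set b \<subseteq> {1..<n}" using Cons by auto
  ultimately show ?case using Cons.prems by auto
qed simp

lemma finite_down_words:
  assumes "y \<in> invs False n"
  shows "finite {a. down y (rev a) e}"
proof (rule finite_subset)
  show "{a. down y (rev a) e} \<subseteq> {a. set a \<subseteq> {1..<n} \<and> length a \<le> ilen y}"
    using invs_False_down[OF assms] ilen_down[OF invs_involution[OF assms] invs_finite_moved[OF assms]]
    by fastforce
  show "finite {a. set a \<subseteq> {1..<n} \<and> length a \<le> ilen y}"
    by (rule finite_lists_length_le) simp
qed

section \<open>The two sets of involutions in the theorem\<close>

lemma invols_iff: "y \<in> invols \<longleftrightarrow> (\<exists>n. y \<in> invs False n)"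
proof
  assume y: "y \<in> invols"
  then have "y permutes {1..}" "finite (moved y)" "y = inv y"
    by (auto simp: invols_def Sym_inf_def moved_def)
  then have "involution y" "y 0 = 0"
    by (metis involution_def permutes_inv_eq) (use \<open>y permutes {1..}\<close> in \<open>simp add: permutes_def\<close>)
  moreover obtain n where "\<forall>x\<in>moved y. x \<le> n"
    using \<open>finite (moved y)\<close> by (meson finite_nat_set_iff_bounded_le)
  ultimately have "y \<in> invs False n"
    by (simp add: invs_def moved_def) (metis not_le)
  then show "\<exists>n. y \<in> invs False n" ..
next
  assume "\<exists>n. y \<in> invs False n"
  then obtain n where y: "y \<in> invs False n" by blast
  have inv: "involution y" by (rule invs_involution[OF y])
  have "\<exists>!x. y x = z" for z
    using involution_swap_iff[OF inv] by metis
  moreover have "y x = x" if "x \<notin> {1..}" for x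
    using that y by (cases "x = 0") (auto simp: invs_def)
  ultimately have "y permutes {1..}"
    by (auto simp: permutes_def)
  moreover have "inv y = y"
    by (rule inv_unique_comp) (simp_all add: fun_eq_iff involutionD[OF inv])
  moreover have "finite {i. y i \<noteq> i}"
    using invs_finite_moved[OF y] by (simp add: moved_def)
  ultimately show "y \<in> invols"
    by (auto simp: invols_def Sym_inf_def)
qed

lemma fpf_invols_on_iff: "z \<in> fpf_invols_on n \<longleftrightarrow> z \<in> invs True (2 * n)"
proof
  assume z: "z \<in> fpf_invols_on n"
  then have "z permutes {1..2*n}" "z = inv z" by (auto simp: fpf_invols_on_def)
  then have "involution z"
    by (metis involution_def permutes_inv_eq)
  then show "z \<in> invs True (2 * n)"
    using z by (auto simp: invs_def fpf_invols_on_def permutes_def)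
next
  assume z: "z \<in> invs True (2 * n)"
  have inv: "involution z" by (rule invs_involution[OF z])
  have "\<exists>!x. z x = w" for w
    using involution_swap_iff[OF inv] by metis
  moreover have "z x = x" if "x \<notin> {1..2 * n}" for x
    using that z by (cases "x = 0") (auto simp: invs_def)
  ultimately have "z permutes {1..2 * n}"
    by (auto simp: permutes_def)
  moreover have "inv z = z"
    by (rule inv_unique_comp) (simp_all add: fun_eq_iff involutionD[OF inv])
  ultimately show "z \<in> fpf_invols_on n"
    using z by (auto simp: fpf_invols_on_def invs_def)
qed

section \<open>Words with few decreasing runs\<close>

text \<open>Each arc over the gap between \<open>j\<close> and \<open>Suc j\<close> is represented
  by its left endpoint.\<close>

definition crossings :: "(nat \<Rightarrow> nat) \<Rightarrow> nat \<Rightarrow> nat set" where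
  "crossings y j = {a. a \<le> j \<and> j < y a}"

lemma finite_crossings [simp]: "finite (crossings y j)"
  by (rule finite_subset[of _ "{..j}"]) (auto simp: crossings_def)

lemma crossings_outside: "y \<in> invs f n \<Longrightarrow> n \<le> j \<Longrightarrow> crossings y j = {}"
  using invs_le[of y f n] invs_fixed[of y f n]
  by (auto simp: crossings_def) (metis le_trans not_le)

text \<open>\<open>i\<close> and \<open>Suc i\<close> lie on the same side of every gap except the
  one between them.\<close>

lemma card_crossings_inv_act:
  assumes y: "involution y" and d: "y (Suc i) < y i" and j: "j \<noteq> i"
  shows "card (crossings (inv_act y i) j) = card (crossings y j)"
proof (cases "y i = Suc i")
  case True
  then have "y (Suc i) = i" using y by (metis involutionD)
  with True have "crossings (y \<circ> s i) j = crossings y j"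
    using j by (auto simp: crossings_def transpose_def split: if_splits)
  then show ?thesis using True y by (simp add: inv_act_remove)
next
  case False
  have le: "s i a \<le> j \<longleftrightarrow> a \<le> j" for a
    using j by (auto simp: transpose_def)
  have less: "j < s i a \<longleftrightarrow> j < a" for a
    using le[of a] by (simp add: not_le[symmetric])
  have "crossings (s i \<circ> y \<circ> s i) j = s i ` crossings y j"
  proof (intro set_eqI iffI)
    fix x assume "x \<in> crossings (s i \<circ> y \<circ> s i) j"
    then have "s i x \<in> crossings y j" by (simp add: crossings_def le less)
    then have "s i (s i x) \<in> s i ` crossings y j" by (rule imageI)
    then show "x \<in> s i ` crossings y j" by simp
  qed (auto simp: crossings_def le less)
  then show ?thesis
    using False y d by (simp add: inv_act_conj card_image inj_on_def)
qed

text \<open>Here \<open>Suc i\<close> is a left endpoint, so every arc over the gap before it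
  continues over the next gap, where one more arc has started.\<close>

lemma crossings_ascent:
  assumes y: "involution y" and i: "i < y (Suc i)" "y (Suc i) \<noteq> Suc i" "y i \<noteq> Suc i"
  shows "card (crossings y i) < card (crossings y (Suc i))"
proof (rule psubset_card_mono)
  have "y a \<noteq> Suc i" if "a \<le> i" for a
    using that i y by (metis involutionD leD le_less)
  then have "crossings y i \<subseteq> crossings y (Suc i)"
    by (auto simp: crossings_def) (metis Suc_lessI)
  moreover have "Suc i \<in> crossings y (Suc i)" "Suc i \<notin> crossings y i"
    using i by (auto simp: crossings_def)
  ultimately show "crossings y i \<subset> crossings y (Suc i)" by blast
qed simp

text \<open>If the arc from \<open>i\<close> ends at \<open>Suc i\<close>, it is deleted. If
  \<open>Suc i\<close> is fixed or a right endpoint, the exchange takes the arc starting at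
  \<open>i\<close> off the gap. If \<open>Suc i\<close> is a left endpoint too, the exchange adds
  nothing over the gap, and by \<open>crossings_ascent\<close> this was not a fullest gap.\<close>

lemma crossings_sweep:
  assumes y: "involution y" and d: "y (Suc i) < y i" "i < y i"
    and R: "\<And>j. card (crossings y j) \<le> Suc R"
  shows "card (crossings (inv_act y i) i) \<le> R"
proof -
  have i: "i \<in> crossings y i" using d by (simp add: crossings_def)
  have drop: "card (crossings (inv_act y i) i) \<le> R"
    if "crossings (inv_act y i) i \<subseteq> crossings y i - {i}"
  proof -
    have "card (crossings (inv_act y i) i) \<le> card (crossings y i - {i})"
      by (rule card_mono) (use that in auto)
    also have "\<dots> \<le> R" using R[of i] i by simp
    finally show ?thesis .
  qed
  consider "y i = Suc i" | "y i \<noteq> Suc i" "y (Suc i) \<le> Suc i" | "y i \<noteq> Suc i" "Suc i < y (Suc i)"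
    by linarith
  then show ?thesis
  proof cases
    case 1
    then have "y (Suc i) = i" using y by (metis involutionD)
    then have "inv_act y i i = i"
      using 1 y by (simp add: inv_act_remove)
    moreover have "inv_act y i a = y a" if "a < i" for a
      using 1 y that by (simp add: inv_act_remove s_other)
    ultimately show ?thesis
      by (intro drop) (auto simp: crossings_def le_less)
  next
    case 2
    have "y (Suc i) \<noteq> i" using 2 y by (metis involutionD)
    then have "inv_act y i i \<le> i"
      using 2 y d by (auto simp: inv_act_conj transpose_def)
    moreover have "inv_act y i a = s i (y a)" "y a \<noteq> i" if "a < i" for a
      using that y d 2 by (simp_all add: inv_act_conj s_other) (metis involutionD not_less_iff_gr_or_eq)
    ultimately show ?thesis
      by (intro drop) (auto simp: crossings_def le_less transpose_def split: if_splits)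
  next
    case 3
    have ne: "y a \<noteq> i" "y a \<noteq> Suc i" if "a < i" for a
      using that y d 3 by (metis involutionD not_less_iff_gr_or_eq, metis Suc_lessD involutionD not_less_iff_gr_or_eq)
    have "inv_act y i a = y a" if "a < i" for a
      using that y d 3 ne[OF that] by (simp add: inv_act_conj s_other)
    then have "crossings (inv_act y i) i \<subseteq> crossings y i"
      using i by (auto simp: crossings_def le_less)
    then have "card (crossings (inv_act y i) i) \<le> card (crossings y i)"
      by (simp add: card_mono)
    also have "\<dots> < card (crossings y (Suc i))"
      using 3 by (intro crossings_ascent y) auto
    also have "\<dots> \<le> Suc R" by (rule R)
    finally show ?thesis by simp
  qed
qed

text \<open>
  A pair \<open>(r, i)\<close> is a letter \<open>i\<close> in the \<open>r\<close>-th run of a word that is read from right to left;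
  \<open>m\<close> bounds the letters of the last run from below.
\<close>

definition run_path :: "(nat \<Rightarrow> nat) \<Rightarrow> (nat \<Rightarrow> nat) \<Rightarrow> nat \<Rightarrow> nat \<Rightarrow> bool" where
  "run_path e y r m \<longleftrightarrow> (\<exists>ps. down y (map snd ps) e \<and>
     sorted_wrt (\<lambda>(q, i) (q', i'). q' < q \<or> q = q' \<and> i < i') ps \<and>
     fst ` set ps \<subseteq> {1..r} \<and> (\<forall>(q, i) \<in> set ps. q = r \<longrightarrow> m \<le> i))"

lemma run_path_mono: "run_path e y r m \<Longrightarrow> m' \<le> m \<Longrightarrow> run_path e y r m'"
  unfolding run_path_def by (force intro: order_trans)

lemma run_path_new_run: "run_path e y r m \<Longrightarrow> run_path e y (Suc r) m'"
proof -
  assume "run_path e y r m"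
  then obtain ps where ps: "down y (map snd ps) e"
    "sorted_wrt (\<lambda>(q, i) (q', i'). q' < q \<or> q = q' \<and> i < i') ps" "fst ` set ps \<subseteq> {1..r}"
    unfolding run_path_def by blast
  have "1 \<le> q \<and> q \<le> r" if "(q, i) \<in> set ps" for q i
    using ps(3) that by force
  then have "fst ` set ps \<subseteq> {1..Suc r}" "\<forall>(q, i) \<in> set ps. q = Suc r \<longrightarrow> m' \<le> i"
    by fastforce+
  with ps show ?thesis unfolding run_path_def by blast
qed

lemma run_path_letter:
  assumes "run_path e (inv_act y i) (Suc r) (Suc i)" "1 \<le> i" "y (Suc i) < y i"
  shows "run_path e y (Suc r) i"
proof -
  obtain ps where ps: "down (inv_act y i) (map snd ps) e"
    "sorted_wrt (\<lambda>(q, i) (q', i'). q' < q \<or> q = q' \<and> i < i') ps"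
    "fst ` set ps \<subseteq> {1..Suc r}" "\<forall>(q, j) \<in> set ps. q = Suc r \<longrightarrow> Suc i \<le> j"
    using assms(1) unfolding run_path_def by blast
  have *: "q \<le> Suc r" if "(q, j) \<in> set ps" for q j
    using ps(3) that by force
  have **: "Suc i \<le> j" if "(Suc r, j) \<in> set ps" for j
    using ps(4) that by force
  have "sorted_wrt (\<lambda>(q, i) (q', i'). q' < q \<or> q = q' \<and> i < i') ((Suc r, i) # ps)"
  proof -
    have "q < Suc r \<or> Suc r = q \<and> i < j" if "(q, j) \<in> set ps" for q j
      using *[OF that] **[of j] that by (cases "q = Suc r") auto
    then show ?thesis using ps(2) by auto
  qed
  moreover have "\<forall>(q, j) \<in> set ((Suc r, i) # ps). q = Suc r \<longrightarrow> i \<le> j"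
    using ** by (auto dest: Suc_leD)
  ultimately show ?thesis
    unfolding run_path_def
    by (intro exI[of _ "(Suc r, i) # ps"] conjI) (use ps assms in simp_all)
qed

text \<open>The sweep carries the arc that reaches furthest among those begun so far: the bound by
  \<open>max i (y i)\<close> says that it starts at \<open>i\<close>, unless all of them have ended.
  The gaps already passed are down to \<open>R\<close>. When \<open>n\<close> is reached, all gaps
  are, and the next run begins.\<close>

lemma run_path_sweep:
  assumes "y \<in> invs f n" "1 \<le> i"
    and "\<And>j. card (crossings y j) \<le> Suc R" "\<And>j. j < i \<Longrightarrow> card (crossings y j) \<le> R"
    and "\<And>j. j \<le> i \<Longrightarrow> y j \<le> max i (y i)"
    and f: "f \<Longrightarrow> 1 \<le> R"
    and less: "\<And>y. y \<in> invs f n \<Longrightarrow> (\<And>j. card (crossings y j) \<le> R) \<Longrightarrow> run_path e y r 0"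
  shows "run_path e y (Suc r) i"
  using assms(1-5)
proof (induction "n - i" arbitrary: y i rule: less_induct)
  case (less i y)
  note y = less.prems(1) and R = less.prems(3) and Ri = less.prems(4) and mx = less.prems(5)
  have inv: "involution y" by (rule invs_involution[OF y])
  show ?case
  proof (cases "i < n")
    case False
    have "card (crossings y j) \<le> R" for j
      using Ri[of j] crossings_outside[OF y, of j] False by (cases "j < i") auto
    then have "run_path e y r 0" using y assms(7) by blast
    then show ?thesis by (rule run_path_new_run)
  next
    case True
    have skip: "run_path e y (Suc r) i"
      if "card (crossings y i) \<le> R" "\<And>j. j \<le> Suc i \<Longrightarrow> y j \<le> max (Suc i) (y (Suc i))"
    proof -
      have "run_path e y (Suc r) (Suc i)"
        by (rule less.hyps) (use True y R Ri that in \<open>auto simp: less_Suc_eq\<close>)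
      then show ?thesis by (rule run_path_mono) simp
    qed
    have step: "run_path e y (Suc r) i"
      if d: "y (Suc i) < y i" "i < y i" and f: "inv_act y i \<in> invs f n"
        and *: "\<And>j. j \<le> Suc i \<Longrightarrow> inv_act y i j \<le> max (Suc i) (inv_act y i (Suc i))"
    proof (rule run_path_letter)
      show "run_path e (inv_act y i) (Suc r) (Suc i)"
      proof (rule less.hyps)
        show "card (crossings (inv_act y i) j) \<le> Suc R" for j
          using crossings_sweep[OF inv d R] card_crossings_inv_act[OF inv d(1)] R[of j]
          by (cases "j = i") auto
        show "card (crossings (inv_act y i) j) \<le> R" if "j < Suc i" for j
          using crossings_sweep[OF inv d R] card_crossings_inv_act[OF inv d(1)] Ri[of j] that
          by (cases "j = i") auto
      qed (use True f * in auto)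
    qed (use d less.prems(2) in auto)
    consider "y i \<le> i" | "i < y i" "y i < y (Suc i)" | "y i = Suc i" | "Suc i < y i" "y (Suc i) < y i"
      using involution_eq_iff[OF inv, of i "Suc i"] by linarith
    then show ?thesis
    proof cases
      case 1
      then have "y j \<le> i" if "j \<le> i" for j using mx[OF that] by simp
      moreover from this have "crossings y i = {}" by (auto simp: crossings_def not_less)
      moreover have "i < y (Suc i)"
        using \<open>\<And>j. j \<le> i \<Longrightarrow> y j \<le> i\<close>[of "y (Suc i)"] involutionD[OF inv] by (metis Suc_n_not_le_n not_le)
      moreover have "y j \<le> max (Suc i) (y (Suc i))" if "j \<le> Suc i" for j
        using \<open>\<And>j. j \<le> i \<Longrightarrow> y j \<le> i\<close>[of j] that by (cases "j = Suc i") auto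
      ultimately show ?thesis by (intro skip) auto
    next
      case 2
      have "card (crossings y i) < card (crossings y (Suc i))"
      proof (rule crossings_ascent[OF inv])
        show "i < y (Suc i)" "y i \<noteq> Suc i" using 2 involutionD[OF inv, of i] by auto
        show "y (Suc i) \<noteq> Suc i" using 2 by linarith
      qed
      then have "card (crossings y i) \<le> R" using R[of "Suc i"] by simp
      moreover have "y j \<le> y (Suc i)" if "j \<le> Suc i" for j
        using 2 mx[of j] that by (cases "j = Suc i") auto
      ultimately show ?thesis by (intro skip) (auto simp: le_max_iff_disj)
    next
      case 3
      then have S: "y (Suc i) = i" using inv by (metis involutionD)
      have le: "y j \<le> Suc i" if "j \<le> Suc i" for j
        using mx[of j] 3 S that by (cases "j = Suc i") auto
      show ?thesis
      proof (cases f)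
        \<comment> \<open>The arc must stay. All arcs begun so far end by \<open>Suc i\<close>, so
          it is alone over its gap and \<open>1 \<le> R\<close> suffices.\<close>
        case True
        have "a = i" if "a \<in> crossings y i" for a
        proof -
          have "y a = Suc i" using le[of a] that by (simp add: crossings_def)
          then have "y (Suc i) = a" using involutionD[OF inv, of a] by simp
          then show ?thesis using S by simp
        qed
        then have "crossings y i \<subseteq> {i}" by blast
        then have "card (crossings y i) \<le> card {i}" by (intro card_mono) auto
        then have "card (crossings y i) \<le> R" using f[OF True] by simp
        then show ?thesis using le by (intro skip) auto
      next
        case False
        then have y': "inv_act y i = y \<circ> s i" "inv_act y i \<in> invs f n"
          using inv_act_remove[OF inv 3] invs_remove[of y n i] 3 y less.prems(2) by auto
        show ?thesis
        proof (rule step)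
          show "inv_act y i j \<le> max (Suc i) (inv_act y i (Suc i))" if "j \<le> Suc i" for j
          proof -
            have "s i j \<le> Suc i" using that by (simp add: transpose_def)
            then show ?thesis using le y' by (simp add: le_max_iff_disj)
          qed
        qed (use 3 S y' in auto)
      qed
    next
      case 4
      then have y': "inv_act y i = s i \<circ> y \<circ> s i" "inv_act y i \<in> invs f n"
        using inv_act_conj[OF inv] invs_conj[OF y less.prems(2)] by auto
      \<comment> \<open>The carried arc now starts at \<open>Suc i\<close>.\<close>
      have top: "inv_act y i (Suc i) = y i"
        using y' 4 by (simp add: s_other)
      show ?thesis
      proof (rule step)
        show "inv_act y i j \<le> max (Suc i) (inv_act y i (Suc i))" if "j \<le> Suc i" for j
        proof -
          have "s i j \<le> Suc i" using that by (simp add: transpose_def)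
          then have "y (s i j) \<le> y i"
            using mx[of "s i j"] 4 by (cases "s i j = Suc i") auto
          then have "s i (y (s i j)) \<le> max (Suc i) (y i)"
            by (auto simp: transpose_def)
          then show ?thesis unfolding top by (simp add: y')
        qed
      qed (use 4 y' in auto)
    qed
  qed
qed

section \<open>Involutions with at most one arc over each gap\<close>

lemma crossings_0_imp_id:
  assumes y: "y \<in> invs f n" and c: "\<And>j. card (crossings y j) \<le> 0"
  shows "y = id"
proof
  fix x
  have inv: "involution y" by (rule invs_involution[OF y])
  have le: "y a \<le> a" for a
    using c[of a] by (auto simp: crossings_def)
  then have "y (y x) \<le> y x" by blast
  with le[of x] show "y x = id x" by (simp add: involutionD[OF inv])
qed

lemma v_simps: "t < n \<Longrightarrow> v n (Suc (2 * t)) = Suc (Suc (2 * t))"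
  "t < n \<Longrightarrow> v n (Suc (Suc (2 * t))) = Suc (2 * t)"
  "2 * n < x \<Longrightarrow> v n x = x" "v n 0 = 0"
  by (auto simp: v_def)

lemma fpf_point_cases:
  fixes x :: nat
  obtains "x = 0" | t where "t < n" "x = 2 * t + 1" | t where "t < n" "x = 2 * t + 2" | "2 * n < x"
proof (cases "x = 0 \<or> 2 * n < x")
  case False
  then show ?thesis
  proof (cases "even x")
    case True
    then obtain t where "x = 2 * t" by blast
    with False show ?thesis by (intro that(3)[of "t - 1"]) auto
  next
    case odd: False
    then obtain t where "x = 2 * t + 1" by (blast elim: oddE)
    with False show ?thesis by (intro that(2)[of t]) auto
  qed
qed (use that in auto)

text \<open>Once the points up to \<open>2 * t\<close> are matched among themselves, the next two
  points have partners beyond \<open>2 * t\<close>. If these two were not joined, both their arcs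
  would pass over the gap after \<open>2 * t + 2\<close>.\<close>

lemma crossings_1_imp_v:
  assumes y: "y \<in> invs True (2 * n)" and c: "\<And>j. card (crossings y j) \<le> 1"
  shows "y = v n"
proof -
  have inv: "involution y" by (rule invs_involution[OF y])
  have pair: "y (2 * t + 1) = 2 * t + 2" if "t < n" for t
    using that
  proof (induction t rule: less_induct)
    case (less t)
    have low: "y x = v n x" if "x \<le> 2 * t" for x
    proof (cases x rule: fpf_point_cases[where n = t])
      case (2 u)
      then show ?thesis using less by (simp add: v_simps)
    next
      case (3 u)
      then have "y (2 * u + 1) = x" using less by simp
      then have "y x = 2 * u + 1" using inv by (metis involutionD)
      then show ?thesis using 3 less by (simp add: v_simps)
    qed (use that y less in \<open>auto simp: v_simps invs_def\<close>)
    have high: "2 * t < y x" if "2 * t < x" for x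
    proof (rule ccontr)
      assume "\<not> 2 * t < y x"
      then have "x = v n (y x)" using low[of "y x"] inv by (metis involutionD not_le)
      also have "\<dots> \<le> 2 * t"
        using \<open>\<not> 2 * t < y x\<close> by (cases "y x" rule: fpf_point_cases[where n = t]) (use less in \<open>auto simp: v_simps\<close>)
      finally show False using that by simp
    qed
    have ne: "y (2 * t + 1) \<noteq> 2 * t + 1" "y (2 * t + 2) \<noteq> 2 * t + 2"
      using y less.prems by (auto simp: invs_def)
    show ?case
    proof (rule ccontr)
      assume "y (2 * t + 1) \<noteq> 2 * t + 2"
      then have "2 * t + 2 < y (2 * t + 1)" using ne high[of "2 * t + 1"] by simp
      moreover have "y (2 * t + 2) \<noteq> 2 * t + 1"
        using \<open>y (2 * t + 1) \<noteq> 2 * t + 2\<close> inv by (metis involutionD)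
      then have "2 * t + 2 < y (2 * t + 2)" using ne high[of "2 * t + 2"] by simp
      ultimately have "{2 * t + 1, 2 * t + 2} \<subseteq> crossings y (2 * t + 2)"
        by (auto simp: crossings_def)
      then have "card {2 * t + 1, 2 * t + 2} \<le> card (crossings y (2 * t + 2))"
        by (intro card_mono) auto
      then show False using c[of "2 * t + 2"] by simp
    qed
  qed
  show ?thesis
  proof
    fix x
    show "y x = v n x"
    proof (cases x rule: fpf_point_cases[where n = n])
      case (3 t)
      then have "y (2 * t + 1) = x" using pair by simp
      then have "y x = 2 * t + 1" using inv by (metis involutionD)
      then show ?thesis using 3 by (simp add: v_simps)
    qed (use pair y in \<open>auto simp: v_simps invs_def\<close>)
  qed
qed

definition base :: "bool \<Rightarrow> nat \<Rightarrow> nat \<Rightarrow> nat" where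
  "base f n = (if f then v (n div 2) else id)"

text \<open>Each sweep costs one run, until at most \<open>of_bool f\<close> arcs are left over each
  gap; this remaining level is the base point.\<close>

lemma run_path_crossings:
  assumes "y \<in> invs f n" "f \<Longrightarrow> even n" "\<And>j. card (crossings y j) \<le> r + of_bool f"
  shows "run_path (base f n) y r 0"
  using assms(1,3)
proof (induction r arbitrary: y)
  case 0
  have "y = base f n"
  proof (cases f)
    case True
    then have "y \<in> invs True (2 * (n div 2))" using 0 assms(2) by simp
    then show ?thesis
      using crossings_1_imp_v[of y] 0 True by (simp add: base_def)
  next
    case False
    then show ?thesis
      using crossings_0_imp_id[of y f n] 0 by (simp add: base_def)
  qed
  then show ?case
    by (auto simp: run_path_def intro: exI[of _ "[]"])
next
  case (Suc r)
  have "run_path (base f n) y (Suc r) 1"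
  proof (rule run_path_sweep[where f = f and n = n and R = "r + of_bool f"])
    show "card (crossings y j) \<le> r + of_bool f" if "j < 1" for j
    proof -
      have "crossings y j = {}"
        using that invs_zero[OF Suc.prems(1)] by (auto simp: crossings_def intro: gr0I)
      then show ?thesis by simp
    qed
    show "y j \<le> max 1 (y 1)" if "j \<le> 1" for j
      using that invs_zero[OF Suc.prems(1)] by (cases "j = 0") (auto simp: le_Suc_eq)
  qed (use Suc in auto)
  then show ?case by (rule run_path_mono) simp
qed

section \<open>Words with a long increasing run\<close>

text \<open>For an involution these are the nonempty rows of its involution Rothe diagram, whose
  cells \<open>(j, y l)\<close> satisfy \<open>y l \<le> j\<close>, or of the fixed-point-free
  variant with \<open>y l < j\<close>. In the first case no bound by the diagonal appears: if
  \<open>j < y l < y j\<close>, then the later position \<open>y j\<close> undercuts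
  \<open>j\<close> with the value \<open>j\<close>.\<close>

definition undercut :: "bool \<Rightarrow> (nat \<Rightarrow> nat) \<Rightarrow> nat set" where
  "undercut f y = {j. \<exists>l>j. y l < (if f then min j (y j) else y j)}"

lemma undercut_subset: "y \<in> invs f n \<Longrightarrow> undercut f' y \<subseteq> {1..<n}"
proof
  fix j
  assume y: "y \<in> invs f n" and "j \<in> undercut f' y"
  then obtain l where l: "j < l" "y l < y j"
    by (auto simp: undercut_def split: if_splits)
  have "j \<noteq> 0" using l invs_zero[OF y] by (metis not_less0)
  moreover have "j < n"
  proof (rule ccontr)
    assume "\<not> j < n"
    then have "y l = l" using l invs_fixed[OF y] by simp
    moreover have "y j \<le> j"
      using \<open>\<not> j < n\<close> invs_fixed[OF y, of j] invs_le[OF y, of j] by (cases "j = n") auto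
    ultimately show False using l by simp
  qed
  ultimately show "j \<in> {1..<n}" by simp
qed

lemma finite_undercut: "y \<in> invs f n \<Longrightarrow> finite (undercut f' y)"
  by (rule finite_subset[OF undercut_subset]) auto

text \<open>For \<open>j < i\<close> the exchange of positions is invisible, and the exchange of the
  values \<open>i\<close> and \<open>Suc i\<close> matters only if one of them is the partner of
  \<open>j\<close>. Then the threshold is \<open>j\<close> itself when \<open>f\<close> holds;
  otherwise \<open>j\<close> is undercut before and after by the small value
  \<open>y (Suc i)\<close>.\<close>

lemma undercut_conj:
  assumes y: "involution y" and d: "y (Suc i) < i" "y (Suc i) < y i" and j: "j < i"
  shows "j \<in> undercut f (s i \<circ> y \<circ> s i) \<longleftrightarrow> j \<in> undercut f y"
proof -
  have above: "(\<exists>l>j. P (s i l)) \<longleftrightarrow> (\<exists>l>j. P l)" for P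
  proof -
    have "j < l \<Longrightarrow> j < s i l" for l using j by (auto simp: transpose_def)
    then show ?thesis by (metis s_simps(3))
  qed
  have [simp]: "s i j = j" using j by (simp add: s_other)
  have cmp: "s i x < t \<longleftrightarrow> x < t" if "t \<noteq> Suc i" for x t
    using that by (auto simp: transpose_def)
  show ?thesis
  proof (cases "y j \<in> {i, Suc i}")
    case False
    then have "s i (y j) = y j" and "y j \<noteq> Suc i" by (auto simp: s_other)
    define t where "t = (if f then min j (y j) else y j)"
    have "t \<noteq> Suc i" using j \<open>y j \<noteq> Suc i\<close> by (simp add: t_def min_def)
    then have "(\<exists>l>j. s i (y (s i l)) < t) \<longleftrightarrow> (\<exists>l>j. y l < t)"
      using above[of "\<lambda>l. y l < t"] by (simp add: cmp)
    moreover have "j \<in> undercut f (s i \<circ> y \<circ> s i) \<longleftrightarrow> (\<exists>l>j. s i (y (s i l)) < t)"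
      using \<open>s i (y j) = y j\<close> by (simp add: undercut_def t_def)
    moreover have "j \<in> undercut f y \<longleftrightarrow> (\<exists>l>j. y l < t)"
      by (simp add: undercut_def t_def)
    ultimately show ?thesis by simp
  next
    case True
    then have "min j (s i (y j)) = j" "min j (y j) = j" "j \<noteq> Suc i" using j by (auto simp: transpose_def)
    then have f: ?thesis if f
      using above[of "\<lambda>l. y l < j"] cmp[of j] that
      by (simp add: undercut_def del: min_less_iff_conj)
    have nf: ?thesis if "\<not> f"
    proof -
      have "j < Suc i" "y (Suc i) < y j" using True j d by auto
      then have "\<exists>l>j. y l < y j" by blast
      moreover have "s i (y (s i i)) < s i (y j)" "j < i" using True j d by (auto simp: transpose_def)
      then have "\<exists>l>j. s i (y (s i l)) < s i (y j)" by blast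
      ultimately show ?thesis using that by (simp add: undercut_def)
    qed
    show ?thesis using f nf by blast
  qed
qed

text \<open>The mirror image of the first sweep: \<open>Suc i\<close> carries the smallest value
  beyond \<open>i\<close>, unless all these values exceed \<open>i\<close>. It decides whether
  \<open>i\<close> is undercut, and the letter \<open>i\<close> is used exactly then. Read
  backwards, the decreasing list \<open>b\<close> is an increasing run at the end of a word.\<close>

lemma rise_sweep:
  assumes "y \<in> invs f n" "\<And>j. i < j \<Longrightarrow> min (Suc i) (y (Suc i)) \<le> y j"
  shows "\<exists>b y'. y' \<in> invs f n \<and> down y b y' \<and> sorted_wrt (>) b \<and> set b \<subseteq> {1..i} \<and>
    length b = card (undercut f y \<inter> {..i})"
  using assms
proof (induction i arbitrary: y)
  case 0
  have "undercut f y \<inter> {..0} = {}" using undercut_subset[OF 0(1), of f] by force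
  with 0(1) show ?case by (intro exI[of _ "[]"] exI[of _ y]) auto
next
  case (Suc k)
  define i where "i = Suc k"
  note y = Suc.prems(1) and mn = Suc.prems(2)[folded i_def]
  have inv: "involution y" by (rule invs_involution[OF y])
  have split: "undercut f y' \<inter> {..i} = (undercut f y' \<inter> {..k}) \<union> (undercut f y' \<inter> {i})" for y'
    by (auto simp: i_def)
  have skip: ?case if nu: "i \<notin> undercut f y" and lo: "\<And>j. k < j \<Longrightarrow> min i (y i) \<le> y j"
  proof -
    obtain b y' where b: "y' \<in> invs f n" "down y b y'" "sorted_wrt (>) b" "set b \<subseteq> {1..k}"
      "length b = card (undercut f y \<inter> {..k})"
      using Suc.IH[OF y] lo by (auto simp: i_def)
    have "undercut f y \<inter> {..i} = undercut f y \<inter> {..k}" using nu split by auto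
    then show ?thesis using b by (intro exI[of _ b] exI[of _ y']) (auto simp: i_def)
  qed
  have step: ?case
    if d: "y (Suc i) < y i" and y1: "inv_act y i \<in> invs f n" and u: "i \<in> undercut f y"
      and eq: "\<And>j. j < i \<Longrightarrow> j \<in> undercut f (inv_act y i) \<longleftrightarrow> j \<in> undercut f y"
      and *: "\<And>j. k < j \<Longrightarrow> min i (inv_act y i i) \<le> inv_act y i j"
  proof -
    obtain b y' where b: "y' \<in> invs f n" "down (inv_act y i) b y'" "sorted_wrt (>) b" "set b \<subseteq> {1..k}"
      "length b = card (undercut f (inv_act y i) \<inter> {..k})"
      using Suc.IH[OF y1] * by (auto simp: i_def)
    have "undercut f (inv_act y i) \<inter> {..k} = undercut f y \<inter> {..k}"
      using eq by (auto simp: i_def)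
    moreover have "card (undercut f y \<inter> {..i}) = Suc (card (undercut f y \<inter> {..k}))"
      unfolding split using u by (subst card_Un_disjoint) (auto simp: i_def)
    ultimately show ?thesis
      using b d by (intro exI[of _ "i # b"] exI[of _ y']) (auto simp: i_def)
  qed
  consider "i < y (Suc i)" | "y (Suc i) < i" "y i < y (Suc i)" | "y (Suc i) < i" "y (Suc i) < y i" | "y (Suc i) = i"
    using involution_eq_iff[OF inv, of i "Suc i"] by linarith
  then show ?case
  proof cases
    case 1
    then have high: "i < y j" if "i < j" for j using mn[OF that] by simp
    have "y i \<le> i"
      using high[of "y i"] involutionD[OF inv, of i] by (metis less_irrefl not_le)
    show ?thesis
    proof (rule skip)
      show "i \<notin> undercut f y"
      proof
        assume "i \<in> undercut f y"
        then obtain l where "i < l" "y l < y i" by (auto simp: undercut_def split: if_splits)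
        then show False using high[of l] \<open>y i \<le> i\<close> by simp
      qed
      show "min i (y i) \<le> y j" if "k < j" for j
        using high[of j] \<open>y i \<le> i\<close> that by (cases "j = i") (auto simp: i_def)
    qed
  next
    case 2
    then have low: "y (Suc i) \<le> y j" if "i < j" for j using mn[OF that] by simp
    show ?thesis
    proof (rule skip)
      show "i \<notin> undercut f y"
      proof
        assume "i \<in> undercut f y"
        then obtain l where "i < l" "y l < y i" by (auto simp: undercut_def split: if_splits)
        then show False using low[of l] 2 by simp
      qed
      show "min i (y i) \<le> y j" if "k < j" for j
        using low[of j] 2 that by (cases "j = i") (auto simp: i_def)
    qed
  next
    case 3
    then have low: "y (Suc i) \<le> y j" if "i < j" for j using mn[OF that] by simp
    have ne: "y i \<noteq> Suc i" using 3 inv by (metis involutionD less_irrefl)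
    have y1: "inv_act y i = s i \<circ> y \<circ> s i" by (rule inv_act_conj[OF inv 3(2) ne])
    show ?thesis
    proof (rule step)
      show "inv_act y i \<in> invs f n"
        using ne 3 by (intro invs_conj[OF y]) (auto simp: i_def)
      show "i \<in> undercut f y" using 3 by (auto simp: undercut_def intro: exI[of _ "Suc i"])
      show "j \<in> undercut f (inv_act y i) \<longleftrightarrow> j \<in> undercut f y" if "j < i" for j
        unfolding y1 by (rule undercut_conj[OF inv 3 that])
      show "min i (inv_act y i i) \<le> inv_act y i j" if "k < j" for j
      proof -
        have "y (Suc i) \<le> y (s i j)"
          using low[of "s i j"] 3 that by (cases "s i j = i") (auto simp: i_def transpose_def split: if_splits)
        then show ?thesis using 3 by (auto simp: y1 transpose_def)
      qed
    qed (use 3 in simp)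
  next
    case 4
    then have yi: "y i = Suc i" using inv by (metis involutionD)
    have low: "i \<le> y j" if "k < j" for j
      using mn[of j] 4 yi that by (cases "j = i") (auto simp: i_def)
    show ?thesis
    proof (cases f)
      \<comment> \<open>The arc must stay, and accordingly the \<open>min\<close> in
        \<open>undercut\<close> keeps the value \<open>i\<close> from undercutting the position
        \<open>i\<close>.\<close>
      case True
      show ?thesis
      proof (rule skip)
        show "i \<notin> undercut f y"
        proof
          assume "i \<in> undercut f y"
          then obtain l where "i < l" "y l < i" using True by (auto simp: undercut_def)
          then show False using low[of l] by (simp add: i_def)
        qed
        show "min i (y i) \<le> y j" if "k < j" for j using low[OF that] by simp
      qed
    next
      case False
      then have y1: "inv_act y i = y \<circ> s i" "inv_act y i \<in> invs f n"
        using inv_act_remove[OF inv yi] invs_remove[of y n i] yi y by (auto simp: i_def)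
      show ?thesis
      proof (rule step)
        show "i \<in> undercut f y" using False yi 4 by (auto simp: undercut_def intro: exI[of _ "Suc i"])
        show "j \<in> undercut f (inv_act y i) \<longleftrightarrow> j \<in> undercut f y" if "j < i" for j
        proof -
          have "(\<exists>l>j. y (s i l) < y j) \<longleftrightarrow> (\<exists>l>j. y l < y j)"
          proof -
            have "j < l \<Longrightarrow> j < s i l" for l using that by (auto simp: transpose_def)
            then show ?thesis by (metis s_simps(3))
          qed
          then show ?thesis using False y1 that by (simp add: undercut_def s_other)
        qed
        show "min i (inv_act y i i) \<le> inv_act y i j" if "k < j" for j
        proof -
          have "k < s i j" using that by (auto simp: i_def transpose_def)
          then show ?thesis using low y1 by (simp add: min.coboundedI1)
        qed
      qed (use 4 yi y1 in auto)
    qed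
  qed
qed

text \<open>All positions beyond \<open>n\<close> are fixed, so the invariant of the sweep holds at
  \<open>n\<close>.\<close>

lemma down_undercut:
  assumes y: "y \<in> invs f n"
  obtains b y' where "y' \<in> invs f n" "down y b y'" "sorted_wrt (>) b" "length b = card (undercut f y)"
proof -
  have "min (Suc n) (y (Suc n)) \<le> y j" if "n < j" for j
    using that invs_fixed[OF y, of j] by simp
  from rise_sweep[OF y this] obtain b y' where
    b: "y' \<in> invs f n" "down y b y'" "sorted_wrt (>) b" "length b = card (undercut f y \<inter> {..n})"
    by blast
  moreover have "undercut f y \<inter> {..n} = undercut f y"
    using undercut_subset[OF y, of f] by fastforce
  ultimately show ?thesis using that by simp
qed

section \<open>Expansions in terms of rises\<close>

definition rises :: "'a::linorder list \<Rightarrow> nat set" where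
  "rises a = {j. Suc j < length a \<and> a ! j < a ! Suc j}"

lemma finite_rises [simp]: "finite (rises a)"
  by (rule finite_subset[of _ "{..length a}"]) (auto simp: rises_def)

lemma Cseq_eq: "Cseq a = {I. length I = length a \<and> set I \<subseteq> {1..} \<and> sorted I \<and> rises a \<subseteq> rises I}"
  by (auto simp: Cseq_def rises_def)

text \<open>A sorted list is determined by its multiset, so a word contributes at most one sequence
  to each monomial.\<close>

lemma gen_series_Cseq:
  "gen_series mset (Cseq a) M =
    of_bool (size M = length a \<and> 0 \<notin># M \<and> rises a \<subseteq> rises (sorted_list_of_multiset M))"
proof -
  have sl: "I = sorted_list_of_multiset M" if "sorted I" "mset I = M" for I
    using that by (metis sorted_list_of_multiset_mset sorted_sort_id)
  let ?P = "size M = length a \<and> 0 \<notin># M \<and> rises a \<subseteq> rises (sorted_list_of_multiset M)"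
  have len: "length (sorted_list_of_multiset M) = size M"
    by (metis mset_sorted_list_of_multiset size_mset)
  have pos: "set_mset M \<subseteq> {1..} \<longleftrightarrow> 0 \<notin># M"
    by (auto simp: Suc_le_eq intro!: gr0I)
  have "{I \<in> Cseq a. mset I = M} = (if ?P then {sorted_list_of_multiset M} else {})"
  proof (intro set_eqI iffI)
    fix I assume "I \<in> {I \<in> Cseq a. mset I = M}"
    then have *: "sorted I" "mset I = M" "length I = length a" "set I \<subseteq> {1..}" "rises a \<subseteq> rises I"
      by (auto simp: Cseq_eq)
    then have "I = sorted_list_of_multiset M" using sl by blast
    moreover have ?P
      using * calculation pos by (metis set_mset_mset size_mset)
    ultimately show "I \<in> (if ?P then {sorted_list_of_multiset M} else {})" by simp
  next
    fix I assume "I \<in> (if ?P then {sorted_list_of_multiset M} else {})"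
    then have ?P "I = sorted_list_of_multiset M" by (auto split: if_splits)
    then show "I \<in> {I \<in> Cseq a. mset I = M}"
      using len pos by (simp add: Cseq_eq)
  qed
  then have "card {I \<in> Cseq a. mset I = M} = of_bool ?P" by simp
  then show ?thesis unfolding gen_series_def by (simp only: of_nat_of_bool)
qed

text \<open>This is the expansion into fundamental quasisymmetric functions, stated for
  coefficients.\<close>

lemma Fhat_rel_rises:
  assumes "finite (Rhat e z)" "\<And>a. a \<in> Rhat e z \<Longrightarrow> length a = N"
  shows "Fhat_rel e z M = (if size M = N \<and> 0 \<notin># M
    then int (card {a \<in> Rhat e z. rises a \<subseteq> rises (sorted_list_of_multiset M)}) else 0)"
proof -
  let ?P = "size M = N \<and> 0 \<notin># M"
  have "Fhat_rel e z M = (\<Sum>a\<in>Rhat e z. of_bool (?P \<and> rises a \<subseteq> rises (sorted_list_of_multiset M)))"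
    unfolding Fhat_rel_def gen_series_Cseq by (rule sum.cong) (auto simp: assms(2))
  also have "\<dots> = (if ?P then (\<Sum>a\<in>Rhat e z. of_bool (rises a \<subseteq> rises (sorted_list_of_multiset M))) else 0)"
  proof (cases ?P)
    case False
    then have "\<not> (?P \<and> Q)" for Q by blast
    with False show ?thesis by (simp only: of_bool_def if_False sum.neutral_const)
  qed simp
  also have "(\<Sum>a\<in>Rhat e z. of_bool (rises a \<subseteq> rises (sorted_list_of_multiset M))) =
      int (card {a \<in> Rhat e z. rises a \<subseteq> rises (sorted_list_of_multiset M)})"
    using assms(1) by (simp add: of_bool_def sum.If_cases Int_def)
  finally show ?thesis .
qed

section \<open>Linear extensions and semistandard tableaux\<close>

definition below :: "nat \<times> nat \<Rightarrow> nat \<times> nat \<Rightarrow> bool" where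
  "below x y \<longleftrightarrow> fst x \<le> fst y \<and> snd x \<le> snd y"

text \<open>As \<open>below\<close> is reflexive, the condition also excludes repeated cells. For
  the diagram of a partition these lists are the standard tableaux.\<close>

definition linexts :: "(nat \<times> nat) set \<Rightarrow> (nat \<times> nat) list set" where
  "linexts D = {c. sorted_wrt (\<lambda>x y. \<not> below y x) c \<and> set c = D}"

text \<open>The negative of the usual content: with this sign a rise along a standard tableau is a
  descent in the usual sense, the next cell lying in a lower row.\<close>

definition content :: "nat \<times> nat \<Rightarrow> int" where
  "content x = int (fst x) - int (snd x)"

lemma below_refl [simp]: "below x x"
  by (simp add: below_def)

lemma linexts_distinct: "c \<in> linexts D \<Longrightarrow> distinct c"
proof -
  have "sorted_wrt (\<lambda>x y. \<not> below y x) c \<Longrightarrow> distinct c"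
    by (induction c) auto
  then show "c \<in> linexts D \<Longrightarrow> distinct c" by (simp add: linexts_def)
qed

lemma linexts_length: "c \<in> linexts D \<Longrightarrow> length c = card D"
  using linexts_distinct[of c D] by (auto simp: linexts_def distinct_card)

lemma linexts_index_less:
  assumes "c \<in> linexts D" "j < length c" "l < length c" "below (c ! j) (c ! l)" "j \<noteq> l"
  shows "j < l"
proof (rule ccontr)
  assume "\<not> j < l"
  then have "\<not> below (c ! j) (c ! l)"
    using assms by (intro sorted_wrt_nth_less[of "\<lambda>x y. \<not> below y x"]) (auto simp: linexts_def)
  with assms(4) show False by blast
qed

lemma finite_linexts: "finite D \<Longrightarrow> finite (linexts D)"
  using linexts_distinct
  by (intro finite_subset[OF _ finite_subset_distinct[of D]]) (auto simp: linexts_def)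

lemma finite_diagram [simp]: "finite (diagram p)"
proof -
  have "diagram p = (SIGMA i:{..<length p}. {..<p ! i})" by (auto simp: diagram_def)
  then show ?thesis by simp
qed

lemma diagram_below:
  assumes "is_partition p" "y \<in> diagram p" "below x y"
  shows "x \<in> diagram p"
proof -
  have "p ! fst y \<le> p ! fst x"
  proof (cases "fst x = fst y")
    case False
    then show ?thesis
      using assms sorted_wrt_nth_less[of "(\<ge>)" p "fst x" "fst y"]
      by (auto simp: is_partition_def diagram_def below_def)
  qed simp
  then show ?thesis
    using assms by (auto simp: diagram_def below_def split: prod.splits)
qed

lemma nondecreasing_between:
  fixes a :: "nat \<Rightarrow> 'a::linorder"
  assumes "j \<le> l" "\<And>q. j \<le> q \<Longrightarrow> q < l \<Longrightarrow> a (Suc q) \<le> a q"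
  shows "a l \<le> a j"
  using assms
proof (induction l rule: dec_induct)
  case (step l)
  then have "a (Suc l) \<le> a l" "a l \<le> a j" by auto
  then show ?case by simp
qed simp

lemma rise_between:
  assumes "j < l" "l < length a" "a ! j < a ! l"
  obtains q where "j \<le> q" "q < l" "q \<in> rises a"
proof -
  have "\<exists>q. j \<le> q \<and> q < l \<and> a ! q < a ! Suc q"
    using nondecreasing_between[of j l "(!) a"] assms by (force simp: not_less)
  then show ?thesis using that assms(2) by (auto simp: rises_def)
qed

section \<open>Standardization of semistandard tableaux\<close>

lemma SSYT_mono:
  assumes p: "is_partition p" and T: "T \<in> SSYT p" and y: "y \<in> diagram p" and "below x y"
  shows "T x \<le> T y" "fst x < fst y \<Longrightarrow> T x < T y"
proof -
  obtain i j i' j' where xy: "x = (i, j)" "y = (i', j')" by force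
  with \<open>below x y\<close> have ij: "i \<le> i'" "j \<le> j'" by (auto simp: below_def)
  have in_D: "(a, b) \<in> diagram p" if "a \<le> i'" "b \<le> j'" for a b
    using that y xy by (intro diagram_below[OF p y]) (auto simp: below_def)
  have row: "T (i, j) \<le> T (i, j')"
    using ij(2) in_D
  proof (induction j' rule: dec_induct)
    case (step b)
    have "T (i, b) \<le> T (i, Suc b)"
      using T step.prems[of i "Suc b"] ij(1) by (auto simp: SSYT_def)
    moreover have "T (i, j) \<le> T (i, b)"
      using step.IH step.prems by simp
    ultimately show ?case by simp
  qed simp
  have col: "T (i, j') + (i' - i) \<le> T (i', j')"
    using ij(1) in_D
  proof (induction i' rule: dec_induct)
    case (step a)
    have "T (a, j') < T (Suc a, j')"
      using T step.prems[of "Suc a" j'] by (auto simp: SSYT_def)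
    moreover have "T (i, j') + (a - i) \<le> T (a, j')"
      using step.IH step.prems by simp
    ultimately show ?case using step.hyps by (simp add: Suc_diff_le)
  qed simp
  show "T x \<le> T y" "fst x < fst y \<Longrightarrow> T x < T y"
    using row col xy by auto
qed

lemma sorted_wrt_asym_unique:
  assumes "sorted_wrt R xs" "sorted_wrt R ys" "set xs = set ys"
    and "\<And>x y. x \<in> set xs \<Longrightarrow> y \<in> set xs \<Longrightarrow> R x y \<Longrightarrow> \<not> R y x"
  shows "xs = ys"
  using assms
proof (induction xs arbitrary: ys)
  case (Cons x xs)
  obtain y ys' where ys: "ys = y # ys'" using Cons.prems(3) by (cases ys) auto
  have "x = y"
  proof (rule ccontr)
    assume "x \<noteq> y"
    with ys Cons.prems(3) have *: "y \<in> set xs" "x \<in> set ys'"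
      by (metis list.set_intros(1) set_ConsD)+
    then have "R x y" "R y x" using Cons.prems(1,2) ys by (metis sorted_wrt.simps(2))+
    moreover have "x \<in> set (x # xs)" "y \<in> set (x # xs)" using * by simp_all
    ultimately show False using Cons.prems(4) by blast
  qed
  have "\<not> R x x" using Cons.prems(4)[of x x] by (meson list.set_intros(1))
  then have "x \<notin> set xs" "x \<notin> set ys'"
    using Cons.prems(1,2) ys \<open>x = y\<close> by auto
  then have eq: "set xs = set ys'" using Cons.prems(3) ys \<open>x = y\<close> by auto
  have sorted: "sorted_wrt R xs" "sorted_wrt R ys'" using Cons.prems(1,2) ys by simp_all
  have "\<not> R b a" if "a \<in> set xs" "b \<in> set xs" "R a b" for a b
    using Cons.prems(4)[of a b] that by simp
  then have "xs = ys'" using Cons.IH[OF sorted eq] by blast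
  then show ?case using ys \<open>x = y\<close> by simp
qed simp

text \<open>The cells are listed by their entries; cells with equal entries form a horizontal strip
  and are listed from left to right, that is by falling content. A rise of the content then occurs
  only where the entry grows.\<close>

lemma SSYT_linext_exists:
  assumes p: "is_partition p" and T: "T \<in> SSYT p"
  obtains c where "c \<in> linexts (diagram p)" "sorted (map T c)" "rises (map content c) \<subseteq> rises (map T c)"
proof -
  \<comment> \<open>\<open>W\<close> exceeds all differences of contents, so the integer key
    \<open>k\<close> below sorts lexicographically by entry and then by falling content.\<close>
  obtain W where W: "\<And>x y. x \<in> diagram p \<Longrightarrow> y \<in> diagram p \<Longrightarrow> content x - content y < W"
  proof -
    have "finite ((\<lambda>(x, y). content x - content y) ` (diagram p \<times> diagram p))" by simp
    then obtain W where "\<forall>d\<in>(\<lambda>(x, y). content x - content y) ` (diagram p \<times> diagram p). d \<le> W"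
      by (metis Max_ge)
    then show ?thesis by (intro that[of "W + 1"]) force
  qed
  define k where "k x = int (T x) * W - content x" for x
  have kT: "T x \<le> T y" if "k x \<le> k y" "x \<in> diagram p" "y \<in> diagram p" for x y
  proof (rule ccontr)
    assume "\<not> T x \<le> T y"
    then have "1 \<le> int (T x) - int (T y)" by simp
    moreover have "0 < W" using W[OF that(2,2)] by simp
    ultimately have "W \<le> (int (T x) - int (T y)) * W" by simp
    then show False using that(1) W[OF that(2,3)] by (simp add: k_def algebra_simps)
  qed
  obtain xs where xs: "distinct xs" "set xs = diagram p"
    using finite_distinct_list[OF finite_diagram] by metis
  define c where "c = sort_key k xs"
  have c: "distinct c" "set c = diagram p" "sorted (map k c)"
    using xs by (simp_all add: c_def)
  have cD: "c ! j \<in> diagram p" if "j < length c" for j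
    using c that by (metis nth_mem)
  have le: "k (c ! j) \<le> k (c ! l)" if "j < l" "l < length c" for j l
    using sorted_nth_mono[OF c(3), of j l] that by simp
  have leT: "T (c ! j) \<le> T (c ! l)" if "j < l" "l < length c" for j l
    using kT[OF le[OF that]] cD that by simp
  have leC: "content (c ! l) \<le> content (c ! j)" if "j < l" "l < length c" "T (c ! l) \<le> T (c ! j)" for j l
  proof -
    have "T (c ! l) = T (c ! j)" using leT[OF that(1,2)] that(3) by simp
    then show ?thesis using le[OF that(1,2)] by (simp add: k_def)
  qed
  have "sorted (map T c)"
    using leT by (auto simp: sorted_iff_nth_mono_less)
  moreover have "rises (map content c) \<subseteq> rises (map T c)"
    using leT leC by (auto simp: rises_def) (meson lessI not_le)
  moreover have "c \<in> linexts (diagram p)"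
  proof -
    have "\<not> below (c ! l) (c ! j)" if "j < l" "l < length c" for j l
    proof
      assume b: "below (c ! l) (c ! j)"
      have D: "c ! j \<in> diagram p" using cD that by simp
      have "content (c ! l) \<le> content (c ! j)"
        using leC that SSYT_mono(1)[OF p T D b] by blast
      moreover have "\<not> fst (c ! l) < fst (c ! j)"
        using SSYT_mono(2)[OF p T D b] leT[OF that] by linarith
      ultimately have "c ! l = c ! j"
        using b by (auto simp: below_def content_def prod_eq_iff)
      then show False using c(1) that nth_eq_iff_index_eq[of c l j] by simp
    qed
    then show ?thesis using c by (simp add: linexts_def sorted_wrt_iff_nth_less)
  qed
  ultimately show ?thesis using that by blast
qed

text \<open>Both lists are sorted by the same strict order. It separates all cells, since distinct
  cells of equal content lie on one diagonal, where the entries grow strictly.\<close>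

lemma SSYT_linext_unique:
  assumes p: "is_partition p" and T: "T \<in> SSYT p"
    and c: "c \<in> linexts (diagram p)" "sorted (map T c)" "rises (map content c) \<subseteq> rises (map T c)"
    and c': "c' \<in> linexts (diagram p)" "sorted (map T c')" "rises (map content c') \<subseteq> rises (map T c')"
  shows "c = c'"
proof (rule sorted_wrt_asym_unique)
  let ?R = "\<lambda>x y. T x < T y \<or> T x = T y \<and> content y < content x"
  have "sorted_wrt ?R d" if d: "d \<in> linexts (diagram p)" "sorted (map T d)"
    "rises (map content d) \<subseteq> rises (map T d)" for d
  proof -
    have "?R (d ! j) (d ! l)" if jl: "j < l" "l < length d" for j l
    proof (cases "T (d ! j) = T (d ! l)")
      case True
      have "content (d ! l) \<le> content (d ! j)"
      proof (rule ccontr)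
        assume "\<not> ?thesis"
        then obtain q where q: "j \<le> q" "q < l" "q \<in> rises (map content d)"
          using rise_between[of j l "map content d"] jl by auto
        then have "T (d ! q) < T (d ! Suc q)" using d(3) by (auto simp: rises_def)
        moreover have "T (d ! j) \<le> T (d ! q)" "T (d ! Suc q) \<le> T (d ! l)"
          using sorted_nth_mono[OF d(2), of j q] sorted_nth_mono[OF d(2), of "Suc q" l] q jl by auto
        ultimately show False using True by simp
      qed
      moreover have "content (d ! l) \<noteq> content (d ! j)"
      proof
        assume eq: "content (d ! l) = content (d ! j)"
        have D: "d ! j \<in> diagram p" "d ! l \<in> diagram p"
          using d jl by (auto simp: linexts_def dest: nth_mem)
        have "d ! j \<noteq> d ! l"
          using linexts_distinct[OF d(1)] jl nth_eq_iff_index_eq[of d j l] by simp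
        then consider "fst (d ! j) < fst (d ! l)" "below (d ! j) (d ! l)"
          | "fst (d ! l) < fst (d ! j)" "below (d ! l) (d ! j)"
          using eq by (cases "fst (d ! j) < fst (d ! l)") (auto simp: below_def content_def prod_eq_iff)
        then show False
          using SSYT_mono(2)[OF p T] D True by cases (metis less_irrefl)+
      qed
      ultimately show ?thesis using True by simp
    next
      case False
      then show ?thesis using sorted_nth_mono[OF d(2), of j l] jl by auto
    qed
    then show ?thesis by (simp add: sorted_wrt_iff_nth_less)
  qed
  then show "sorted_wrt ?R c" "sorted_wrt ?R c'" using c c' by blast+
  show "set c = set c'" using c c' by (simp add: linexts_def)
qed auto

text \<open>Going down a column raises the content, so the list has a rise between the two cells,
  and there the entries grow strictly.\<close>

lemma linext_SSYT:
  assumes p: "is_partition p" and c: "c \<in> linexts (diagram p)"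
    and T: "T \<in> extensional (diagram p)" "\<And>x. x \<in> diagram p \<Longrightarrow> 1 \<le> T x"
      "sorted (map T c)" "rises (map content c) \<subseteq> rises (map T c)"
  shows "T \<in> SSYT p"
proof -
  have *: "T x \<le> T y \<and> (content x < content y \<longrightarrow> T x < T y)"
    if y: "y \<in> diagram p" and xy: "below x y" "x \<noteq> y" for x y
  proof -
    have "x \<in> diagram p" using diagram_below[OF p y xy(1)] .
    then obtain j l where jl: "j < length c" "l < length c" "x = c ! j" "y = c ! l"
      using y c unfolding linexts_def by (metis (mono_tags, lifting) in_set_conv_nth mem_Collect_eq)
    then have "j < l" using linexts_index_less[OF c, of j l] xy by auto
    have "T x < T y" if "content x < content y"
    proof -
      obtain q where q: "j \<le> q" "q < l" "q \<in> rises (map content c)"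
        using rise_between[of j l "map content c"] jl \<open>j < l\<close> \<open>content x < content y\<close> by auto
      then have "T (c ! q) < T (c ! Suc q)" using T(4) by (auto simp: rises_def)
      moreover have "T (c ! j) \<le> T (c ! q)" "T (c ! Suc q) \<le> T (c ! l)"
        using sorted_nth_mono[OF T(3), of j q] sorted_nth_mono[OF T(3), of "Suc q" l] q jl by auto
      ultimately show ?thesis using jl by simp
    qed
    moreover have "T x \<le> T y"
      using sorted_nth_mono[OF T(3), of j l] jl \<open>j < l\<close> by simp
    ultimately show ?thesis by blast
  qed
  have "T (i, j) \<le> T (i, Suc j)" if "(i, Suc j) \<in> diagram p" for i j
    using *[OF that, of "(i, j)"] by (simp add: below_def)
  moreover have "T (i, j) < T (Suc i, j)" if "(Suc i, j) \<in> diagram p" for i j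
    using *[OF that, of "(i, j)"] by (simp add: below_def content_def)
  ultimately show ?thesis
    using T(1,2) by (auto simp: SSYT_def PiE_def)
qed

text \<open>Filling the cells in the order of \<open>c\<close> with the sorted entries of
  \<open>M\<close> inverts standardization.\<close>

lemma schur_linexts:
  assumes p: "is_partition p"
  shows "schur p M = (if size M = card (diagram p) \<and> 0 \<notin># M
    then int (card {c \<in> linexts (diagram p). rises (map content c) \<subseteq> rises (sorted_list_of_multiset M)})
    else 0)"
proof (cases "size M = card (diagram p) \<and> 0 \<notin># M")
  case False
  have "{T \<in> SSYT p. image_mset T (mset_set (diagram p)) = M} = {}"
  proof (intro equals0I, clarify)
    fix T assume T: "T \<in> SSYT p" "M = image_mset T (mset_set (diagram p))"
    then have "size M = card (diagram p)" by simp
    moreover have "0 \<notin># M" using T by (force simp: SSYT_def PiE_def)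
    ultimately show False using False by blast
  qed
  then show ?thesis using False unfolding schur_def gen_series_def by (simp only: if_False card.empty of_nat_0)
next
  case True
  define D where "D = diagram p"
  define I where "I = sorted_list_of_multiset M"
  have I: "sorted I" "mset I = M" "length I = card D"
    using True by (auto simp: I_def D_def) (metis mset_sorted_list_of_multiset size_mset)
  have wt: "image_mset T (mset_set D) = mset (map T c)" if "c \<in> linexts D" for T :: "nat \<times> nat \<Rightarrow> nat" and c
  proof -
    have "mset_set D = mset c"
      using mset_set_set[OF linexts_distinct[OF that]] that by (simp add: linexts_def)
    then show ?thesis by simp
  qed
  define f where "f c = restrict (\<lambda>x. the (map_of (zip c I) x)) D" for c :: "(nat \<times> nat) list"
  have mf: "map (f c) c = I" if "c \<in> linexts D" for c
  proof (rule nth_equalityI)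
    show "length (map (f c) c) = length I" using I linexts_length[OF that] by simp
    fix j assume "j < length (map (f c) c)"
    then have j: "j < length c" "length c = length I" using I linexts_length[OF that] by auto
    then have "map_of (zip c I) (c ! j) = Some (I ! j)"
      using map_of_zip_nth[of c I j] linexts_distinct[OF that] by simp
    moreover have "c ! j \<in> D" using j that by (auto simp: linexts_def)
    ultimately show "map (f c) c ! j = I ! j" using j by (simp add: f_def)
  qed
  have feq: "f c = T" if "c \<in> linexts D" "T \<in> extensional D" "map T c = I" for c T
  proof (rule extensionalityI)
    show "f c \<in> extensional D" by (simp add: f_def)
    show "f c x = T x" if "x \<in> D" for x
      using mf[OF \<open>c \<in> linexts D\<close>] \<open>map T c = I\<close> \<open>c \<in> linexts D\<close> that by (auto simp: linexts_def)
  qed (use that in simp)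
  let ?A = "{c \<in> linexts D. rises (map content c) \<subseteq> rises I}"
  let ?B = "{T \<in> SSYT p. image_mset T (mset_set D) = M}"
  have "bij_betw f ?A ?B"
  proof (rule bij_betw_imageI)
    have fS: "f c \<in> SSYT p" if "c \<in> ?A" for c
    proof (rule linext_SSYT[OF p])
      have c: "c \<in> linexts D" "rises (map content c) \<subseteq> rises I" using that by auto
      show "c \<in> linexts (diagram p)" using c by (simp add: D_def)
      show "f c \<in> extensional (diagram p)" by (simp add: f_def D_def)
      show "sorted (map (f c) c)" "rises (map content c) \<subseteq> rises (map (f c) c)"
        using c I by (simp_all only: mf)
      show "1 \<le> f c x" if "x \<in> diagram p" for x
      proof -
        have "x \<in> set c" using c that by (simp add: linexts_def D_def)
        then have "f c x \<in> set I" using mf[OF c(1)] by (metis list.set_map imageI)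
        then have "f c x \<in># M" using I(2) by (metis set_mset_mset)
        then show ?thesis using True by (metis One_nat_def Suc_leI gr0I)
      qed
    qed
    show "inj_on f ?A"
    proof (rule inj_onI)
      fix c c' assume cc: "c \<in> ?A" "c' \<in> ?A" "f c = f c'"
      then have "map (f c) c = I" "map (f c) c' = I" using mf[of c] mf[of c'] by auto
      then show "c = c'"
        using cc I fS[of c] by (intro SSYT_linext_unique[OF p, of "f c"]) (auto simp: D_def)
    qed
    show "f ` ?A = ?B"
    proof (intro set_eqI iffI)
      fix T assume "T \<in> f ` ?A"
      then obtain c where c: "c \<in> ?A" "T = f c" by blast
      then show "T \<in> ?B" using fS[of c] wt[of c T] mf[of c] I by auto
    next
      fix T assume T: "T \<in> ?B"
      then obtain c where c: "c \<in> linexts D" "sorted (map T c)" "rises (map content c) \<subseteq> rises (map T c)"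
        using SSYT_linext_exists[OF p, of T] by (auto simp: D_def)
      have "mset (map T c) = M" using wt[OF c(1), of T] T by simp
      then have mT: "map T c = I"
        using c(2) by (metis I_def sorted_list_of_multiset_mset sorted_sort_id)
      moreover have "T \<in> extensional D" using T by (auto simp: SSYT_def PiE_def D_def)
      ultimately have "f c = T" using feq c by blast
      then show "T \<in> f ` ?A" using c mT by (metis (mono_tags, lifting) image_eqI mem_Collect_eq)
    qed
  qed
  then have "card ?A = card ?B" by (rule bij_betw_same_card)
  then show ?thesis using True by (simp add: schur_def gen_series_def D_def I_def)
qed

text \<open>The counts of sets contained in \<open>D\<close>, known for all \<open>D\<close>,
  determine the counts of sets equal to \<open>D\<close> by induction on \<open>D\<close>. It is
  applied to the ascent sets of words and of standard tableaux.\<close>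

lemma subset_counts_attained:
  fixes F :: "'a \<Rightarrow> 'c set" and G :: "'b \<Rightarrow> 'c set"
  assumes fin: "finite A" "finite B"
    and eq: "\<And>D. finite D \<Longrightarrow> D \<subseteq> U \<Longrightarrow> card {a \<in> A. F a \<subseteq> D} = card {b \<in> B. G b \<subseteq> D}"
    and a: "a \<in> A" "finite (F a)" "F a \<subseteq> U"
  shows "\<exists>b\<in>B. G b = F a"
proof -
  have decomp: "card {x \<in> X. H x \<subseteq> D} = card {x \<in> X. H x = D} + (\<Sum>E\<in>Pow D - {D}. card {x \<in> X. H x = E})"
    if "finite X" "finite D" for X :: "'d set" and H :: "'d \<Rightarrow> 'c set" and D
  proof -
    have "{x \<in> X. H x \<subseteq> D} = (\<Union>E\<in>Pow D. {x \<in> X. H x = E})" by auto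
    then have "card {x \<in> X. H x \<subseteq> D} = (\<Sum>E\<in>Pow D. card {x \<in> X. H x = E})"
      using that by (simp add: card_UN_disjoint disjoint_iff)
    also have "\<dots> = card {x \<in> X. H x = D} + (\<Sum>E\<in>Pow D - {D}. card {x \<in> X. H x = E})"
      using that by (intro sum.remove) auto
    finally show ?thesis .
  qed
  have "card {a \<in> A. F a = D} = card {b \<in> B. G b = D}" if "finite D" "D \<subseteq> U" for D
    using that
  proof (induction D rule: finite_psubset_induct)
    case (psubset D)
    have "(\<Sum>E\<in>Pow D - {D}. card {a \<in> A. F a = E}) = (\<Sum>E\<in>Pow D - {D}. card {b \<in> B. G b = E})"
      using psubset by (intro sum.cong refl) auto
    then show ?case
      using decomp[OF fin(1) psubset.hyps, of F] decomp[OF fin(2) psubset.hyps, of G]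
        eq[OF psubset.hyps psubset.prems] by simp
  qed
  then have "card {x \<in> A. F x = F a} = card {b \<in> B. G b = F a}" using a by blast
  moreover have "card {x \<in> A. F x = F a} \<noteq> 0" using a fin by auto
  ultimately have "{b \<in> B. G b = F a} \<noteq> {}" by (metis card.empty)
  then show ?thesis by blast
qed

lemma monomial_with_rises:
  assumes "D \<subseteq> {j. Suc j < N}"
  obtains M :: "nat multiset" where "size M = N" "0 \<notin># M" "rises (sorted_list_of_multiset M) = D"
proof -
  \<comment> \<open>Each entry exceeds its predecessor exactly if the position of the predecessor is
    in \<open>D\<close>.\<close>
  define I where "I = map (\<lambda>j. Suc (card (D \<inter> {..<j}))) [0..<N]"
  have "sorted I"
    by (auto simp: I_def sorted_iff_nth_mono intro!: card_mono)
  have "I ! j < I ! Suc j \<longleftrightarrow> j \<in> D" if "Suc j < N" for j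
  proof -
    have "D \<inter> {..<Suc j} = (if j \<in> D then insert j (D \<inter> {..<j}) else D \<inter> {..<j})"
      by (auto simp: less_Suc_eq)
    then show ?thesis using that by (simp add: I_def)
  qed
  then have "rises I = D" using assms by (auto simp: rises_def I_def)
  moreover have "sorted_list_of_multiset (mset I) = I"
    using \<open>sorted I\<close> by (simp add: sorted_list_of_multiset_mset sorted_sort_id)
  moreover have "size (mset I) = N" "0 \<notin># mset I"
    by (auto simp: I_def)
  ultimately show ?thesis using that by metis
qed

section \<open>Symmetry of Schur functions\<close>

text \<open>A tableau is encoded by the growing shapes that its entries up to \<open>b\<close> form;
  these are their row lengths.\<close>

definition row_count :: "nat list \<Rightarrow> (nat \<times> nat \<Rightarrow> nat) \<Rightarrow> nat \<Rightarrow> nat \<Rightarrow> nat" where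
  "row_count p T b r = card {c. (r, c) \<in> diagram p \<and> T (r, c) \<le> b}"

lemma down_closed_nat_set:
  fixes A :: "nat set"
  assumes "finite A" "\<And>c d. d \<in> A \<Longrightarrow> c \<le> d \<Longrightarrow> c \<in> A"
  shows "A = {..<card A}"
proof (cases "A = {}")
  case False
  have "c \<in> A" if "c \<le> Max A" for c
    using assms(2)[OF Max_in[OF assms(1) False] that] .
  then have "A = {..Max A}"
    using Max_ge[OF assms(1)] by auto
  then have "card A = Suc (Max A)" by (metis card_atMost)
  with \<open>A = {..Max A}\<close> show ?thesis by (simp add: lessThan_Suc_atMost)
qed simp

lemma finite_row [simp]: "finite {c. (r, c) \<in> diagram p \<and> P c}"
  by (rule finite_subset[of _ "{..<p ! r}"]) (auto simp: diagram_def)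

lemma row_count_less:
  assumes p: "is_partition p" and T: "T \<in> SSYT p"
  shows "c < row_count p T b r \<longleftrightarrow> (r, c) \<in> diagram p \<and> T (r, c) \<le> b"
proof -
  let ?A = "{c. (r, c) \<in> diagram p \<and> T (r, c) \<le> b}"
  have "?A = {..<card ?A}"
  proof (rule down_closed_nat_set)
    fix c d assume d: "d \<in> ?A" "c \<le> d"
    have b: "below (r, c) (r, d)" and D: "(r, d) \<in> diagram p" using d by (simp_all add: below_def)
    have "(r, c) \<in> diagram p" by (rule diagram_below[OF p D b])
    moreover have "T (r, c) \<le> T (r, d)" by (rule SSYT_mono(1)[OF p T D b])
    ultimately show "c \<in> ?A" using d by simp
  qed simp
  from arg_cong[OF this, of "\<lambda>X. c \<in> X"] show ?thesis by (simp add: row_count_def)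
qed

lemma row_count_mono: "b \<le> b' \<Longrightarrow> row_count p T b r \<le> row_count p T b' r"
  unfolding row_count_def by (intro card_mono) auto

lemma row_count_outside: "length p \<le> r \<Longrightarrow> row_count p T b r = 0"
  by (simp add: row_count_def diagram_def)

lemma row_count_column:
  assumes p: "is_partition p" and T: "T \<in> SSYT p"
  shows "row_count p T (Suc b) (Suc r) \<le> row_count p T b r"
proof (rule ccontr)
  assume "\<not> ?thesis"
  then have "row_count p T b r < row_count p T (Suc b) (Suc r)" by simp
  then have *: "(Suc r, row_count p T b r) \<in> diagram p" "T (Suc r, row_count p T b r) \<le> Suc b"
    unfolding row_count_less[OF p T] by auto
  have "T (r, row_count p T b r) < T (Suc r, row_count p T b r)"
    using SSYT_mono(2)[OF p T *(1), of "(r, row_count p T b r)"] by (simp add: below_def)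
  moreover have "(r, row_count p T b r) \<in> diagram p"
    by (rule diagram_below[OF p *(1)]) (simp add: below_def)
  ultimately have "row_count p T b r < row_count p T b r"
    using * unfolding row_count_less[OF p T, of "row_count p T b r" b r] by simp
  then show False by simp
qed

text \<open>A chain of shapes yields strict columns as soon as consecutive shapes differ by a
  horizontal strip, which is what \<open>col\<close> says.\<close>

lemma SSYT_by_row_counts:
  assumes p: "is_partition p" and "T \<in> extensional (diagram p)"
    and "\<And>x. x \<in> diagram p \<Longrightarrow> 1 \<le> T x"
    and C: "\<And>r c b. (r, c) \<in> diagram p \<Longrightarrow> T (r, c) \<le> b \<longleftrightarrow> c < C b r"
    and col: "\<And>b r. C (Suc b) (Suc r) \<le> C b r"
  shows "T \<in> SSYT p"
proof -
  have "T (i, j) \<le> T (i, Suc j)" if "(i, Suc j) \<in> diagram p" for i j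
  proof -
    have "(i, j) \<in> diagram p"
      by (rule diagram_below[OF p that]) (simp add: below_def)
    then show ?thesis using C[of i j "T (i, Suc j)"] C[OF that, of "T (i, Suc j)"] by simp
  qed
  moreover have "T (i, j) < T (Suc i, j)" if D: "(Suc i, j) \<in> diagram p" for i j
  proof -
    have ij: "(i, j) \<in> diagram p"
      by (rule diagram_below[OF p D]) (simp add: below_def)
    obtain b where b: "T (Suc i, j) = Suc b"
      using assms(3)[OF D] by (cases "T (Suc i, j)") auto
    have "j < C b i"
      using C[OF D, of "Suc b"] b col[of b i] by simp
    then show ?thesis using C[OF ij, of b] b by simp
  qed
  ultimately show ?thesis using assms(2,3) by (auto simp: SSYT_def PiE_def)
qed

text \<open>
  The entries at most \<open>i\<close> of a row end between \<open>lo\<close> and \<open>hi\<close> if the entries at most \<open>i - 1\<close> and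
  at most \<open>i + 1\<close> are fixed. The Bender-Knuth involution reflects this end in the interval.
\<close>

context
  fixes p :: "nat list" and i :: nat
  assumes p: "is_partition p" and i: "1 \<le> i"
begin

private definition lo :: "(nat \<times> nat \<Rightarrow> nat) \<Rightarrow> nat \<Rightarrow> nat" where
  "lo T r = max (row_count p T (i - 1) r) (row_count p T (Suc i) (Suc r))"

private definition hi :: "(nat \<times> nat \<Rightarrow> nat) \<Rightarrow> nat \<Rightarrow> nat" where
  "hi T r = (case r of 0 \<Rightarrow> row_count p T (Suc i) 0
     | Suc r' \<Rightarrow> min (row_count p T (Suc i) r) (row_count p T (i - 1) r'))"

private definition reflected :: "(nat \<times> nat \<Rightarrow> nat) \<Rightarrow> nat \<Rightarrow> nat" where
  "reflected T r = lo T r + hi T r - row_count p T i r"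

private definition bk_count :: "(nat \<times> nat \<Rightarrow> nat) \<Rightarrow> nat \<Rightarrow> nat \<Rightarrow> nat" where
  "bk_count T b r = (if b = i then reflected T r else row_count p T b r)"

private definition bk :: "(nat \<times> nat \<Rightarrow> nat) \<Rightarrow> nat \<times> nat \<Rightarrow> nat" where
  "bk T = restrict (\<lambda>(r, c).
     if c < row_count p T (i - 1) r \<or> row_count p T (Suc i) r \<le> c then T (r, c)
     else if c < reflected T r then i else Suc i) (diagram p)"

private lemma lo_hi:
  assumes "T \<in> SSYT p"
  shows "lo T r \<le> row_count p T i r" "row_count p T i r \<le> hi T r"
    "row_count p T (i - 1) r \<le> lo T r" "hi T r \<le> row_count p T (Suc i) r"
proof -
  have "row_count p T (Suc (i - 1)) (Suc r') \<le> row_count p T (i - 1) r'" for r'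
    by (rule row_count_column[OF p assms])
  then have "row_count p T i (Suc r') \<le> row_count p T (i - 1) r'" for r' using i by simp
  then show "row_count p T i r \<le> hi T r"
    by (auto simp: hi_def row_count_mono split: nat.splits)
qed (use row_count_column[OF p assms, of i r] in
    \<open>auto simp: lo_def hi_def row_count_mono split: nat.splits\<close>)

private lemma lo_hi_reflected:
  assumes "T \<in> SSYT p"
  shows "lo T r \<le> reflected T r" "reflected T r \<le> hi T r"
    "reflected T r + row_count p T i r = lo T r + hi T r"
  using lo_hi(1,2)[OF assms, of r] by (simp_all add: reflected_def)

private lemma bk_le:
  assumes T: "T \<in> SSYT p" and D: "(r, c) \<in> diagram p"
  shows "bk T (r, c) \<le> b \<longleftrightarrow> c < bk_count T b r"
proof -
  have rc: "c < row_count p T b r \<longleftrightarrow> T (r, c) \<le> b" for b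
    using row_count_less[OF p T, of c b r] D by simp
  note lh = lo_hi(3,4)[OF T, of r] lo_hi_reflected(1,2)[OF T, of r]
  consider "c < row_count p T (i - 1) r" | "row_count p T (Suc i) r \<le> c"
    | "row_count p T (i - 1) r \<le> c" "c < row_count p T (Suc i) r" by linarith
  then show ?thesis
  proof cases
    case 1
    then have "T (r, c) \<le> i" "c < reflected T r" using rc[of "i - 1"] lh by auto
    with 1 show ?thesis using D rc[of b] by (simp add: bk_def bk_count_def)
  next
    case 2
    then have "\<not> T (r, c) \<le> i" "\<not> c < reflected T r" using rc[of "Suc i"] lh by auto
    with 2 show ?thesis using D rc[of b] by (simp add: bk_def bk_count_def)
  next
    case 3
    then have "i \<le> T (r, c)" "T (r, c) \<le> Suc i" using rc[of "i - 1"] rc[of "Suc i"] by auto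
    with 3 show ?thesis using D rc[of b] by (auto simp: bk_def bk_count_def)
  qed
qed

private lemma bk_count_column:
  assumes T: "T \<in> SSYT p"
  shows "bk_count T (Suc b) (Suc r) \<le> bk_count T b r"
proof -
  have "hi T (Suc r) \<le> row_count p T (i - 1) r" "row_count p T (Suc i) (Suc r) \<le> lo T r"
    by (simp_all add: hi_def lo_def)
  then show ?thesis
    using row_count_column[OF p T, of b r] lo_hi_reflected(1)[OF T, of r] lo_hi_reflected(2)[OF T, of "Suc r"]
    by (auto simp: bk_count_def)
qed

private lemma bk_SSYT:
  assumes T: "T \<in> SSYT p"
  shows "bk T \<in> SSYT p"
proof (rule SSYT_by_row_counts[OF p, of _ "bk_count T"])
  show "bk T \<in> extensional (diagram p)" by (simp add: bk_def)
  show "1 \<le> bk T x" if "x \<in> diagram p" for x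
  proof -
    have "1 \<le> T x" using T that by (auto simp: SSYT_def PiE_def)
    then show ?thesis using that i by (auto simp: bk_def split: prod.splits)
  qed
qed (use bk_le[OF T] bk_count_column[OF T] in auto)

private lemma bk_row_count:
  assumes T: "T \<in> SSYT p"
  shows "row_count p (bk T) b r = bk_count T b r"
proof -
  have "(r, c) \<in> diagram p" if "c < bk_count T b r" for c
  proof -
    have "c < row_count p T b r \<or> c < row_count p T (Suc i) r"
      using that lo_hi(4)[OF T, of r] lo_hi_reflected(2)[OF T, of r] by (auto simp: bk_count_def split: if_splits)
    then show ?thesis using row_count_less[OF p T] by blast
  qed
  then have "{c. (r, c) \<in> diagram p \<and> bk T (r, c) \<le> b} = {..<bk_count T b r}"
    using bk_le[OF T] by auto
  then show ?thesis by (simp add: row_count_def)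
qed

private lemma bk_bk:
  assumes T: "T \<in> SSYT p"
  shows "bk (bk T) = T"
proof (rule extensionalityI)
  show "bk (bk T) \<in> extensional (diagram p)" by (simp add: bk_def)
  show "T \<in> extensional (diagram p)" using T by (simp add: SSYT_def PiE_def)
  fix x assume "x \<in> diagram p"
  then obtain r c where x: "x = (r, c)" "(r, c) \<in> diagram p" by (cases x) auto
  have count: "row_count p (bk T) b r = row_count p T b r" if "b \<noteq> i" for b r
    using bk_row_count[OF T] that by (simp add: bk_count_def)
  have "lo (bk T) r = lo T r" "hi (bk T) r = hi T r"
    using i by (simp_all add: lo_def hi_def count split: nat.splits)
  then have "reflected (bk T) r = row_count p T i r"
    using lo_hi_reflected(3)[OF T, of r] bk_row_count[OF T, of i r]
    by (simp add: reflected_def[of "bk T"] bk_count_def)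
  moreover have "c < row_count p T b r \<longleftrightarrow> T (r, c) \<le> b" for b
    using row_count_less[OF p T, of c b r] x by simp
  ultimately show "bk (bk T) x = T x"
    using x i count[of "i - 1"] count[of "Suc i"]
    by (auto simp: bk_def not_le not_less)
qed

text \<open>\<open>lo\<close> of a row and \<open>hi\<close> of the next row are the maximum and the
  minimum of the same two counts, so their sum is the sum of these counts.\<close>

private lemma bk_row_sums:
  assumes T: "T \<in> SSYT p"
  shows "(\<Sum>r<length p. reflected T r) + (\<Sum>r<length p. row_count p T i r) =
    (\<Sum>r<length p. row_count p T (i - 1) r) + (\<Sum>r<length p. row_count p T (Suc i) r)"
proof -
  \<comment> \<open>Row \<open>n\<close> enters with its \<open>hi\<close> only, because its
    \<open>lo\<close> pairs with the row after it. At \<open>n = length p\<close> the extra terms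
    vanish.\<close>
  have "(\<Sum>r<n. lo T r) + (\<Sum>r<n. hi T r) + hi T n =
      (\<Sum>r<n. row_count p T (i - 1) r) + (\<Sum>r<n. row_count p T (Suc i) r) + row_count p T (Suc i) n" for n
  proof (induction n)
    case (Suc n)
    have "lo T n + hi T (Suc n) = row_count p T (i - 1) n + row_count p T (Suc i) (Suc n)"
      by (simp add: lo_def hi_def max_def min_def)
    with Suc show ?case by simp
  qed (simp add: hi_def)
  from this[of "length p"] have "(\<Sum>r<length p. lo T r) + (\<Sum>r<length p. hi T r) =
      (\<Sum>r<length p. row_count p T (i - 1) r) + (\<Sum>r<length p. row_count p T (Suc i) r)"
    using lo_hi(4)[OF T, of "length p"] by (simp add: row_count_outside)
  moreover have "(\<Sum>r<length p. reflected T r) + (\<Sum>r<length p. row_count p T i r) =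
      (\<Sum>r<length p. lo T r) + (\<Sum>r<length p. hi T r)"
    by (simp add: sum.distrib[symmetric] lo_hi_reflected(3)[OF T])
  ultimately show ?thesis by simp
qed

private definition wt :: "(nat \<times> nat \<Rightarrow> nat) \<Rightarrow> nat multiset" where
  "wt T = image_mset T (mset_set (diagram p))"

private lemma wt_sums:
  assumes T: "T \<in> SSYT p"
  shows "(\<Sum>r<length p. row_count p T b r) + count (wt T) (Suc b) = (\<Sum>r<length p. row_count p T (Suc b) r)"
    and "count (wt T) 0 = 0"
proof -
  have cnt: "count (wt T) x = card {z \<in> diagram p. T z = x}" for x
    by (simp add: wt_def count_image_mset' Collect_conj_eq eq_commute[of x])
  have sums: "(\<Sum>r<length p. row_count p T b r) = card {z \<in> diagram p. T z \<le> b}" for b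
  proof -
    have "{z \<in> diagram p. T z \<le> b} = (SIGMA r:{..<length p}. {c. (r, c) \<in> diagram p \<and> T (r, c) \<le> b})"
      by (auto simp: diagram_def)
    then show ?thesis by (simp add: row_count_def)
  qed
  have "{z \<in> diagram p. T z \<le> Suc b} = {z \<in> diagram p. T z \<le> b} \<union> {z \<in> diagram p. T z = Suc b}"
    by auto
  then have "card {z \<in> diagram p. T z \<le> Suc b} = card {z \<in> diagram p. T z \<le> b} + card {z \<in> diagram p. T z = Suc b}"
    by (simp only:) (rule card_Un_disjoint; auto)
  then show "(\<Sum>r<length p. row_count p T b r) + count (wt T) (Suc b) = (\<Sum>r<length p. row_count p T (Suc b) r)"
    by (simp add: cnt sums)
  have "{z \<in> diagram p. T z = 0} = {}" using T by (force simp: SSYT_def PiE_def)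
  then show "count (wt T) 0 = 0" by (simp add: cnt)
qed

text \<open>The multiplicity of an entry is a difference of two sums of row counts. Only the sum for
  \<open>i\<close> changes; it is reflected between its two neighbours, which exchanges the
  differences belonging to \<open>i\<close> and \<open>Suc i\<close>.\<close>

private lemma wt_bk:
  assumes T: "T \<in> SSYT p"
  shows "wt (bk T) = image_mset (s i) (wt T)"
proof (rule multiset_eqI)
  fix x
  note T' = bk_SSYT[OF T]
  define S where "S b = (\<Sum>r<length p. row_count p T b r)" for b
  define S' where "S' b = (\<Sum>r<length p. row_count p (bk T) b r)" for b
  have S'_eq: "S' b = S b" if "b \<noteq> i" for b
    using that by (simp add: S'_def S_def bk_row_count[OF T] bk_count_def)
  have S'_i: "S' i + S i = S (i - 1) + S (Suc i)"
    using bk_row_sums[OF T] by (simp add: S'_def S_def bk_row_count[OF T] bk_count_def)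
  have c: "S b + count (wt T) (Suc b) = S (Suc b)" "S' b + count (wt (bk T)) (Suc b) = S' (Suc b)" for b
    using wt_sums(1)[OF T] wt_sums(1)[OF T'] by (simp_all add: S_def S'_def)
  have i1: "S (i - 1) + count (wt T) i = S i" "S' (i - 1) + count (wt (bk T)) i = S' i"
    using c[of "i - 1"] i by simp_all
  have "count (image_mset (s i) M) x = count M (s i x)" for M
  proof (induction M)
    case (add m M)
    have "s i m = x \<longleftrightarrow> m = s i x" by (metis s_simps(3))
    with add show ?case by simp
  qed simp
  then have "count (image_mset (s i) (wt T)) x = count (wt T) (s i x)" .
  also have "\<dots> = count (wt (bk T)) x"
  proof -
    consider "x = 0" | "x = i" | "x = Suc i" | b where "x = Suc b" "x \<noteq> i" "b \<noteq> i"
      by (cases x) auto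
    then show ?thesis
    proof cases
      case 1
      then show ?thesis using i wt_sums(2)[OF T] wt_sums(2)[OF T'] by (simp add: s_other)
    next
      case 2
      then show ?thesis using i1 c[of i] S'_eq[of "i - 1"] S'_i i by simp
    next
      case 3
      then show ?thesis using i1 c[of i] S'_eq[of "Suc i"] S'_i i by simp
    next
      case 4
      then show ?thesis using c[of b] S'_eq[of b] S'_eq[of "Suc b"] by (simp add: s_other)
    qed
  qed
  finally show "count (wt (bk T)) x = count (image_mset (s i) (wt T)) x" by simp
qed

lemma schur_symmetric_adjacent: "schur p (image_mset (s i) M) = schur p M"
proof -
  have "bij_betw bk {T \<in> SSYT p. wt T = M} {T \<in> SSYT p. wt T = image_mset (s i) M}"
  proof (rule bij_betw_byWitness[where f' = bk])
    show "bk ` {T \<in> SSYT p. wt T = image_mset (s i) M} \<subseteq> {T \<in> SSYT p. wt T = M}"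
      using bk_SSYT wt_bk by (auto simp: multiset.map_comp comp_def)
  qed (use bk_SSYT wt_bk bk_bk in auto)
  then show ?thesis
    unfolding schur_def gen_series_def wt_def by (metis (no_types, lifting) bij_betw_same_card)
qed

end

text \<open>Conjugating adjacent transpositions gives all transpositions, and these generate all
  permutations.\<close>

lemma schur_symmetric:
  assumes p: "is_partition p" and \<pi>: "\<pi> permutes {1..n}"
  shows "schur p (image_mset \<pi> M) = schur p M"
proof -
  have up: "schur p (image_mset (transpose a (Suc (a + d))) M) = schur p M" if "1 \<le> a" for a d M
  proof (induction d arbitrary: M)
    case 0
    show ?case using schur_symmetric_adjacent[OF p that] by simp
  next
    case (Suc d)
    let ?b = "Suc (a + d)"
    have "transpose a (Suc ?b) = s ?b \<circ> transpose a ?b \<circ> s ?b"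
      by (auto simp: fun_eq_iff transpose_def)
    then have "image_mset (transpose a (Suc ?b)) M =
        image_mset (s ?b) (image_mset (transpose a ?b) (image_mset (s ?b) M))"
      by (simp add: multiset.map_comp comp_assoc)
    then show ?case
      using Suc schur_symmetric_adjacent[OF p, of ?b] by simp
  qed
  have tr: "schur p (image_mset (transpose a b) M) = schur p M" if "1 \<le> a" "1 \<le> b" for a b M
  proof -
    have *: "schur p (image_mset (transpose a b) M) = schur p M" if "1 \<le> a" "a < b" for a b M
      using up[OF that(1), of "b - a - 1" M] that(2) by simp
    consider "a = b" | "a < b" | "b < a" by linarith
    then show ?thesis
      using *[of a b] *[of b a] that by cases (auto simp: transpose_commute[of b a])
  qed
  from finite_atLeastAtMost \<pi> show ?thesis
  proof (induction arbitrary: M rule: permutes_rev_induct)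
    case id
    show ?case by (simp add: id_def)
  next
    case (swap a b q)
    have eq: "image_mset (q \<circ> transpose a b) M = image_mset q (image_mset (transpose a b) M)"
      by (simp add: multiset.map_comp)
    have "1 \<le> a" "1 \<le> b" using swap by auto
    then show ?case unfolding eq using trans[OF swap.IH tr] by blast
  qed
qed

section \<open>Descending paths as growing order ideals\<close>

definition order_ideal :: "(nat \<times> nat) set \<Rightarrow> bool" where
  "order_ideal A \<longleftrightarrow> (\<forall>y\<in>A. \<forall>x. below x y \<longrightarrow> x \<in> A)"

definition staircase :: "nat \<Rightarrow> (nat \<times> nat) set" where
  "staircase k = {(i, j). i + j < k}"

text \<open>
  In the one-line notation of \<open>1\<^sub>m \<times> g\<^sub>k\<close> the row \<open>i\<close> of an order ideal \<open>A\<close> stands for the left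
  endpoint \<open>m + k - i\<close> of an arc and the column \<open>j\<close> for the right endpoint \<open>m + k + 1 + j\<close>. Adding
  a cell to \<open>A\<close> exchanges the endpoints of its row and its column, which are adjacent then. An arc
  whose endpoints have been exchanged with each other is deleted.
\<close>

definition row_pos :: "nat \<Rightarrow> nat \<Rightarrow> (nat \<times> nat) set \<Rightarrow> nat \<Rightarrow> nat" where
  "row_pos m k A i = m + (k - i) + card {j. (i, j) \<in> A}"

definition col_pos :: "nat \<Rightarrow> nat \<Rightarrow> (nat \<times> nat) set \<Rightarrow> nat \<Rightarrow> nat" where
  "col_pos m k A j = m + k + 1 + j - card {i. (i, j) \<in> A}"

text \<open>Row \<open>i\<close> and column \<open>k - 1 - i\<close> belong to one arc. Their
  positions have crossed once the cell \<open>(i, k - 1 - i)\<close> is in \<open>A\<close>; from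
  then on the maximum and the minimum return the argument itself, so both points are fixed.\<close>

definition ideal_involution ::
    "nat \<Rightarrow> nat \<Rightarrow> (nat \<Rightarrow> nat) \<Rightarrow> (nat \<times> nat) set \<Rightarrow> (nat \<Rightarrow> nat) \<Rightarrow> bool" where
  "ideal_involution m k w A y \<longleftrightarrow>
    (\<forall>i<k. y (row_pos m k A i) = max (row_pos m k A i) (col_pos m k A (k - 1 - i))) \<and>
    (\<forall>j<k. y (col_pos m k A j) = min (col_pos m k A j) (row_pos m k A (k - 1 - j))) \<and>
    (\<forall>x. x \<le> m \<or> m + 2 * k < x \<longrightarrow> y x = w x)"

text \<open>On the staircase this is \<open>m + k\<close> minus \<open>content\<close>, so letters
  and contents are ordered oppositely.\<close>

definition cell_letter :: "nat \<Rightarrow> nat \<Rightarrow> nat \<times> nat \<Rightarrow> nat" where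
  "cell_letter m k x = m + (k - fst x) + snd x"

lemma finite_staircase [simp]: "finite (staircase k)"
  by (rule finite_subset[of _ "{..<k} \<times> {..<k}"]) (auto simp: staircase_def)

lemma staircase_mono: "l \<le> k \<Longrightarrow> staircase l \<subseteq> staircase k"
  by (auto simp: staircase_def)

lemma order_ideal_staircase: "order_ideal (staircase k)"
  by (auto simp: order_ideal_def staircase_def below_def)

lemma card_staircase_row: "card {j. (i, j) \<in> staircase k} = k - i"
proof -
  have "{j. (i, j) \<in> staircase k} = {..<k - i}" by (auto simp: staircase_def)
  then show ?thesis by simp
qed

lemma card_staircase_col: "card {i. (i, j) \<in> staircase k} = k - j"
proof -
  have "{i. (i, j) \<in> staircase k} = {..<k - j}" by (auto simp: staircase_def)
  then show ?thesis by simp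
qed

section \<open>Positions determined by an order ideal\<close>

locale staircase_ideal =
  fixes k :: nat and A :: "(nat \<times> nat) set"
  assumes ideal: "order_ideal A" and sub: "A \<subseteq> staircase k"
begin

lemma idealD: "y \<in> A \<Longrightarrow> below x y \<Longrightarrow> x \<in> A"
  using ideal unfolding order_ideal_def by blast

lemma row_iff: "j < card {j. (i, j) \<in> A} \<longleftrightarrow> (i, j) \<in> A"
proof -
  have "{j. (i, j) \<in> A} = {..<card {j. (i, j) \<in> A}}"
  proof (rule down_closed_nat_set)
    show "finite {j. (i, j) \<in> A}"
      by (rule finite_subset[of _ "{..<k}"]) (use sub in \<open>auto simp: staircase_def\<close>)
    show "c \<in> {j. (i, j) \<in> A}" if "d \<in> {j. (i, j) \<in> A}" "c \<le> d" for c d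
      using that idealD[of "(i, d)" "(i, c)"] by (simp add: below_def)
  qed
  from arg_cong[OF this, of "\<lambda>X. j \<in> X"] show ?thesis by simp
qed

lemma col_iff: "i < card {i. (i, j) \<in> A} \<longleftrightarrow> (i, j) \<in> A"
proof -
  have "{i. (i, j) \<in> A} = {..<card {i. (i, j) \<in> A}}"
  proof (rule down_closed_nat_set)
    show "finite {i. (i, j) \<in> A}"
      by (rule finite_subset[of _ "{..<k}"]) (use sub in \<open>auto simp: staircase_def\<close>)
    show "c \<in> {i. (i, j) \<in> A}" if "d \<in> {i. (i, j) \<in> A}" "c \<le> d" for c d
      using that idealD[of "(d, j)" "(c, j)"] by (simp add: below_def)
  qed
  from arg_cong[OF this, of "\<lambda>X. i \<in> X"] show ?thesis by simp
qed

lemma row_le: "card {j. (i, j) \<in> A} \<le> k - i"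
proof (rule ccontr)
  assume "\<not> ?thesis"
  then have "(i, k - i) \<in> A" by (simp only: not_le row_iff)
  then show False using sub by (auto simp: staircase_def)
qed

lemma col_le: "card {i. (i, j) \<in> A} \<le> k - j"
proof (rule ccontr)
  assume "\<not> ?thesis"
  then have "(k - j, j) \<in> A" by (simp only: not_le col_iff)
  then show False using sub by (auto simp: staircase_def)
qed

lemma row_antimono: "i \<le> i' \<Longrightarrow> card {j. (i', j) \<in> A} \<le> card {j. (i, j) \<in> A}"
proof (rule ccontr)
  assume "i \<le> i'" and "\<not> ?thesis"
  then have "(i', card {j. (i, j) \<in> A}) \<in> A" by (simp only: not_le row_iff)
  then have "(i, card {j. (i, j) \<in> A}) \<in> A"
    by (rule idealD) (simp add: below_def \<open>i \<le> i'\<close>)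
  then show False using row_iff[of "card {j. (i, j) \<in> A}" i] by simp
qed

lemma col_antimono: "j \<le> j' \<Longrightarrow> card {i. (i, j') \<in> A} \<le> card {i. (i, j) \<in> A}"
proof (rule ccontr)
  assume "j \<le> j'" and "\<not> ?thesis"
  then have "(card {i. (i, j) \<in> A}, j') \<in> A" by (simp only: not_le col_iff)
  then have "(card {i. (i, j) \<in> A}, j) \<in> A"
    by (rule idealD) (simp add: below_def \<open>j \<le> j'\<close>)
  then show False using col_iff[of "card {i. (i, j) \<in> A}" j] by simp
qed

lemma row_pos_less: "i < i' \<Longrightarrow> i' < k \<Longrightarrow> row_pos m k A i' < row_pos m k A i"
  using row_antimono[of i i'] by (simp add: row_pos_def)

lemma col_pos_less: "j < j' \<Longrightarrow> j' < k \<Longrightarrow> col_pos m k A j < col_pos m k A j'"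
  using col_antimono[of j j'] col_le[of j] by (simp add: col_pos_def)

lemma row_pos_bounds: "i < k \<Longrightarrow> m < row_pos m k A i \<and> row_pos m k A i \<le> m + 2 * k"
  using row_le[of i] unfolding row_pos_def by linarith

lemma col_pos_bounds: "j < k \<Longrightarrow> m < col_pos m k A j \<and> col_pos m k A j \<le> m + 2 * k"
  using col_le[of j] unfolding col_pos_def by linarith

text \<open>The distance of the two positions is governed by the row length plus the column length.
  These are at most \<open>j\<close> and \<open>i\<close> if \<open>(i, j)\<close> is not in
  \<open>A\<close>, and both are larger otherwise.\<close>

lemma adjacent_iff:
  assumes "i < k" "j < k"
  shows "col_pos m k A j = row_pos m k A i + 1 \<longleftrightarrow> card {j. (i, j) \<in> A} = j \<and> card {i. (i, j) \<in> A} = i"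
  using assms row_iff[of j i] col_iff[of i j] col_le[of j] by (auto simp: row_pos_def col_pos_def)

lemma row_pos_neq_col_pos:
  assumes "i < k" "j < k"
  shows "row_pos m k A i \<noteq> col_pos m k A j"
  using assms row_iff[of j i] col_iff[of i j] col_le[of j] by (auto simp: row_pos_def col_pos_def)

text \<open>There are \<open>2 * k\<close> distinct positions in an interval with as many
  points.\<close>

lemma pos_cover:
  assumes "m < x" "x \<le> m + 2 * k"
  obtains i where "i < k" "x = row_pos m k A i" | j where "j < k" "x = col_pos m k A j"
proof -
  let ?L = "row_pos m k A ` {..<k}" and ?R = "col_pos m k A ` {..<k}"
  have "inj_on (row_pos m k A) {..<k}"
    by (rule inj_onI) (metis lessThan_iff less_irrefl linorder_neqE_nat row_pos_less)
  moreover have "inj_on (col_pos m k A) {..<k}"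
    by (rule inj_onI) (metis lessThan_iff less_irrefl linorder_neqE_nat col_pos_less)
  moreover have "?L \<inter> ?R = {}" using row_pos_neq_col_pos by auto
  ultimately have "card (?L \<union> ?R) = 2 * k"
    by (simp add: card_Un_disjoint card_image)
  moreover have "?L \<union> ?R \<subseteq> {m + 1..m + 2 * k}"
    using row_pos_bounds[of _ m] col_pos_bounds[of _ m] by (auto simp: Suc_le_eq)
  ultimately have "?L \<union> ?R = {m + 1..m + 2 * k}"
    by (intro card_subset_eq) auto
  then have "x \<in> ?L \<union> ?R" using assms by simp
  then show ?thesis using that by auto
qed

lemma ideal_involution_unique:
  assumes "ideal_involution m k w A y" "ideal_involution m k w A y'"
  shows "y = y'"
proof
  fix x
  show "y x = y' x"
  proof (cases "m < x \<and> x \<le> m + 2 * k")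
    case True
    then have "m < x" "x \<le> m + 2 * k" by auto
    then show ?thesis
      by (cases rule: pos_cover) (use assms in \<open>auto simp: ideal_involution_def\<close>)
  next
    case False
    then have "x \<le> m \<or> m + 2 * k < x" by linarith
    then show ?thesis using assms unfolding ideal_involution_def by metis
  qed
qed

end

locale addable_cell = staircase_ideal +
  fixes a b :: nat
  assumes new: "(a, b) \<notin> A" and cell: "a + b < k" and ideal': "order_ideal (insert (a, b) A)"
begin

sublocale extended: staircase_ideal k "insert (a, b) A"
  by unfold_locales (use ideal' sub cell in \<open>auto simp: staircase_def\<close>)

lemma ab_less: "a < k" "b < k"
  using cell by auto

lemma row_a: "card {j. (a, j) \<in> A} = b"
proof (rule antisym)
  show "card {j. (a, j) \<in> A} \<le> b" using new row_iff[of b a] by simp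
  show "b \<le> card {j. (a, j) \<in> A}"
  proof (rule ccontr)
    assume less: "\<not> ?thesis"
    then have "(a, card {j. (a, j) \<in> A}) \<in> insert (a, b) A"
      by (intro extended.idealD[of "(a, b)" "(a, card {j. (a, j) \<in> A})"]) (simp_all add: below_def)
    then show False using less row_iff[of "card {j. (a, j) \<in> A}" a] by auto
  qed
qed

lemma col_b: "card {i. (i, b) \<in> A} = a"
proof (rule antisym)
  show "card {i. (i, b) \<in> A} \<le> a" using new col_iff[of a b] by simp
  show "a \<le> card {i. (i, b) \<in> A}"
  proof (rule ccontr)
    assume less: "\<not> ?thesis"
    then have "(card {i. (i, b) \<in> A}, b) \<in> insert (a, b) A"
      by (intro extended.idealD[of "(a, b)" "(card {i. (i, b) \<in> A}, b)"]) (simp_all add: below_def)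
    then show False using less col_iff[of "card {i. (i, b) \<in> A}" b] by auto
  qed
qed

abbreviation (input) "letter m \<equiv> cell_letter m k (a, b)"

lemma pos_old: "row_pos m k A a = letter m" "col_pos m k A b = Suc (letter m)"
  using ab_less by (simp_all add: row_pos_def col_pos_def row_a col_b cell_letter_def)

lemma row_pos_new: "row_pos m k (insert (a, b) A) i = (if i = a then Suc (letter m) else row_pos m k A i)"
proof (cases "i = a")
  case True
  have "{j. (a, j) \<in> insert (a, b) A} = insert b {j. (a, j) \<in> A}" by auto
  moreover have "finite {j. (a, j) \<in> A}"
    by (rule finite_subset[of _ "{..<k}"]) (use sub in \<open>auto simp: staircase_def\<close>)
  ultimately have "card {j. (a, j) \<in> insert (a, b) A} = Suc b" using new row_a by simp
  then show ?thesis using True by (simp add: row_pos_def cell_letter_def)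
qed (simp add: row_pos_def)

lemma col_pos_new: "col_pos m k (insert (a, b) A) j = (if j = b then letter m else col_pos m k A j)"
proof (cases "j = b")
  case True
  have "{i. (i, b) \<in> insert (a, b) A} = insert a {i. (i, b) \<in> A}" by auto
  moreover have "finite {i. (i, b) \<in> A}"
    by (rule finite_subset[of _ "{..<k}"]) (use sub in \<open>auto simp: staircase_def\<close>)
  ultimately have "card {i. (i, b) \<in> insert (a, b) A} = Suc a" using new col_b by simp
  then show ?thesis using True ab_less by (simp add: col_pos_def cell_letter_def)
qed (simp add: col_pos_def)

text \<open>The arc of row \<open>a\<close> ends at column \<open>k - 1 - a\<close>, which is never
  to the left of column \<open>b\<close> and agrees with it exactly on the antidiagonal. Only there
  does the step delete an arc.\<close>

lemma letter_descent:
  assumes y: "ideal_involution m k w A y"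
  shows "y (Suc (letter m)) \<le> letter m" "Suc (letter m) \<le> y (letter m)"
    "y (letter m) = Suc (letter m) \<longleftrightarrow> a + b = k - 1"
proof -
  have y1: "y (letter m) = max (letter m) (col_pos m k A (k - 1 - a))"
    using y ab_less unfolding ideal_involution_def by (metis pos_old(1))
  have y2: "y (Suc (letter m)) = min (Suc (letter m)) (row_pos m k A (k - 1 - b))"
    using y ab_less unfolding ideal_involution_def by (metis pos_old(2))
  have "b = k - 1 - a \<or> b < k - 1 - a" using cell by linarith
  then have "col_pos m k A (k - 1 - a) = Suc (letter m) \<and> a + b = k - 1 \<or>
      Suc (letter m) < col_pos m k A (k - 1 - a) \<and> a + b \<noteq> k - 1"
    using col_pos_less[of b "k - 1 - a" m] pos_old(2)[of m] cell by auto
  then show "Suc (letter m) \<le> y (letter m)" "y (letter m) = Suc (letter m) \<longleftrightarrow> a + b = k - 1"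
    unfolding y1 by auto
  have "a = k - 1 - b \<or> a < k - 1 - b" using cell by linarith
  then have "row_pos m k A (k - 1 - b) \<le> letter m"
    using row_pos_less[of a "k - 1 - b" m] pos_old(1)[of m] cell by auto
  then show "y (Suc (letter m)) \<le> letter m" unfolding y2 by simp
qed

text \<open>The new cell exchanges the neighbouring positions of its row and its column, as
  conjugation by \<open>s\<close> does. On the antidiagonal these are the two ends of one arc, which
  disappears.\<close>

lemma ideal_involution_step:
  assumes y: "ideal_involution m k w A y" and inv: "involution y"
    and w: "\<And>x. x \<le> m \<or> m + 2 * k < x \<Longrightarrow> w x \<le> m \<or> m + 2 * k < w x"
  shows "ideal_involution m k w (insert (a, b) A) (inv_act y (letter m))"
proof -
  let ?p = "letter m" and ?A = "insert (a, b) A" and ?y = "inv_act y (letter m)"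
  let ?L = "row_pos m k A" and ?R = "col_pos m k A"
  note d = letter_descent[OF y]
  have yL: "y (?L i) = max (?L i) (?R (k - 1 - i))" if "i < k" for i
    using y that by (simp add: ideal_involution_def)
  have yR: "y (?R j) = min (?R j) (?L (k - 1 - j))" if "j < k" for j
    using y that by (simp add: ideal_involution_def)
  have out: "y x = w x" if "x \<le> m \<or> m + 2 * k < x" for x
    using y that unfolding ideal_involution_def by blast
  have bounds: "m < ?p" "Suc ?p \<le> m + 2 * k"
    using row_pos_bounds[of a m] col_pos_bounds[of b m] ab_less by (simp_all add: pos_old)
  have L_ne: "?L i \<noteq> ?p" "?L i \<noteq> Suc ?p" if "i < k" "i \<noteq> a" for i
    using that ab_less row_pos_less[of i a m] row_pos_less[of a i m] row_pos_neq_col_pos[of i b m]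
    by (auto simp: pos_old linorder_neq_iff)
  have R_ne: "?R j \<noteq> ?p" "?R j \<noteq> Suc ?p" if "j < k" "j \<noteq> b" for j
    using that ab_less col_pos_less[of j b m] col_pos_less[of b j m] row_pos_neq_col_pos[of a j m]
    by (auto simp: pos_old linorder_neq_iff)
  show ?thesis
  proof (cases "a + b = k - 1")
    case True
    then have ba: "k - 1 - a = b" "k - 1 - b = a" using cell by auto
    have y': "?y = y \<circ> s ?p" using d(3) True inv by (simp add: inv_act_remove)
    have "y (Suc ?p) = ?p" using yR[of b] ab_less ba by (simp add: pos_old)
    have "?y (row_pos m k ?A i) = max (row_pos m k ?A i) (col_pos m k ?A (k - 1 - i))" if "i < k" for i
    proof (cases "i = a")
      case True
      then show ?thesis using ba d(3) \<open>a + b = k - 1\<close> by (simp add: y' row_pos_new col_pos_new)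
    next
      case False
      then have "k - 1 - i \<noteq> b" using that ba by auto
      then show ?thesis using False that L_ne[of i] yL[of i] by (simp add: y' row_pos_new col_pos_new s_other)
    qed
    moreover have "?y (col_pos m k ?A j) = min (col_pos m k ?A j) (row_pos m k ?A (k - 1 - j))" if "j < k" for j
    proof (cases "j = b")
      case True
      then show ?thesis using ba \<open>y (Suc ?p) = ?p\<close> by (simp add: y' row_pos_new col_pos_new)
    next
      case False
      then have "k - 1 - j \<noteq> a" using that ba by auto
      then show ?thesis using False that R_ne[of j] yR[of j] by (simp add: y' row_pos_new col_pos_new s_other)
    qed
    moreover have "?y x = w x" if "x \<le> m \<or> m + 2 * k < x" for x
      using that bounds out[OF that] by (auto simp: y' s_other)
    ultimately show ?thesis by (simp add: ideal_involution_def)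
  next
    case False
    then have ba: "b < k - 1 - a" "a < k - 1 - b" using cell by auto
    have y': "?y = s ?p \<circ> y \<circ> s ?p"
      using d False inv by (simp add: inv_act_conj)
    have Rb: "Suc ?p < ?R (k - 1 - a)"
      using col_pos_less[OF ba(1), of m] ab_less by (simp add: pos_old)
    have La: "?L (k - 1 - b) < ?p"
      using row_pos_less[OF ba(2), of m] ab_less by (simp add: pos_old)
    have "?y (row_pos m k ?A i) = max (row_pos m k ?A i) (col_pos m k ?A (k - 1 - i))" if "i < k" for i
    proof (cases "i = a")
      case True
      have "?y (row_pos m k ?A a) = s ?p (y ?p)" by (simp add: y' row_pos_new)
      also have "y ?p = ?R (k - 1 - a)" using yL[of a] ab_less Rb by (simp add: pos_old)
      finally show ?thesis using True Rb ba by (simp add: row_pos_new col_pos_new s_other)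
    next
      case F: False
      have "?y (row_pos m k ?A i) = s ?p (max (?L i) (?R (k - 1 - i)))"
        using F that L_ne[of i] yL[of i] by (simp add: y' row_pos_new s_other)
      also have "\<dots> = max (?L i) (col_pos m k ?A (k - 1 - i))"
      proof (cases "k - 1 - i = b")
        case True
        then have "i = k - 1 - b" using that by auto
        then show ?thesis using La True by (simp add: col_pos_new pos_old max_def)
      next
        case False
        then show ?thesis
          using F that L_ne[of i] R_ne[of "k - 1 - i"] by (simp add: col_pos_new max_def s_other)
      qed
      finally show ?thesis using F by (simp add: row_pos_new)
    qed
    moreover have "?y (col_pos m k ?A j) = min (col_pos m k ?A j) (row_pos m k ?A (k - 1 - j))" if "j < k" for j
    proof (cases "j = b")
      case True
      have "?y (col_pos m k ?A b) = s ?p (y (Suc ?p))" by (simp add: y' col_pos_new)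
      also have "y (Suc ?p) = ?L (k - 1 - b)" using yR[of b] ab_less La by (simp add: pos_old)
      finally show ?thesis using True La ba by (simp add: row_pos_new col_pos_new s_other)
    next
      case F: False
      have "?y (col_pos m k ?A j) = s ?p (min (?R j) (?L (k - 1 - j)))"
        using F that R_ne[of j] yR[of j] by (simp add: y' col_pos_new s_other)
      also have "\<dots> = min (?R j) (row_pos m k ?A (k - 1 - j))"
      proof (cases "k - 1 - j = a")
        case True
        then have "j = k - 1 - a" using that by auto
        then show ?thesis using Rb True by (simp add: row_pos_new pos_old min_def)
      next
        case False
        then show ?thesis
          using F that R_ne[of j] L_ne[of "k - 1 - j"] by (simp add: row_pos_new min_def s_other)
      qed
      finally show ?thesis using F by (simp add: col_pos_new)
    qed
    moreover have "?y x = w x" if "x \<le> m \<or> m + 2 * k < x" for x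
    proof -
      have "s ?p x = x" "s ?p (w x) = w x" using that bounds w[OF that] by (auto intro: s_other)
      then show ?thesis using out[OF that] by (simp add: y')
    qed
    ultimately show ?thesis by (simp add: ideal_involution_def)
  qed
qed

end

context staircase_ideal
begin

text \<open>Among the rows, and likewise among the columns, larger positions have larger values, so
  a descent leads from a row to a column. Adjacent positions mean a corner of \<open>A\<close>, and
  beyond the antidiagonal both points would be fixed.\<close>

lemma descent_addable:
  assumes y: "ideal_involution m k w A y"
    and q: "m < q" "Suc q \<le> m + 2 * k" and d: "y (Suc q) < y q"
  obtains a b where "addable_cell k A a b" "q = cell_letter m k (a, b)"
proof -
  let ?L = "row_pos m k A" and ?R = "col_pos m k A"
  have yL: "y (?L i) = max (?L i) (?R (k - 1 - i))" if "i < k" for i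
    using y that by (simp add: ideal_involution_def)
  have yR: "y (?R j) = min (?R j) (?L (k - 1 - j))" if "j < k" for j
    using y that by (simp add: ideal_involution_def)
  have "m < Suc q" "q \<le> m + 2 * k" using q by auto
  obtain i where i: "i < k" "q = ?L i"
  proof (rule pos_cover[OF q(1) \<open>q \<le> m + 2 * k\<close>])
    fix j assume j: "j < k" "q = ?R j"
    show ?thesis
    proof (rule pos_cover[OF \<open>m < Suc q\<close> q(2)])
      fix i assume "i < k" "Suc q = ?L i"
      then show ?thesis using d j yL[of i] yR[of j] by auto
    next
      fix j' assume j': "j' < k" "Suc q = ?R j'"
      then have "j < j'" using j col_pos_less[of j' j m] by (cases j j' rule: linorder_cases) auto
      then have "?L (k - 1 - j) < ?L (k - 1 - j') " using j j' by (intro row_pos_less) auto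
      then show ?thesis using d j j' yR[of j] yR[of j'] by auto
    qed
  qed
  obtain j where j: "j < k" "Suc q = ?R j"
  proof (rule pos_cover[OF \<open>m < Suc q\<close> q(2)])
    fix i' assume i': "i' < k" "Suc q = ?L i'"
    then have "i' < i" using i row_pos_less[of i i' m] by (cases i i' rule: linorder_cases) auto
    then have "?R (k - 1 - i) < ?R (k - 1 - i')" using i i' by (intro col_pos_less) auto
    then show ?thesis using d i i' yL[of i] yL[of i'] by auto
  qed
  have adj: "card {j. (i, j) \<in> A} = j" "card {i. (i, j) \<in> A} = i"
    using adjacent_iff[OF i(1) j(1), of m] i j by auto
  have "i + j < k"
  proof (rule ccontr)
    assume "\<not> ?thesis"
    then have less: "k - 1 - i < j" "k - 1 - j < i" using i(1) j(1) by auto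
    have "?R (k - 1 - i) < ?R j" using less j by (intro col_pos_less) auto
    moreover have "?L i < ?L (k - 1 - j)" using less i by (intro row_pos_less) auto
    ultimately show False using d i j yL[of i] yR[of j] by auto
  qed
  moreover have "(i, j) \<notin> A" using adj row_iff[of j i] by simp
  moreover have "order_ideal (insert (i, j) A)"
    unfolding order_ideal_def
  proof (intro ballI allI impI)
    fix z x assume z: "z \<in> insert (i, j) A" and x: "below x z"
    show "x \<in> insert (i, j) A"
    proof (cases "z \<in> A")
      case True
      then show ?thesis using idealD x by blast
    next
      case False
      then have "fst x \<le> i" "snd x \<le> j" using z x by (auto simp: below_def)
      moreover have "(i, j') \<in> A" if "j' < j" for j' using that adj row_iff[of j' i] by simp
      moreover have "(i', j) \<in> A" if "i' < i" for i' using that adj col_iff[of i' j] by simp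
      then have "(i', j') \<in> A" if "i' < i" "j' \<le> j" for i' j'
        using that idealD[of "(i', j)" "(i', j')"] by (simp add: below_def)
      ultimately show ?thesis by (cases x) (auto simp: le_less)
    qed
  qed
  ultimately have "addable_cell k A i j" by unfold_locales
  moreover have "q = cell_letter m k (i, j)"
    using i adj by (simp add: row_pos_def cell_letter_def)
  ultimately show ?thesis by (rule that)
qed

end

section \<open>Words of the base point\<close>

lemma v_invs: "v n \<in> invs True (2 * n)"
proof -
  have "v n (v n x) = x" for x
    by (cases x rule: fpf_point_cases[where n = n]) (auto simp: v_simps)
  moreover have "v n x = x" if "x = 0 \<or> 2 * n < x" for x
    using that by (auto simp: v_simps)
  moreover have "v n x \<noteq> x" if "x \<in> {1..2 * n}" for x
    using that by (cases x rule: fpf_point_cases[where n = n]) (auto simp: v_simps)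
  ultimately show ?thesis by (simp add: invs_def involution_def)
qed

lemma base_invs: "f \<Longrightarrow> even n \<Longrightarrow> base f n \<in> invs f n" "\<not> f \<Longrightarrow> base f n \<in> invs f n"
  using v_invs[of "n div 2"] by (auto simp: base_def invs_def)

text \<open>The first sweep already provides a path; \<open>Suc n\<close> is a crude bound for the
  crossings.\<close>

lemma down_base_exists:
  assumes "y \<in> invs f n" "f \<Longrightarrow> even n"
  obtains b where "down y b (base f n)"
proof -
  have "crossings y j \<subseteq> {..n}" for j
    using invs_fixed[OF assms(1)] by (auto simp: crossings_def) (metis leD not_le)
  then have "card (crossings y j) \<le> Suc n" for j
    using card_mono[of "{..n}" "crossings y j"] by simp
  then have "run_path (base f n) y (Suc n) 0"
    by (intro run_path_crossings[OF assms]) (auto intro: le_SucI)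
  then show ?thesis using that unfolding run_path_def by blast
qed

text \<open>A path from the base point to \<open>id\<close> is needed as well. It exists because the
  base point can be treated as an involution that may acquire fixed points.\<close>

lemma Rhat_base:
  assumes z: "z \<in> invs f n" and f: "f \<Longrightarrow> even n"
  shows "Rhat (base f n) z = {a. down z (rev a) (base f n)}"
proof -
  have "base f n \<in> invs False n"
    using base_invs[of f n] f by (cases f) (auto intro: invs_weaken)
  then obtain b where "down (base f n) b (base False n)"
    by (rule down_base_exists) auto
  then have b: "down (base f n) b id" by (simp add: base_def)
  obtain c where c: "down z c (base f n)" using down_base_exists[OF z f] by blast
  show ?thesis
    by (rule Rhat_down[OF invs_involution[OF z] invs_finite_moved[OF z] b c])
qed

lemma Fhat_rel_base:
  assumes z: "z \<in> invs f n" and f: "f \<Longrightarrow> even n" and c: "down z c (base f n)"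
  shows "Fhat_rel (base f n) z M = (if size M = length c \<and> 0 \<notin># M then int (card
    {a. down z (rev a) (base f n) \<and> rises a \<subseteq> rises (sorted_list_of_multiset M)}) else 0)"
proof -
  note R = Rhat_base[OF z f]
  note l = ilen_down[OF invs_involution[OF z] invs_finite_moved[OF z]]
  have "length a = length c" if "a \<in> Rhat (base f n) z" for a
    using l[OF c] l[of "rev a" "base f n"] that by (simp add: R)
  moreover have "finite (Rhat (base f n) z)"
    using finite_down_words[OF invs_weaken[OF z]] by (simp add: R)
  ultimately show ?thesis
    using Fhat_rel_rises[of "base f n" z "length c" M] by (simp add: R)
qed

section \<open>The involution Stanley symmetric functions of \<open>g\<^sub>k\<close>\<close>

lemma card_moved_remove:
  assumes "involution y" "finite (moved y)" "y i = Suc i"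
  shows "card (moved (inv_act y i)) < card (moved y)"
proof (rule psubset_card_mono[OF assms(2)])
  have "y (Suc i) = i" using assms by (metis involutionD)
  then have "moved (inv_act y i) = moved y - {i, Suc i}"
    using assms by (auto simp: inv_act_remove moved_def transpose_def split: if_splits)
  moreover have "i \<in> moved y" using assms by (simp add: moved_def)
  ultimately show "moved (inv_act y i) \<subset> moved y" by blast
qed

text \<open>Descending steps never create arcs. If start and end have no fixed points in the same
  interval, no arc can have been deleted either.\<close>

lemma card_moved_down:
  "involution y \<Longrightarrow> finite (moved y) \<Longrightarrow> down y b e \<Longrightarrow> card (moved e) \<le> card (moved y)"
proof (induction b arbitrary: y)
  case (Cons i b)
  have "card (moved (inv_act y i)) \<le> card (moved y)"
  proof (cases "y i = Suc i")
    case True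
    then show ?thesis using card_moved_remove[of y i] Cons.prems by simp
  next
    case False
    then have "inv_act y i = s i \<circ> y \<circ> s i" using Cons.prems by (intro inv_act_conj) auto
    then show ?thesis by (simp add: moved_conj card_image_le Cons.prems)
  qed
  moreover have "card (moved e) \<le> card (moved (inv_act y i))"
    using Cons.prems by (intro Cons.IH) auto
  ultimately show ?case by simp
qed simp

lemma moved_fpf: "y \<in> invs True n \<Longrightarrow> moved y = {1..n}"
proof (intro set_eqI)
  fix x assume y: "y \<in> invs True n"
  show "x \<in> moved y \<longleftrightarrow> x \<in> {1..n}"
  proof (cases "x \<in> {1..n}")
    case True
    then have "y x \<noteq> x" using y unfolding invs_def by blast
    then show ?thesis using True unfolding moved_def by blast
  next
    case False
    then have "x = 0 \<or> n < x" by auto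
    have *: "\<forall>x. x = 0 \<or> n < x \<longrightarrow> y x = x"
      using y unfolding invs_def mem_Collect_eq by (elim conjE)
    have "y x = x" by (rule mp[OF spec[OF *]]) fact
    then show ?thesis using False by (simp add: moved_def)
  qed
qed

lemma linext_exists:
  assumes "finite B"
  obtains c where "sorted_wrt (\<lambda>x y. \<not> below y x) c" "set c = B"
  using assms
proof -
  define h where "h x = fst x + snd x" for x :: "nat \<times> nat"
  obtain xs where xs: "distinct xs" "set xs = B" using finite_distinct_list[OF assms] by blast
  define c where "c = sort_key h xs"
  have c: "distinct c" "set c = B" "sorted (map h c)" using xs by (simp_all add: c_def)
  have "\<not> below (c ! l) (c ! j)" if "j < l" "l < length c" for j l
  proof
    assume "below (c ! l) (c ! j)"
    moreover have "h (c ! j) \<le> h (c ! l)" using sorted_nth_mono[OF c(3), of j l] that by simp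
    ultimately have "c ! l = c ! j" by (auto simp: below_def h_def prod_eq_iff)
    then show False using c(1) that nth_eq_iff_index_eq[of c l j] by simp
  qed
  then have "sorted_wrt (\<lambda>x y. \<not> below y x) c" by (simp add: sorted_wrt_iff_nth_less)
  then show ?thesis using that c(2) by blast
qed

text \<open>With \<open>f\<close> only the smaller staircase is filled, as the cells of the last
  antidiagonal stand for deleted arcs. \<open>w_descent\<close> leaves no letters outside the block
  except those that would delete an arc although \<open>f\<close> forbids it.\<close>

locale staircase_words =
  fixes f :: bool and n m k K :: nat and w e :: "nat \<Rightarrow> nat"
  assumes w_low: "\<And>x. x \<le> m \<Longrightarrow> w x \<le> m"
    and w_high: "\<And>x. m + 2 * k < x \<Longrightarrow> m + 2 * k < w x"
    and w_descent: "\<And>q. q < m \<or> m + 2 * k < q \<Longrightarrow> w (Suc q) < w q \<Longrightarrow> f \<and> w q = Suc q"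
    and K: "K = (if f then k - 1 else k)"
    and e: "e \<in> invs f n" "ideal_involution m k w (staircase K) e"
begin

lemma K_le: "K \<le> k"
  by (simp add: K)

lemma step:
  assumes y: "y \<in> invs f n" "ideal_involution m k w A y" and ac: "addable_cell k A a b" "a + b < K"
  shows "inv_act y (cell_letter m k (a, b)) \<in> invs f n"
    "ideal_involution m k w (insert (a, b) A) (inv_act y (cell_letter m k (a, b)))"
    "y (Suc (cell_letter m k (a, b))) < y (cell_letter m k (a, b))" "1 \<le> cell_letter m k (a, b)"
proof -
  interpret addable_cell k A a b by (rule ac(1))
  note d = letter_descent[OF y(2)]
  show desc: "y (Suc (letter m)) < y (letter m)" using d(1,2) by simp
  show pos: "1 \<le> letter m" using ab_less by (simp add: cell_letter_def)
  show "inv_act y (letter m) \<in> invs f n"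
  proof (cases "y (letter m) = Suc (letter m)")
    case True
    then have "\<not> f" using d(3) ac(2) K by auto
    then show ?thesis using True invs_remove[of y n "letter m"] y pos by simp
  next
    case False
    then show ?thesis using invs_conj[OF y(1) pos desc] by simp
  qed
  show "ideal_involution m k w (insert (a, b) A) (inv_act y (letter m))"
    using w_low w_high by (intro ideal_involution_step y(2) invs_involution[OF y(1)]) blast
qed

lemma linext_down:
  assumes "y \<in> invs f n" "ideal_involution m k w A y" "order_ideal A" "A \<subseteq> staircase K"
    and "sorted_wrt (\<lambda>x y. \<not> below y x) c" "set c = staircase K - A"
  shows "down y (map (cell_letter m k) c) e"
  using assms
proof (induction c arbitrary: y A)
  case Nil
  then have "A = staircase K" by auto
  moreover have "staircase_ideal k (staircase K)"
    by unfold_locales (rule order_ideal_staircase, rule staircase_mono[OF K_le])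
  ultimately show ?case
    using staircase_ideal.ideal_involution_unique[of k "staircase K"] Nil e by auto
next
  case (Cons x c)
  obtain a b where x: "x = (a, b)" by force
  have new: "(a, b) \<notin> A" "a + b < K"
    using Cons.prems(6) by (auto simp: x staircase_def)
  have "order_ideal (insert (a, b) A)"
    unfolding order_ideal_def
  proof (intro ballI allI impI)
    fix z u assume z: "z \<in> insert (a, b) A" and u: "below u z"
    show "u \<in> insert (a, b) A"
    proof (cases "z \<in> A")
      case True
      then show ?thesis using u Cons.prems(3) unfolding order_ideal_def by blast
    next
      case False
      then have "below u x" using z u x by simp
      then have "u \<in> staircase K" using new by (auto simp: x below_def staircase_def)
      moreover have "u \<notin> set c" using Cons.prems(5) \<open>below u x\<close> by auto
      ultimately show ?thesis using Cons.prems(6) x by auto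
    qed
  qed
  then have cell: "addable_cell k A a b"
    using new Cons.prems(3,4) staircase_mono[OF K_le] K_le by unfold_locales auto
  have "x \<notin> set c" using Cons.prems(5) by auto
  then have "set c = staircase K - insert (a, b) A" using Cons.prems(6) x by auto
  then have "down (inv_act y (cell_letter m k (a, b))) (map (cell_letter m k) c) e"
    using Cons.prems new cell addable_cell.ideal'[OF cell] step[OF Cons.prems(1,2) cell new(2)]
    by (intro Cons.IH[of _ "insert (a, b) A"]) (auto simp: staircase_def)
  then show ?case using step[OF Cons.prems(1,2) cell new(2)] x by simp
qed

text \<open>Each letter is a descent and comes from an addable cell by
  \<open>descent_addable\<close>, once letters outside the block and, with \<open>f\<close>, the
  last antidiagonal are excluded.\<close>

lemma down_linext:
  assumes "y \<in> invs f n" "ideal_involution m k w A y" "order_ideal A" "A \<subseteq> staircase K"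
    and "down y b e"
  shows "\<exists>c. sorted_wrt (\<lambda>x y. \<not> below y x) c \<and> set c = staircase K - A \<and> b = map (cell_letter m k) c"
  using assms
proof (induction b arbitrary: y A)
  case Nil
  obtain c where c: "sorted_wrt (\<lambda>x y. \<not> below y x) c" "set c = staircase K - A"
    using linext_exists[of "staircase K - A"] by auto
  note l = ilen_down[OF invs_involution[OF Nil(1)] invs_finite_moved[OF Nil(1)]]
  \<comment> \<open>Missing cells would give a second path from \<open>y\<close> to
    \<open>e\<close>, but all such paths have the same length.\<close>
  have "length c = 0"
    using l[OF linext_down[OF Nil.prems(1-4) c]] Nil.prems(5) by simp
  then show ?case using c by auto
next
  case (Cons q b)
  note y = Cons.prems(1,2) and inv = invs_involution[OF Cons.prems(1)]
  interpret staircase_ideal k A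
    using Cons.prems(3,4) staircase_mono[OF K_le] by unfold_locales auto
  have q: "1 \<le> q" "y (Suc q) < y q" "down (inv_act y q) b e" using Cons.prems(5) by auto
  \<comment> \<open>A deletion would lose two moved points for good, while \<open>e\<close> moves as
    many points as \<open>y\<close>.\<close>
  have no_remove: False if "f" "y q = Suc q"
  proof -
    have fin: "finite (moved y)" by (rule invs_finite_moved[OF y(1)])
    have "card (moved e) \<le> card (moved (inv_act y q))"
      by (rule card_moved_down[OF _ _ q(3)]) (use inv fin in auto)
    also have "\<dots> < card (moved y)" by (rule card_moved_remove[OF inv fin that(2)])
    finally show False using moved_fpf[of y n] moved_fpf[of e n] y e \<open>f\<close> by simp
  qed
  have out: "y x = w x" if "x \<le> m \<or> m + 2 * k < x" for x
    using y(2) that unfolding ideal_involution_def by blast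
  have inside: "m < q \<and> Suc q \<le> m + 2 * k"
  proof (rule ccontr)
    assume "\<not> ?thesis"
    then consider "q < m \<or> m + 2 * k < q" | "q = m" | "q = m + 2 * k" by linarith
    then show False
    proof cases
      case 1
      then have "y q = w q" "y (Suc q) = w (Suc q)" using out[of q] out[of "Suc q"] by auto
      then show False using no_remove w_descent[OF 1] q(2) by simp
    next
      \<comment> \<open>A descent at the border would send a point across it, but \<open>w\<close>
        maps the outer points of this side to themselves as a set.\<close>
      case 2
      then have "y q \<le> m" using w_low[of q] out[of q] by simp
      then have "y (Suc q) \<le> m" using q(2) by simp
      then have "y (y (Suc q)) \<le> m" using w_low[of "y (Suc q)"] out[of "y (Suc q)"] by simp
      then show False using 2 by (simp add: involutionD[OF inv])
    next
      case 3
      then have "m + 2 * k < y (Suc q)" using w_high[of "Suc q"] out[of "Suc q"] by simp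
      then have "m + 2 * k < y q" using q(2) by simp
      then have "m + 2 * k < y (y q)" using w_high[of "y q"] out[of "y q"] by simp
      then show False using 3 by (simp add: involutionD[OF inv])
    qed
  qed
  then obtain a a' where cell: "addable_cell k A a a'" "q = cell_letter m k (a, a')"
    using descent_addable[OF y(2) _ _ q(2)] by blast
  have "a + a' \<noteq> k - 1" if f
    using addable_cell.letter_descent(3)[OF cell(1) y(2)] no_remove that cell(2) by auto
  then have aK: "a + a' < K" using addable_cell.cell[OF cell(1)] K by (auto split: if_splits)
  note st = step[OF y cell(1) aK]
  have "\<exists>c. sorted_wrt (\<lambda>x y. \<not> below y x) c \<and> set c = staircase K - insert (a, a') A \<and>
      b = map (cell_letter m k) c"
  proof (rule Cons.IH)
    show "down (inv_act y (cell_letter m k (a, a'))) b e" using q(3) cell(2) by simp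
    show "order_ideal (insert (a, a') A)" by (rule addable_cell.ideal'[OF cell(1)])
    show "insert (a, a') A \<subseteq> staircase K" using aK Cons.prems(4) by (auto simp: staircase_def)
  qed (use st in auto)
  then obtain c where c: "sorted_wrt (\<lambda>x y. \<not> below y x) c" "set c = staircase K - insert (a, a') A"
    "b = map (cell_letter m k) c" by blast
  have "\<not> below z (a, a')" if "z \<in> set c" for z
  proof
    assume "below z (a, a')"
    then have "z \<in> insert (a, a') A"
      using addable_cell.ideal'[OF cell(1)] unfolding order_ideal_def by blast
    then show False using c(2) that by auto
  qed
  moreover have "set ((a, a') # c) = staircase K - A"
    using c(2) aK addable_cell.new[OF cell(1)] by (auto simp: staircase_def)
  ultimately show ?case
    using c cell(2) by (intro exI[of _ "(a, a') # c"]) auto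
qed

end

section \<open>Words read backwards\<close>

lemma linexts_content_inj:
  "sorted_wrt (\<lambda>x y. \<not> below y x) c \<Longrightarrow> sorted_wrt (\<lambda>x y. \<not> below y x) c' \<Longrightarrow> set c = set c' \<Longrightarrow>
    map content c = map content c' \<Longrightarrow> c = c'"
proof (induction c arbitrary: c')
  case (Cons x c)
  then obtain x' d where d: "c' = x' # d" by (cases c') auto
  have "x = x'"
  proof (rule ccontr)
    assume "x \<noteq> x'"
    then have "x' \<in> set c" "x \<in> set d" using Cons.prems(3) d by auto
    then have "\<not> below x' x" "\<not> below x x'" using Cons.prems(1,2) d by auto
    moreover have "content x = content x'" using Cons.prems(4) d by simp
    \<comment> \<open>Cells of equal content lie on one diagonal and are comparable.\<close>
    then have "below x' x \<or> below x x'" by (auto simp: content_def below_def)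
    ultimately show False by blast
  qed
  moreover have "x \<notin> set c" "x' \<notin> set d" using Cons.prems(1,2) d by auto
  then have "set c = set d" using Cons.prems(3) d \<open>x = x'\<close> by auto
  then have "c = d" using Cons.prems d by (intro Cons.IH) auto
  ultimately show ?case using d by simp
qed simp

text \<open>Reversing the list and reversing the order of its letters cancel for each pair of
  neighbours; only the place of the rise is mirrored.\<close>

lemma rises_rev_map:
  fixes l :: "'a::linorder list" and h :: "'a \<Rightarrow> 'b::linorder"
  assumes "\<And>x y. x \<in> set l \<Longrightarrow> y \<in> set l \<Longrightarrow> h x < h y \<longleftrightarrow> y < x"
  shows "rises (rev (map h l)) = {q. Suc q < length l \<and> length l - 2 - q \<in> rises l}"
proof (intro set_eqI iffI)
  fix q
  have *: "rev (map h l) ! q < rev (map h l) ! Suc q \<longleftrightarrow> l ! (length l - 2 - q) < l ! Suc (length l - 2 - q)"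
    if q: "Suc q < length l"
  proof -
    define r where "r = length l - 2 - q"
    have r: "length l - Suc q = Suc r" "length l - Suc (Suc q) = r" "Suc r < length l"
      using q by (auto simp: r_def)
    have "rev (map h l) ! q = h (l ! Suc r)" "rev (map h l) ! Suc q = h (l ! r)"
      using rev_nth[of q "map h l"] rev_nth[of "Suc q" "map h l"] q r by simp_all
    moreover have "h (l ! Suc r) < h (l ! r) \<longleftrightarrow> l ! r < l ! Suc r"
      using r by (intro assms nth_mem) auto
    ultimately show ?thesis by (simp add: r_def)
  qed
  show "q \<in> {q. Suc q < length l \<and> length l - 2 - q \<in> rises l}" if "q \<in> rises (rev (map h l))"
    using that * by (auto simp: rises_def)
  show "q \<in> rises (rev (map h l))" if "q \<in> {q. Suc q < length l \<and> length l - 2 - q \<in> rises l}"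
    using that * by (auto simp: rises_def)
qed

lemma rises_rev_map_subset:
  fixes l :: "'a::linorder list" and h :: "'a \<Rightarrow> 'b::linorder" and l' :: "'c::linorder list" and h' :: "'c \<Rightarrow> 'd::linorder"
  assumes h: "\<And>x y. x \<in> set l \<Longrightarrow> y \<in> set l \<Longrightarrow> h x < h y \<longleftrightarrow> y < x"
    and h': "\<And>x y. x \<in> set l' \<Longrightarrow> y \<in> set l' \<Longrightarrow> h' x < h' y \<longleftrightarrow> y < x"
    and len: "length l = length l'"
  shows "rises (rev (map h l)) \<subseteq> rises (rev (map h' l')) \<longleftrightarrow> rises l \<subseteq> rises l'"
proof -
  define N where "N = length l"
  have bound: "Suc q < N" if "q \<in> rises l" for q
    using that by (simp add: rises_def N_def)
  have eq: "rises (rev (map h l)) = {q. Suc q < N \<and> N - 2 - q \<in> rises l}"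
    "rises (rev (map h' l')) = {q. Suc q < N \<and> N - 2 - q \<in> rises l'}"
    using rises_rev_map[of l h, OF h] rises_rev_map[of l' h', OF h'] len by (simp_all add: N_def)
  have "{q. Suc q < N \<and> N - 2 - q \<in> X} \<subseteq> {q. Suc q < N \<and> N - 2 - q \<in> Y} \<longleftrightarrow> X \<subseteq> Y"
    if X: "\<And>q. q \<in> X \<Longrightarrow> Suc q < N" for X Y
  proof
    assume sub: "{q. Suc q < N \<and> N - 2 - q \<in> X} \<subseteq> {q. Suc q < N \<and> N - 2 - q \<in> Y}"
    show "X \<subseteq> Y"
    proof
      fix q assume q: "q \<in> X"
      then have "Suc q < N" by (rule X)
      then have *: "Suc (N - 2 - q) < N" "N - 2 - (N - 2 - q) = q" by auto
      then have "N - 2 - q \<in> {q. Suc q < N \<and> N - 2 - q \<in> X}" using q by simp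
      then have "N - 2 - q \<in> {q. Suc q < N \<and> N - 2 - q \<in> Y}" by (rule subsetD[OF sub])
      then show "q \<in> Y" using * by simp
    qed
  qed auto
  then show ?thesis unfolding eq using bound by blast
qed

definition stair_partition :: "nat \<Rightarrow> nat list" where
  "stair_partition k = map (\<lambda>i. k - i) [0..<k]"

lemma is_partition_stair: "is_partition (stair_partition k)"
  by (auto simp: is_partition_def stair_partition_def sorted_wrt_iff_nth_less)

lemma diagram_stair: "diagram (stair_partition k) = staircase k"
  by (auto simp: diagram_def stair_partition_def staircase_def)

context staircase_words
begin

text \<open>The words are the reversed letter lists of linear extensions, and their rises are those
  of the contents at mirrored places. The permutation \<open>\<pi>\<close> reverses the variables of
  \<open>M\<close> to mirror the monomial too, which the symmetry of Schur functions
  permits.\<close>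

lemma Fhat_rel_schur:
  assumes z: "z \<in> invs f n" "ideal_involution m k w {} z" and f: "f \<Longrightarrow> even n" and e_base: "e = base f n"
  shows "Fhat_rel (base f n) z = schur (stair_partition K)"
proof
  fix M
  let ?\<phi> = "map (cell_letter m k)" and ?C = "linexts (staircase K)"
  obtain c0 where c0: "c0 \<in> ?C"
    using linext_exists[OF finite_staircase, of K thesis] unfolding linexts_def by blast
  have ideal: "order_ideal {}" "{} \<subseteq> staircase K" by (auto simp: order_ideal_def)
  have words: "down z b e \<longleftrightarrow> b \<in> ?\<phi> ` ?C" for b
    using linext_down[OF z ideal] down_linext[OF z ideal] by (auto simp: linexts_def)
  define N where "N = card (staircase K)"
  have len: "length c = N" if "c \<in> ?C" for c using linexts_length[OF that] by (simp add: N_def)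
  have F: "Fhat_rel (base f n) z M = (if size M = N \<and> 0 \<notin># M then int (card
    {a. rev a \<in> ?\<phi> ` ?C \<and> rises a \<subseteq> rises (sorted_list_of_multiset M)}) else 0)"
    using Fhat_rel_base[OF z(1) f, of "?\<phi> c0" M] c0 len[OF c0] words by (simp add: e_base[symmetric])
  obtain B where B: "\<forall>x\<in>#M. x \<le> B"
    by (meson finite_nat_set_iff_bounded_le finite_set_mset)
  define \<pi> where "\<pi> x = (if x \<in> {1..B} then Suc B - x else x)" for x
  have "\<pi> permutes {1..B}"
    by (rule bij_imp_permutes, rule bij_betw_byWitness[where f' = \<pi>]) (auto simp: \<pi>_def)
  then have sym: "schur (stair_partition K) (image_mset \<pi> M) = schur (stair_partition K) M"
    by (rule schur_symmetric[OF is_partition_stair])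
  show "Fhat_rel (base f n) z M = schur (stair_partition K) M"
  proof (cases "size M = N \<and> 0 \<notin># M")
    case False
    then show ?thesis
      unfolding F schur_linexts[OF is_partition_stair] diagram_stair N_def by (simp only: if_False)
  next
    case True
    have M: "x \<in> {1..B}" if "x \<in># M" for x using B True that by (auto simp: Suc_le_eq intro: gr0I)
    define I where "I = sorted_list_of_multiset M"
    define I' where "I' = sorted_list_of_multiset (image_mset \<pi> M)"
    have \<pi>M: "\<pi> x \<in> {1..B}" "\<pi> (\<pi> x) = x" if "x \<in># M" for x using M[OF that] by (auto simp: \<pi>_def)
    have setI': "x \<in> {1..B}" if "x \<in> set I'" for x
      using that \<pi>M by (auto simp: I'_def)
    have "sorted (rev (map \<pi> I'))"
    proof -
      have "sorted I'" by (simp add: I'_def)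
      then show ?thesis
        using setI' by (auto simp: sorted_wrt_rev sorted_wrt_map \<pi>_def elim: sorted_wrt_mono_rel[rotated])
    qed
    moreover have "mset (rev (map \<pi> I')) = M"
    proof -
      have "mset (rev (map \<pi> I')) = image_mset (\<lambda>x. \<pi> (\<pi> x)) M"
        by (simp add: I'_def multiset.map_comp comp_def)
      also have "\<dots> = image_mset (\<lambda>x. x) M" by (rule image_mset_cong) (simp add: \<pi>M)
      finally show ?thesis by simp
    qed
    ultimately have II': "I = rev (map \<pi> I')"
      unfolding I_def by (metis sorted_list_of_multiset_mset sorted_sort_id)
    have sizeI': "length I' = N"
      using True by (metis I'_def mset_sorted_list_of_multiset size_image_mset size_mset)
    have rise_iff: "rises (rev (?\<phi> c)) \<subseteq> rises I \<longleftrightarrow> rises (map content c) \<subseteq> rises I'" if c: "c \<in> ?C" for c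
    proof -
      \<comment> \<open>On contents up to \<open>k\<close> nothing is truncated by
        \<open>nat\<close>, so \<open>h\<close> reverses the order there.\<close>
      define h where "h x = nat (int (m + k) - x)" for x
      have cl: "cell_letter m k x = h (content x)" "content x \<le> int k" if "x \<in> set c" for x
      proof -
        have "fst x < k" using that c K_le by (auto simp: linexts_def staircase_def)
        then show "cell_letter m k x = h (content x)" "content x \<le> int k"
          by (simp_all add: cell_letter_def h_def content_def of_nat_diff nat_eq_iff)
      qed
      have mc: "?\<phi> c = map h (map content c)" using cl by simp
      have h: "h x < h y \<longleftrightarrow> y < x" if "x \<in> set (map content c)" "y \<in> set (map content c)" for x y
      proof -
        have "x \<le> int k" "y \<le> int k" using that cl(2) by auto
        then show ?thesis by (auto simp: h_def)
      qed
      have \<pi>: "\<pi> x < \<pi> y \<longleftrightarrow> y < x" if "x \<in> set I'" "y \<in> set I'" for x y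
        using setI'[OF that(1)] setI'[OF that(2)] by (auto simp: \<pi>_def)
      show ?thesis
        unfolding II' mc
      proof (rule rises_rev_map_subset)
        show "length (map content c) = length I'" using len[OF c] sizeI' by simp
      qed (fact h, fact \<pi>)
    qed
    have "inj_on (\<lambda>c. rev (?\<phi> c)) ?C"
    proof (rule inj_onI)
      fix c d assume cd: "c \<in> ?C" "d \<in> ?C" "rev (?\<phi> c) = rev (?\<phi> d)"
      have cl: "map content c = map (\<lambda>l. int (m + k) - int l) (?\<phi> c)" if "c \<in> ?C" for c
      proof -
        have "content x = int (m + k) - int (cell_letter m k x)" if "x \<in> set c" for x
        proof -
          have "fst x < k" using that \<open>c \<in> ?C\<close> K_le by (auto simp: linexts_def staircase_def)
          then show ?thesis by (simp add: cell_letter_def content_def of_nat_diff)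
        qed
        then show ?thesis by simp
      qed
      have "?\<phi> c = ?\<phi> d" using cd(3) by (metis rev_rev_ident)
      then have "map content c = map content d" unfolding cl[OF cd(1)] cl[OF cd(2)] by (rule arg_cong)
      then show "c = d" using cd linexts_content_inj[of c d] by (simp add: linexts_def)
    qed
    then have inj: "inj_on (\<lambda>c. rev (?\<phi> c)) {c \<in> ?C. rises (map content c) \<subseteq> rises I'}"
      by (rule inj_on_subset) auto
    have "{a. rev a \<in> ?\<phi> ` ?C \<and> rises a \<subseteq> rises I} =
        (\<lambda>c. rev (?\<phi> c)) ` {c \<in> ?C. rises (map content c) \<subseteq> rises I'}"
    proof (intro set_eqI iffI)
      fix a assume "a \<in> {a. rev a \<in> ?\<phi> ` ?C \<and> rises a \<subseteq> rises I}"
      then obtain c where c: "c \<in> ?C" "rev a = ?\<phi> c" "rises a \<subseteq> rises I" by auto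
      then have "a = rev (?\<phi> c)" by (metis rev_rev_ident)
      then show "a \<in> (\<lambda>c. rev (?\<phi> c)) ` {c \<in> ?C. rises (map content c) \<subseteq> rises I'}"
        using c rise_iff[OF c(1)] by blast
    qed (use rise_iff in auto)
    then have "card {a. rev a \<in> ?\<phi> ` ?C \<and> rises a \<subseteq> rises I} =
        card {c \<in> ?C. rises (map content c) \<subseteq> rises I'}"
      by (simp add: card_image[OF inj])
    moreover have "size (image_mset \<pi> M) = N" "0 \<notin># image_mset \<pi> M"
      using True \<pi>M by force+
    ultimately show ?thesis
      using True sym by (simp add: F schur_linexts[OF is_partition_stair] diagram_stair N_def I_def I'_def)
  qed
qed

end

lemma ideal_involution_empty:
  assumes "\<And>x. x \<le> m \<or> m + 2 * k < x \<Longrightarrow> y x = w x"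
    and "\<And>x. m < x \<Longrightarrow> x \<le> m + k \<Longrightarrow> y x = x + k" "\<And>x. m + k < x \<Longrightarrow> x \<le> m + 2 * k \<Longrightarrow> y x = x - k"
  shows "ideal_involution m k w {} y"
  using assms by (auto simp: ideal_involution_def row_pos_def col_pos_def)

lemma Fhat_dprod_id_g:
  assumes "dprod m id (g k) \<in> invs False n"
  shows "Fhat_rel (base False n) (dprod m id (g k)) = schur (stair_partition k)"
proof -
  interpret staircase_words False n m k k id id
  proof
    show "id \<in> invs False n" by (simp add: invs_def)
    \<comment> \<open>With the full staircase each row has passed the column of its arc, so all
      points are fixed.\<close>
    show "ideal_involution m k id (staircase k) id"
      unfolding ideal_involution_def row_pos_def col_pos_def card_staircase_row card_staircase_col by auto
  qed auto
  show ?thesis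
  proof (rule Fhat_rel_schur[OF assms])
    show "ideal_involution m k id {} (dprod m id (g k))"
      by (rule ideal_involution_empty) (auto simp: dprod_def g_def)
  qed (auto simp: base_def)
qed

lemma Fhat_dprod_v_g_v:
  assumes k: "1 \<le> k" and z: "dprod (2*m + 2*k) (dprod (2*m) (v m) (g k)) (v n) \<in> invs True (2 * (m + k + n))"
  shows "Fhat_rel (base True (2 * (m + k + n))) (dprod (2*m + 2*k) (dprod (2*m) (v m) (g k)) (v n)) =
    schur (stair_partition (k - 1))"
proof -
  let ?w = "v (m + k + n)"
  interpret staircase_words True "2 * (m + k + n)" "2 * m" k "k - 1" ?w ?w
  proof
    show "?w x \<le> 2 * m" if "x \<le> 2 * m" for x
      using that by (cases x rule: fpf_point_cases[where n = m]) (auto simp: v_simps)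
    show "2 * m + 2 * k < ?w x" if "2 * m + 2 * k < x" for x
      using that by (auto simp: v_def) presburger
    show "True \<and> ?w q = Suc q" if "?w (Suc q) < ?w q" for q
      using that by (auto simp: v_def split: if_splits)
    show "?w \<in> invs True (2 * (m + k + n))" by (rule v_invs)
    \<comment> \<open>At this staircase row \<open>i\<close> has position
      \<open>2 * m + 2 * (k - i) - 1\<close> and column \<open>k - 1 - i\<close> the next one, so
      every arc joins neighbours.\<close>
    have "?w x = (if odd x then x + 1 else x - 1)" if "1 \<le> x" "x \<le> 2 * m + 2 * k" for x
      using that by (simp add: v_def)
    then show "ideal_involution (2 * m) k ?w (staircase (k - 1)) ?w"
      unfolding ideal_involution_def row_pos_def col_pos_def card_staircase_row card_staircase_col by auto
  qed auto
  show ?thesis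
  proof (rule Fhat_rel_schur[OF z])
    show "ideal_involution (2 * m) k ?w {} (dprod (2*m + 2*k) (dprod (2*m) (v m) (g k)) (v n))"
      by (rule ideal_involution_empty) (auto simp: dprod_def g_def v_def)
  qed (auto simp: base_def)
qed

section \<open>Bounds on the length of the partition\<close>

text \<open>The numbers of the runs form a sequence compatible with the word, so a monomial in the
  first \<open>r\<close> variables occurs. The first column of a tableau for it has distinct
  entries.\<close>

lemma partition_length_le_runs:
  assumes z: "z \<in> invs f n" and f: "f \<Longrightarrow> even n" and p: "is_partition p"
    and F: "Fhat_rel (base f n) z = schur p" and run: "run_path (base f n) z r 0"
  shows "length p \<le> r"
proof -
  obtain ps where ps: "down z (map snd ps) (base f n)"
    "sorted_wrt (\<lambda>(q, i) (q', i'). q' < q \<or> q = q' \<and> i < i') ps" "fst ` set ps \<subseteq> {1..r}"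
    using run unfolding run_path_def by blast
  define a where "a = rev (map snd ps)"
  define I where "I = rev (map fst ps)"
  have "sorted_wrt (\<lambda>x y. fst y \<le> fst x) ps"
    by (rule sorted_wrt_mono_rel[OF _ ps(2)]) auto
  then have "sorted I" by (simp add: I_def sorted_wrt_rev sorted_wrt_map)
  then have I: "sorted_list_of_multiset (mset I) = I"
    by (simp add: sorted_list_of_multiset_mset sorted_sort_id)
  have "rises a \<subseteq> rises I"
  proof
    fix q assume q: "q \<in> rises a"
    define u where "u = length ps - Suc (Suc q)"
    have u: "Suc u < length ps" "length ps - Suc q = Suc u" using q by (auto simp: rises_def a_def u_def)
    then have "snd (ps ! Suc u) < snd (ps ! u)"
      using q rev_nth[of q "map snd ps"] rev_nth[of "Suc q" "map snd ps"]
      by (simp add: rises_def a_def u_def[symmetric])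
    then have "fst (ps ! Suc u) < fst (ps ! u)"
      using sorted_wrt_nth_less[OF ps(2), of u "Suc u"] u by (auto split: prod.splits)
    then show "q \<in> rises I"
      using q u rev_nth[of q "map fst ps"] rev_nth[of "Suc q" "map fst ps"]
      by (simp add: rises_def a_def I_def u_def[symmetric])
  qed
  moreover have "0 \<notin># mset I" using ps(3) by (auto simp: I_def)
  moreover have "down z (rev a) (base f n)" using ps(1) by (simp add: a_def)
  moreover have "finite {a. down z (rev a) (base f n) \<and> rises a \<subseteq> rises I}"
    by (rule finite_subset[OF _ finite_down_words[OF invs_weaken[OF z]]]) auto
  ultimately have "card {a. down z (rev a) (base f n) \<and> rises a \<subseteq> rises I} \<noteq> 0" "0 \<notin># mset I"
    by (auto simp del: set_mset_mset)
  moreover have "Fhat_rel (base f n) z (mset I) = (if size (mset I) = length (map snd ps) \<and> 0 \<notin># mset I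
      then int (card {a. down z (rev a) (base f n) \<and> rises a \<subseteq> rises I}) else 0)"
    using Fhat_rel_base[OF z _ ps(1), of "mset I"] f unfolding I by blast
  ultimately have "Fhat_rel (base f n) z (mset I) \<noteq> 0"
    by (simp add: I_def)
  then have "{T \<in> SSYT p. image_mset T (mset_set (diagram p)) = mset I} \<noteq> {}"
    unfolding F schur_def gen_series_def by (metis card.empty of_nat_0)
  then obtain T where T: "T \<in> SSYT p" "image_mset T (mset_set (diagram p)) = mset I" by blast
  have first: "(i, 0) \<in> diagram p" if "i < length p" for i
  proof -
    have "p ! i \<noteq> 0" using p that by (metis is_partition_def nth_mem)
    then show ?thesis using that by (simp add: diagram_def)
  qed
  have less: "T (i, 0) < T (j, 0)" if "i < j" "j < length p" for i j
    using SSYT_mono(2)[OF p T(1) first[OF that(2)], of "(i, 0)"] that by (simp add: below_def)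
  have "inj_on (\<lambda>i. T (i, 0)) {..<length p}"
    by (rule inj_onI) (metis lessThan_iff less less_irrefl linorder_neqE_nat)
  moreover have "(\<lambda>i. T (i, 0)) ` {..<length p} \<subseteq> {1..r}"
  proof
    fix x assume "x \<in> (\<lambda>i. T (i, 0)) ` {..<length p}"
    then have "x \<in># image_mset T (mset_set (diagram p))" using first by auto
    then have "x \<in> set I" using T(2) by simp
    then show "x \<in> {1..r}" using ps(3) by (auto simp: I_def)
  qed
  ultimately have "card {..<length p} \<le> card {1..r}"
    by (intro card_inj_on_le) auto
  then show ?thesis by simp
qed

text \<open>The second sweep gives a word ending with an increasing run of length \<open>d\<close>.
  In a standard tableau with the same ascents each of the last \<open>d\<close> cells lies in a
  lower row than the one before, which takes at least \<open>d\<close> rows.\<close>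

lemma undercut_le_partition_length:
  assumes z: "z \<in> invs f n" and f: "f \<Longrightarrow> even n" and p: "is_partition p"
    and F: "Fhat_rel (base f n) z = schur p"
  shows "card (undercut f z) \<le> length p"
proof -
  obtain b y' where b: "y' \<in> invs f n" "down z b y'" "sorted_wrt (>) b" "length b = card (undercut f z)"
    by (rule down_undercut[OF z])
  obtain b' where b': "down y' b' (base f n)" using down_base_exists[OF b(1) f] by blast
  then have word: "down z (b @ b') (base f n)" using b(2) by (auto simp: down_append)
  define N where "N = length (b @ b')"
  define a where "a = rev (b @ b')"
  let ?A = "{a. down z (rev a) (base f n)}" and ?B = "linexts (diagram p)"
  have a: "a \<in> ?A" using word by (simp add: a_def)
  have finA: "finite ?A" by (rule finite_down_words[OF invs_weaken[OF z]])
  have Fh: "Fhat_rel (base f n) z M = (if size M = N \<and> 0 \<notin># M then int (card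
      {a. down z (rev a) (base f n) \<and> rises a \<subseteq> rises (sorted_list_of_multiset M)}) else 0)" for M
    unfolding N_def by (rule Fhat_rel_base[OF z _ word]) (rule f)
  have riseU: "rises x \<subseteq> {j. Suc j < N}" if "length x = N" for x :: "'x::linorder list"
    using that by (auto simp: rises_def)
  have lenA: "length x = N" if "x \<in> ?A" for x
  proof -
    have "ilen z = ilen (base f n) + 4 * length (rev x)" "ilen z = ilen (base f n) + 4 * N"
      using ilen_down[OF invs_involution[OF z] invs_finite_moved[OF z]] word that
      unfolding N_def by blast+
    then show ?thesis by simp
  qed
  have card_p: "card (diagram p) = N"
  proof -
    \<comment> \<open>With pairwise distinct variables every word contributes, so the nonzero
      coefficient reveals the degree.\<close>
    obtain M :: "nat multiset" where M: "size M = N" "0 \<notin># M"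
      "rises (sorted_list_of_multiset M) = {j. Suc j < N}"
      by (rule monomial_with_rises[OF order_refl])
    have "{a \<in> ?A. rises a \<subseteq> {j. Suc j < N}} = ?A" using riseU lenA by blast
    then have "{a. down z (rev a) (base f n) \<and> rises a \<subseteq> {j. Suc j < N}} = ?A" by auto
    then have "Fhat_rel (base f n) z M = int (card ?A)" using M by (simp add: Fh)
    also have "\<dots> \<noteq> 0" using finA a by auto
    finally have "schur p M \<noteq> 0" by (simp add: F)
    then show ?thesis unfolding schur_linexts[OF p] using M(1) by (metis)
  qed
  have "\<exists>c\<in>?B. rises (map content c) = rises a"
  proof (rule subset_counts_attained[where U = "{j. Suc j < N}" and A = ?A and F = rises and a = a])
    show "card {a \<in> ?A. rises a \<subseteq> D} = card {c \<in> ?B. rises (map content c) \<subseteq> D}"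
      if D: "D \<subseteq> {j. Suc j < N}" for D
    proof -
      obtain M :: "nat multiset" where M: "size M = N" "0 \<notin># M" "rises (sorted_list_of_multiset M) = D"
        by (rule monomial_with_rises[OF D])
      have "Fhat_rel (base f n) z M = schur p M" by (simp add: F)
      then show ?thesis
        unfolding Fh schur_linexts[OF p] using M card_p by simp
    qed
    show "rises a \<subseteq> {j. Suc j < N}" using riseU lenA[OF a] by blast
  qed (use finA a finite_linexts[OF finite_diagram] in auto)
  then obtain c where c: "c \<in> ?B" "rises (map content c) = rises a" by blast
  have lc: "length c = N" using linexts_length[OF c(1)] card_p by simp
  define d where "d = length b"
  have dN: "d \<le> N" by (simp add: d_def N_def)
  have rise: "q \<in> rises a" if q: "N - d \<le> q" "Suc q < N" for q
  proof -
    define u where "u = N - Suc (Suc q)"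
    have u: "N - Suc q = Suc u" "Suc u < d" using q dN by (auto simp: u_def)
    have "b ! Suc u < b ! u" using sorted_wrt_nth_less[OF b(3), of u "Suc u"] u by (simp add: d_def)
    then have "(b @ b') ! Suc u < (b @ b') ! u" using u by (simp add: nth_append d_def)
    moreover have "Suc q < length b' + length b" using q by (simp add: N_def)
    ultimately show ?thesis
      using q u rev_nth[of q "b @ b'"] rev_nth[of "Suc q" "b @ b'"]
      by (simp add: rises_def a_def u_def[symmetric] N_def[simplified, symmetric])
  qed
  have row: "fst (c ! q) < fst (c ! Suc q)" if q: "N - d \<le> q" "Suc q < N" for q
  proof -
    have "q \<in> rises (map content c)" using rise[OF q] c(2) by simp
    then have "content (c ! q) < content (c ! Suc q)" using q lc by (simp add: rises_def Suc_lessD)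
    \<comment> \<open>If the next cell were not in a lower row, the growing content would put it
      weakly above and to the left, against the order of \<open>c\<close>.\<close>
    moreover have "\<not> below (c ! Suc q) (c ! q)"
      using c(1) q lc by (auto simp: linexts_def sorted_wrt_iff_nth_less)
    ultimately show ?thesis by (auto simp: below_def content_def)
  qed
  have rows: "t \<le> fst (c ! (N - d + t))" if "t < d" for t
    using that
  proof (induction t)
    case (Suc t)
    have "N - d \<le> N - d + t" "Suc (N - d + t) < N" using Suc.prems dN by linarith+
    from row[OF this] have "fst (c ! (N - d + t)) < fst (c ! (N - d + Suc t))" by simp
    moreover have "t \<le> fst (c ! (N - d + t))" using Suc by simp
    ultimately show ?case by linarith
  qed simp
  show ?thesis
  proof (cases "d = 0")
    case False
    then have "N - d + (d - 1) = N - 1" using dN by linarith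
    then have "d - 1 \<le> fst (c ! (N - 1))" using rows[of "d - 1"] False by simp
    moreover have "set c = diagram p" using c(1) by (simp add: linexts_def)
    then have "c ! (N - 1) \<in> diagram p"
      using nth_mem[of "N - 1" c] lc False dN by simp
    then have "fst (c ! (N - 1)) < length p" by (auto simp: diagram_def)
    ultimately show ?thesis using b(4) by (simp add: d_def)
  qed (use b(4) in \<open>simp add: d_def\<close>)
qed

section \<open>Involutions whose undercut points all cross one point\<close>

text \<open>The points between \<open>c\<close> and \<open>h x\<close> are exactly the images of the
  points before \<open>x\<close>; comparing sizes gives the value.\<close>

lemma strict_mono_onto_interval:
  fixes h :: "nat \<Rightarrow> nat"
  assumes mono: "\<And>x x'. m < x \<Longrightarrow> x < x' \<Longrightarrow> x' \<le> c \<Longrightarrow> h x < h x'"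
    and above: "\<And>x. m < x \<Longrightarrow> x \<le> c \<Longrightarrow> c < h x"
    and onto: "\<And>x t. m < x \<Longrightarrow> x \<le> c \<Longrightarrow> c < t \<Longrightarrow> t < h x \<Longrightarrow> t \<in> h ` {m<..c}"
    and x: "m < x" "x \<le> c"
  shows "h x = x + (c - m)"
proof -
  have "{c<..<h x} = h ` {m<..<x}"
  proof (intro set_eqI iffI)
    fix t assume t: "t \<in> {c<..<h x}"
    then obtain x' where x': "x' \<in> {m<..c}" "t = h x'" using onto[OF x, of t] by auto
    have "x' < x"
    proof (rule ccontr)
      assume "\<not> x' < x"
      then have "h x \<le> h x'" using mono[of x x'] x x' by (cases "x = x'") auto
      then show False using t x' by simp
    qed
    then show "t \<in> h ` {m<..<x}" using x' by auto
  next
    fix t assume "t \<in> h ` {m<..<x}"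
    then show "t \<in> {c<..<h x}" using mono above x by auto
  qed
  moreover have "inj_on h {m<..<x}"
    by (rule inj_onI)
      (metis greaterThanLessThan_iff less_irrefl less_le_trans linorder_neqE_nat mono x(2) less_imp_le)
  ultimately have "card {c<..<h x} = card {m<..<x}" by (simp add: card_image)
  then show ?thesis using x above[OF x] by simp
qed

text \<open>Each point of \<open>crossings y c\<close> is undercut by its partner, so the bound
  leaves no other undercut points. Hence every arc passes over the gap after \<open>c\<close>, no
  arc is nested in another, and no fixed point lies under an arc.\<close>

lemma undercut_le_crossings:
  assumes y: "y \<in> invs False n" and u: "card (undercut False y) \<le> card (crossings y c)"
  shows "\<exists>m k. y = dprod m id (g k)"
proof -
  have inv: "involution y" by (rule invs_involution[OF y])
  note yy = involutionD[OF inv] and y_eq = involution_eq_iff[OF inv]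
  define X where "X = crossings y c"
  have X: "x \<in> X \<longleftrightarrow> x \<le> c \<and> c < y x" for x by (simp add: X_def crossings_def)
  have "X \<subseteq> undercut False y"
  proof
    fix x assume "x \<in> X"
    then have "x < y x" "y (y x) < y x" using X yy by auto
    then show "x \<in> undercut False y" by (auto simp: undercut_def)
  qed
  then have "undercut False y = X"
    using u by (intro card_seteq[symmetric] finite_undercut[OF y]) (auto simp: X_def)
  then have inX: "j \<in> X" if "j < l" "y l < y j" for j l
    using that unfolding undercut_def by auto
  have left: "x \<in> X" if "x < y x" for x using inX[of x "y x"] that yy by simp
  show ?thesis
  proof (cases "X = {}")
    case True
    have "y x = x" for x using left[of x] left[of "y x"] True yy[of x] by (metis empty_iff linorder_neqE_nat)
    then have "y = dprod 0 id (g 0)" by (auto simp: dprod_def g_def fun_eq_iff)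
    then show ?thesis by blast
  next
    case False
    define a where "a = Min X"
    have finX: "finite X" by (simp add: X_def)
    have a: "a \<in> X" "\<And>x. x \<in> X \<Longrightarrow> a \<le> x" using Min_in[OF finX False] Min_le[OF finX] by (auto simp: a_def)
    have "0 \<notin> X" using X invs_zero[OF y] by simp
    then have "a \<noteq> 0" using a(1) by metis
    define m where "m = a - 1"
    have X_interval: "x \<in> X \<longleftrightarrow> m < x \<and> x \<le> c" for x
    proof
      assume "m < x \<and> x \<le> c"
      then have x: "a \<le> x" "x \<le> c" using \<open>a \<noteq> 0\<close> by (auto simp: m_def)
      show "x \<in> X"
      proof (rule ccontr)
        assume nx: "x \<notin> X"
        then have "y x \<le> x" using left[of x] by linarith
        moreover have "\<not> y x < x"
        proof
          assume "y x < x"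
          then have "y x \<in> X" using left[of "y x"] yy by simp
          then show False using X[of "y x"] x yy by simp
        qed
        ultimately have "y x = x" by simp
        moreover have "a \<noteq> x" using nx a by metis
        ultimately have "x < y a" "y (y a) < y x" using a(1) X[of a] x yy by auto
        then show False using inX nx by blast
      qed
    next
      assume "x \<in> X"
      then show "m < x \<and> x \<le> c" using a(2)[of x] X[of x] \<open>a \<noteq> 0\<close> by (auto simp: m_def)
    qed
    define k where "k = c - m"
    have shift: "y x = x + k" if x: "m < x" "x \<le> c" for x
      unfolding k_def
    proof (rule strict_mono_onto_interval[OF _ _ _ x])
      show "c < y x" if "m < x" "x \<le> c" for x using that X[of x] X_interval[of x] by simp
      show "y x < y x'" if "m < x" "x < x'" "x' \<le> c" for x x'
      proof (rule ccontr)
        assume "\<not> y x < y x'"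
        then have "y x' < y x" using that y_eq[of x x'] by simp
        \<comment> \<open>A nested arc would have an undercut right endpoint, which lies beyond
          \<open>c\<close>.\<close>
        then have "y x' \<in> X" using inX[of "y x'" "y x"] that yy by simp
        moreover have "c < y x'" using that X[of x'] X_interval[of x'] by simp
        ultimately show False using X by simp
      qed
      show "t \<in> y ` {m<..c}" if x: "m < x" "x \<le> c" and t: "c < t" "t < y x" for x t
      proof -
        have nt: "t \<notin> X" using t X by simp
        then have "\<not> t < y t" using left by blast
        moreover have "y t \<noteq> t"
        proof
          assume "y t = t"
          then have "y (y x) < y t" using x t yy by simp
          then show False using inX[of t "y x"] t nt by blast
        qed
        ultimately have "y t < y (y t)" using yy by simp
        then have "y t \<in> X" by (rule left)
        then have "y t \<in> {m<..c}" using X_interval by simp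
        then have "y (y t) \<in> y ` {m<..c}" by (rule imageI)
        then show ?thesis by (simp add: yy)
      qed
    qed
    have "m \<le> c" using a(1) X_interval[of a] by simp
    have unshift: "y x = x - k" if "c < x" "x \<le> c + k" for x
    proof -
      have "y (x - k) = x" using shift[of "x - k"] that \<open>m \<le> c\<close> by (simp add: k_def)
      then show ?thesis using yy by metis
    qed
    have out: "y x = x" if "x \<le> m \<or> c + k < x" for x
    proof (rule ccontr)
      assume "y x \<noteq> x"
      then consider "x < y x" | "y x < y (y x)" using yy by fastforce
      then show False
      proof cases
        case 1
        then have "m < x \<and> x \<le> c" using left X_interval by blast
        then show False using that by auto
      next
        case 2
        then have "m < y x \<and> y x \<le> c" using left X_interval by blast
        then have "x = y x + k" using shift[of "y x"] yy by simp
        then show False using that \<open>m < y x \<and> y x \<le> c\<close> by auto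
      qed
    qed
    have "c = m + k" using \<open>m \<le> c\<close> by (simp add: k_def)
    then have "y x = dprod m id (g k) x" for x
      using shift[of x] unshift[of x] out[of x] by (auto simp: dprod_def g_def)
    then show ?thesis by blast
  qed
qed

text \<open>The points before \<open>x\<close> are matched among themselves. If \<open>x\<close> and
  \<open>Suc x\<close> are not joined, the partner of \<open>x\<close> lies after
  \<open>Suc x\<close> and undercuts it with the value \<open>x\<close>.\<close>

lemma fpf_adjacent:
  assumes z: "z \<in> invs True n" and x: "1 \<le> x" "x \<le> n" and closed: "\<And>u. u < x \<Longrightarrow> z u < x"
    and nu: "Suc x \<notin> undercut True z"
  shows "z x = Suc x"
proof (rule ccontr)
  assume ne: "z x \<noteq> Suc x"
  have inv: "involution z" by (rule invs_involution[OF z])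
  note zz = involutionD[OF inv] and z_eq = involution_eq_iff[OF inv]
  have high: "x \<le> z u" if "x \<le> u" for u
    using closed[of "z u"] that zz by (metis not_le)
  have "z x \<noteq> x" using z x by (auto simp: invs_def)
  then have "Suc x < z x" using high[of x] ne by simp
  moreover have "z (Suc x) \<noteq> x" using ne zz by metis
  then have "x < z (Suc x)" using high[of "Suc x"] by simp
  ultimately have "Suc x \<in> undercut True z"
    using zz[of x] by (auto simp: undercut_def intro!: exI[of _ "z x"])
  with nu show False by blast
qed

text \<open>Peels off neighbouring pairs after a closed initial part; it is used on both sides of
  the block that becomes \<open>g k\<close>.\<close>

lemma fpf_adjacent_pairs:
  assumes z: "z \<in> invs True n" and closed: "\<And>u. u \<le> h \<Longrightarrow> z u \<le> h"
    and nu: "\<And>x. h < x \<Longrightarrow> x < h' \<Longrightarrow> Suc x \<notin> undercut True z" and h': "h' \<le> Suc n"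
  shows "Suc (h + 2 * t) < h' \<Longrightarrow> z (Suc (h + 2 * t)) = Suc (Suc (h + 2 * t))"
proof (induction t rule: less_induct)
  case (less t)
  have inv: "involution z" by (rule invs_involution[OF z])
  show ?case
  proof (rule fpf_adjacent[OF z])
    show "z u < Suc (h + 2 * t)" if u: "u < Suc (h + 2 * t)" for u
    proof (cases "u \<le> h")
      case True
      then show ?thesis using closed[OF True] by simp
    next
      case False
      define q where "q = (u - h - 1) div 2"
      have "u = Suc (h + 2 * q) \<or> u = Suc (Suc (h + 2 * q))" "q < t" using u False by (auto simp: q_def)
      moreover have "z (Suc (h + 2 * q)) = Suc (Suc (h + 2 * q))"
        using less.IH[OF \<open>q < t\<close>] less.prems \<open>q < t\<close> by simp
      moreover from this have "z (Suc (Suc (h + 2 * q))) = Suc (h + 2 * q)"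
        using inv by (metis involutionD)
      ultimately show ?thesis by auto
    qed
  qed (use less.prems h' nu in auto)
qed

text \<open>The partner of the first point \<open>a\<close> of \<open>crossings z c\<close>
  undercuts all the other ones, so nothing else is undercut. As \<open>a\<close> itself is not, no
  arc passes over \<open>a\<close>. The parts outside the block have no undercut points and split
  into neighbouring pairs.\<close>

lemma undercut_less_crossings:
  assumes z: "z \<in> invs True n" and n: "even n" and u: "card (undercut True z) < card (crossings z c)"
  shows "\<exists>m l k. k \<ge> 1 \<and> z = dprod (2*m + 2*k) (dprod (2*m) (v m) (g k)) (v l)"
proof -
  have inv: "involution z" by (rule invs_involution[OF z])
  note zz = involutionD[OF inv] and z_eq = involution_eq_iff[OF inv]
  define X where "X = crossings z c"
  have X: "x \<in> X \<longleftrightarrow> x \<le> c \<and> c < z x" for x by (simp add: X_def crossings_def)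
  have finX: "finite X" by (simp add: X_def)
  have "X \<noteq> {}" using u by (auto simp: X_def)
  define a where "a = Min X"
  have a: "a \<in> X" "\<And>x. x \<in> X \<Longrightarrow> a \<le> x"
    using Min_in[OF finX \<open>X \<noteq> {}\<close>] Min_le[OF finX] by (auto simp: a_def)
  have "X - {a} \<subseteq> undercut True z"
  proof
    fix x assume x: "x \<in> X - {a}"
    then have "a < x" using a(2)[of x] by simp
    moreover have "x < z a" "c < z x" "x \<le> c" using x X[of x] X[of a] a(1) by auto
    ultimately show "x \<in> undercut True z"
      using zz[of a] by (auto simp: undercut_def intro!: exI[of _ "z a"])
  qed
  then have under: "undercut True z = X - {a}"
    using u a(1) finX
    by (intro card_seteq[symmetric] finite_undercut[OF z]) (auto simp: X_def[symmetric])
  have inX: "j \<in> X \<and> j \<noteq> a" if "j < l" "z l < j" "z l < z j" for j l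
  proof -
    have "j \<in> undercut True z" using that by (auto simp: undercut_def)
    then show ?thesis by (simp add: under)
  qed
  have "0 \<notin> X" using X invs_zero[OF z] by simp
  then have "a \<noteq> 0" using a(1) by metis
  have ac: "a \<le> c" "c < z a" using a(1) X by auto
  define m where "m = a - 1"
  have am: "a = Suc m" using \<open>a \<noteq> 0\<close> by (simp add: m_def)
  have no_cross_a: "a < z x" if "a < x" "x \<noteq> z a" for x
  proof (rule ccontr)
    assume "\<not> a < z x"
    moreover have "z x \<noteq> a" using that zz by metis
    ultimately have "z x < a" by simp
    then show False using inX[of a x] that ac by auto
  qed
  have X_interval: "x \<in> X \<longleftrightarrow> m < x \<and> x \<le> c" for x
  proof
    assume "m < x \<and> x \<le> c"
    then have x: "a \<le> x" "x \<le> c" using am by auto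
    show "x \<in> X"
    proof (cases "x = a")
      case False
      then have "a < z x" using x ac by (intro no_cross_a) auto
      then show ?thesis using inX[of x "z a"] False x ac zz[of a] by simp
    qed (simp add: a)
  next
    assume "x \<in> X"
    then show "m < x \<and> x \<le> c" using a(2)[of x] X[of x] am by auto
  qed
  define k where "k = c - m"
  have k: "1 \<le> k" "c = m + k" using ac am by (auto simp: k_def)
  have shift: "z x = x + k" if x: "m < x" "x \<le> c" for x
    unfolding k_def
  proof (rule strict_mono_onto_interval[OF _ _ _ x])
    show above: "c < z x" if "m < x" "x \<le> c" for x using that X[of x] X_interval[of x] by simp
    show "z x < z x'" if "m < x" "x < x'" "x' \<le> c" for x x'
    proof (rule ccontr)
      assume "\<not> z x < z x'"
      then have "z x' < z x" using that z_eq[of x x'] by simp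
      moreover have "c < z x'" using above[of x'] that by simp
      ultimately have "z x' \<in> X" using inX[of "z x'" "z x"] that zz by simp
      then show False using X \<open>c < z x'\<close> by simp
    qed
    show "t \<in> z ` {m<..c}" if x: "m < x" "x \<le> c" and t: "c < t" "t < z x" for x t
    proof -
      have "\<not> x < z t" using inX[of t "z x"] t x X[of t] zz[of x] by auto
      then have "z t \<le> c" using x by simp
      moreover have "m < z t"
      proof (cases "t = z a")
        case True
        then show ?thesis using zz am by simp
      next
        case False
        then have "a < z t" using t ac by (intro no_cross_a) auto
        then show ?thesis using am by simp
      qed
      ultimately have "z (z t) \<in> z ` {m<..c}" by (intro imageI) simp
      then show ?thesis by (simp add: zz)
    qed
  qed
  have unshift: "z x = x - k" if "c < x" "x \<le> c + k" for x
  proof -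
    have "z (x - k) = x" using shift[of "x - k"] that k by simp
    then show ?thesis using zz by metis
  qed
  define h where "h = m + 2 * k"
  have h_le: "h \<le> n"
  proof (rule ccontr)
    assume "\<not> h \<le> n"
    then have "z h = h" by (intro invs_fixed[OF z]) simp
    moreover have "z h = h - k" using k by (intro unshift) (auto simp: h_def)
    ultimately show False using k by (simp add: h_def)
  qed
  have low: "z (Suc (0 + 2 * t)) = Suc (Suc (0 + 2 * t))" if "Suc (0 + 2 * t) < a" for t
  proof (rule fpf_adjacent_pairs[OF z, where h' = a])
    show "Suc x \<notin> undercut True z" if "0 < x" "x < a" for x
      using that a(2)[of "Suc x"] by (auto simp: under)
    show "a \<le> Suc n" using h_le am k by (simp add: h_def)
  qed (use that invs_zero[OF z] in auto)
  \<comment> \<open>Otherwise the pairing from the left would join \<open>m\<close> to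
    \<open>a\<close>.\<close>
  have "even m"
  proof (rule ccontr)
    assume "odd m"
    then obtain t where t: "m = 2 * t + 1" by (blast elim: oddE)
    then have "z m = a" using low[of t] am by simp
    then have "z a = m" using zz by metis
    then show False using ac am by simp
  qed
  then obtain m' where m': "m = 2 * m'" by blast
  have low_v: "z x = v m' x" if "x \<le> m" for x
  proof (cases x rule: fpf_point_cases[where n = m'])
    case (3 t)
    then have "z (Suc (2 * t)) = x" using low[of t] am m' by simp
    then have "z x = Suc (2 * t)" using zz by metis
    then show ?thesis using 3 by (simp add: v_simps)
  qed (use that low am m' invs_zero[OF z] in \<open>auto simp: v_simps\<close>)
  have closed: "z x \<le> h" if x: "x \<le> h" for x
  proof -
    consider "x \<le> m" | "m < x" "x \<le> c" | "c < x" "x \<le> c + k" using x k unfolding h_def by linarith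
    then show ?thesis
    proof cases
      case 1
      then have "z x \<le> m" unfolding low_v[OF 1] m'
        by (cases x rule: fpf_point_cases[where n = m']) (auto simp: v_simps)
      then show ?thesis by (simp add: h_def)
    qed (use shift unshift k in \<open>auto simp: h_def\<close>)
  qed
  have high: "z (Suc (h + 2 * t)) = Suc (Suc (h + 2 * t))" if "Suc (h + 2 * t) < Suc n" for t
  proof (rule fpf_adjacent_pairs[OF z closed])
    show "Suc x \<notin> undercut True z" if "h < x" "x < Suc n" for x
      using that X[of "Suc x"] k by (auto simp: under h_def)
  qed (use that in auto)
  obtain l where l: "n = h + 2 * l"
  proof -
    have "even (n - h)" using n h_le \<open>even m\<close> by (simp add: h_def)
    then show ?thesis using that[of "(n - h) div 2"] h_le by simp
  qed
  have high_v: "z (h + x) = h + v l x" if "0 < x" for x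
  proof (cases x rule: fpf_point_cases[where n = l])
    case (3 t)
    then have "z (Suc (h + 2 * t)) = h + x" using high[of t] l by simp
    then have "z (h + x) = Suc (h + 2 * t)" using zz by metis
    then show ?thesis using 3 by (simp add: v_simps)
  qed (use that high l invs_fixed[OF z] in \<open>auto simp: v_simps\<close>)
  have "z x = dprod (2*m' + 2*k) (dprod (2*m') (v m') (g k)) (v l) x" for x
  proof -
    consider "x \<le> m" | "m < x" "x \<le> c" | "c < x" "x \<le> c + k" | "h < x" using k unfolding h_def by linarith
    then show ?thesis
    proof cases
      case 1
      then show ?thesis using low_v[OF 1] m' by (simp add: dprod_def)
    next
      case 4
      then show ?thesis using high_v[of "x - h"] m' by (simp add: dprod_def h_def)
    qed (use shift[of x] unshift[of x] m' k in \<open>auto simp: dprod_def g_def\<close>)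
  qed
  then show ?thesis using k(1) by blast
qed

lemma maximal_crossings:
  assumes "y \<in> invs f n"
  obtains c where "\<And>j. card (crossings y j) \<le> card (crossings y c)"
proof -
  let ?K = "(\<lambda>j. card (crossings y j)) ` {..n}"
  obtain c where c: "c \<le> n" "card (crossings y c) = Max ?K"
    using Max_in[of ?K] by fastforce
  have "card (crossings y j) \<le> card (crossings y c)" for j
  proof (cases "j \<le> n")
    case True
    then show ?thesis using c(2) by simp
  next
    case False
    then show ?thesis using crossings_outside[OF assms, of j] by simp
  qed
  then show ?thesis by (rule that)
qed

theorem theorem3p35:
  fixes y z :: "nat \<Rightarrow> nat"
  assumes "y \<in> invols" and "z \<in> fpf_invols"
  shows "(is_Schur_function (Fhat y) \<longleftrightarrow> (\<exists>m k. y = dprod m id (g k))) \<and>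
         (is_Schur_function (Fhat_FPF z) \<longleftrightarrow>
            (\<exists>m n k. k \<ge> 1 \<and> z = dprod (2*m + 2*k) (dprod (2*m) (v m) (g k)) (v n)))"
proof (intro conjI iffI)
  obtain N where y: "y \<in> invs False N" using assms(1) invols_iff by blast
  have Fy: "Fhat y = Fhat_rel (base False N) y" by (simp add: Fhat_def base_def)
  show "\<exists>m k. y = dprod m id (g k)" if S: "is_Schur_function (Fhat y)"
  proof -
    obtain p where p: "is_partition p" "Fhat_rel (base False N) y = schur p"
      using S Fy unfolding is_Schur_function_def by auto
    obtain c where c: "\<And>j. card (crossings y j) \<le> card (crossings y c)"
      by (rule maximal_crossings[OF y]) blast
    have "length p \<le> card (crossings y c)"
      by (rule partition_length_le_runs[OF y _ p run_path_crossings[OF y]]) (use c in auto)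
    moreover have "card (undercut False y) \<le> length p"
      by (rule undercut_le_partition_length[OF y _ p]) auto
    ultimately show ?thesis by (intro undercut_le_crossings[OF y, of c]) simp
  qed
  show "is_Schur_function (Fhat y)" if "\<exists>m k. y = dprod m id (g k)"
    using that y Fy Fhat_dprod_id_g is_partition_stair unfolding is_Schur_function_def by metis
next
  obtain M where M: "1 \<le> M" "z \<in> fpf_invols_on M" using assms(2) by (auto simp: fpf_invols_def)
  then have z: "z \<in> invs True (2 * M)" by (simp add: fpf_invols_on_iff)
  have Fz: "Fhat_FPF z = Fhat_rel (base True (2 * M)) z"
    using Fhat_FPF_eq[OF M(2)] by (simp add: base_def)
  show "\<exists>m n k. k \<ge> 1 \<and> z = dprod (2*m + 2*k) (dprod (2*m) (v m) (g k)) (v n)"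
    if S: "is_Schur_function (Fhat_FPF z)"
  proof -
    obtain p where p: "is_partition p" "Fhat_rel (base True (2 * M)) z = schur p"
      using S Fz unfolding is_Schur_function_def by auto
    obtain c where c: "\<And>j. card (crossings z j) \<le> card (crossings z c)"
      by (rule maximal_crossings[OF z]) blast
    \<comment> \<open>An arc exists, so the subtraction of one from the number of crossings below is
      not truncated.\<close>
    have "1 < z 1"
    proof -
      have "z 1 \<noteq> 1" using z M(1) by (simp add: invs_def)
      then show ?thesis using invs_pos[OF z, of 1] by simp
    qed
    then have "1 \<in> crossings z 1" by (simp add: crossings_def)
    then have "0 < card (crossings z 1)" by (auto simp: card_gt_0_iff)
    then have pos: "0 < card (crossings z c)" using c[of 1] by simp
    have "length p \<le> card (crossings z c) - 1"
      by (rule partition_length_le_runs[OF z _ p run_path_crossings[OF z]]) (use c pos in auto)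
    moreover have "card (undercut True z) \<le> length p"
      by (rule undercut_le_partition_length[OF z _ p]) auto
    ultimately have "card (undercut True z) < card (crossings z c)" using pos by simp
    then show ?thesis using undercut_less_crossings[OF z] by fastforce
  qed
  show "is_Schur_function (Fhat_FPF z)"
    if ex: "\<exists>m n k. k \<ge> 1 \<and> z = dprod (2*m + 2*k) (dprod (2*m) (v m) (g k)) (v n)"
  proof -
    obtain m n k where k: "1 \<le> k" and eq: "z = dprod (2*m + 2*k) (dprod (2*m) (v m) (g k)) (v n)"
      using ex by blast
    have moved: "z x \<noteq> x \<longleftrightarrow> 1 \<le> x \<and> x \<le> 2 * (m + k + n)" for x
      unfolding eq dprod_def g_def v_def using k by auto
    \<comment> \<open>The number of moved points identifies the base point that belongs to
      \<open>z\<close>.\<close>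
    have "moved z = {1..2 * (m + k + n)}" by (auto simp: moved_def moved)
    from trans[OF this[symmetric] moved_fpf[OF z]] have "card {1..2 * (m + k + n)} = card {1..2 * M}" by (rule arg_cong)
    then have "M = m + k + n" by simp
    then have "Fhat_FPF z = schur (stair_partition (k - 1))"
      using Fhat_dprod_v_g_v[OF k, of m n] z Fz eq by simp
    then show ?thesis using is_partition_stair unfolding is_Schur_function_def by blast
  qed
qed

end
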